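(* Suppose that $V(x)=\|x\|^\delta$ on $\mathbb R^d$ with $\delta>0$, $\theta_j=j^\gamma$ with $\gamma<0$, and that $1<\frac d\delta<\gamma+2$. If $\rho>\rho_{\rm c}$, then as $n,L\to\infty$ with $n=\rho L^d$, under $\mathbb P_{L,n}$, $$\frac{H_0-(\rho-\rho_{\rm c}^L)L^d}{L^\alpha}\longrightarrow Z\quad\text{in distribution},\qquad\alpha=\frac{\delta}{1-\delta\gamma/d},$$ where $Z$ is the stable random variable whose Laplace transform for $t\ge0$ is $$\mathbb E\,e^{tZ}=\exp\bigl(b_{\gamma,\delta,d}\,t^{|\gamma|+d/\delta}\bigr),$$ with $$b_{\gamma,\delta,d}=-\frac{\Gamma(1+\gamma)}{|\gamma|}\int_{\mathbb R^d}\Bigl(\bigl(1+\|x\|^\delta\bigr)^{|\gamma|}-\|x\|^{\delta|\gamma|}-|\gamma|\,\|x\|^{-\delta(1+\gamma)}\Bigr)dx>0.$$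
   Context: A spatial partition of $n$ is a family $\boldsymbol\lambda=(\lambda_x)_{x\in\mathbb Z^d}$ of integer partitions (possibly empty) whose parts sum in total to $n$; $\Lambda_n$ is the set of these. $r_{xj}(\boldsymbol\lambda)$ is the number of parts of $\lambda_x$ equal to $j$; $H_x=\sum_jj\,r_{xj}$, so $H_0$ is the occupation of the origin. The probability measure on $\Lambda_n$ is $$\mathbb P_{L,n}(\boldsymbol\lambda)=\frac1{Z_{L,n}}\prod_{x\in\mathbb Z^d}\prod_{j\ge1}\frac1{r_{xj}(\boldsymbol\lambda)!}\Bigl(\frac{\theta_j}{j}e^{-jV(x/L)}\Bigr)^{r_{xj}(\boldsymbol\lambda)},$$ with $Z_{L,n}$ the normalization. Further $$\rho_{\rm c}=\sum_{j\ge1}\theta_j\int_{\mathbb R^d}e^{-jV(x)}dx,\qquad\rho_{\rm c}^L=\frac1{L^d}\sum_{j\ge1}\sum_{x\in\mathbb Z^d\setminus\{0\}}\theta_je^{-jV(x/L)}.$$ $\|\cdot\|$ is the Euclidean norm. *)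

theory Defs
  imports "HOL-Probability.Probability" "HOL-Library.Multiset"
begin

text \<open>
  An integer partition is the multiset of its (positive) parts; a family of partitions over the
  lattice \<open>\<int>\<^sup>d\<close> is a function on \<open>int ^ 'd\<close>, with \<open>d = CARD('d)\<close>.
\<close>

type_synonym 'd partition_family = "int ^ 'd \<Rightarrow> nat multiset"

definition part_mult :: "'d partition_family \<Rightarrow> int ^ 'd \<Rightarrow> nat \<Rightarrow> nat" where
  "part_mult p x j = count (p x) j"

definition occupation :: "'d partition_family \<Rightarrow> int ^ 'd \<Rightarrow> nat" where
  "occupation p x = (\<Sum>j\<in>set_mset (p x). j * part_mult p x j)"

definition part_supp :: "'d partition_family \<Rightarrow> (int ^ 'd) set" where
  "part_supp p = {x. p x \<noteq> {#}}"

definition spatial_partitions :: "nat \<Rightarrow> ('d::finite) partition_family set" where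
  "spatial_partitions n =
     {p. (\<forall>x. \<forall>j\<in>#p x. j \<ge> 1) \<and> finite (part_supp p) \<and> (\<Sum>x\<in>part_supp p. occupation p x) = n}"

definition scaled_site :: "real \<Rightarrow> int ^ 'd \<Rightarrow> real ^ ('d::finite)" where
  "scaled_site L x = (\<chi> i. real_of_int (x $ i) / L)"

text \<open>
  The product over all sites \<open>x\<close> and all \<open>j \<ge> 1\<close> is restricted to the pairs with
  \<open>part_mult p x j > 0\<close>; all other factors equal \<open>1\<close>.
\<close>

definition weight ::
  "(nat \<Rightarrow> real) \<Rightarrow> (real ^ 'd \<Rightarrow> real) \<Rightarrow> real \<Rightarrow> ('d::finite) partition_family \<Rightarrow> real" where
  "weight \<theta> V L p = (\<Prod>x\<in>part_supp p. \<Prod>j\<in>set_mset (p x).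
     1 / fact (part_mult p x j) *
     (\<theta> j / real j * exp (- real j * V (scaled_site L x))) ^ part_mult p x j)"

definition partition_fun ::
  "(nat \<Rightarrow> real) \<Rightarrow> (real ^ 'd::finite \<Rightarrow> real) \<Rightarrow> real \<Rightarrow> nat \<Rightarrow> real" where
  "partition_fun \<theta> V L n = (\<Sum>\<^sub>\<infinity>p\<in>spatial_partitions n. weight \<theta> V L p)"

definition spatial_measure ::
  "(nat \<Rightarrow> real) \<Rightarrow> (real ^ 'd \<Rightarrow> real) \<Rightarrow> real \<Rightarrow> nat \<Rightarrow> ('d::finite) partition_family measure" where
  "spatial_measure \<theta> V L n =
     point_measure (spatial_partitions n) (\<lambda>p. ennreal (weight \<theta> V L p / partition_fun \<theta> V L n))"

definition rho_crit :: "(nat \<Rightarrow> real) \<Rightarrow> (real ^ 'd::finite \<Rightarrow> real) \<Rightarrow> real" where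
  "rho_crit \<theta> V = (\<Sum>\<^sub>\<infinity>j\<in>{1..}. \<theta> j * (\<integral>x. exp (- real j * V x) \<partial>lborel))"

definition rho_crit_scaled :: "(nat \<Rightarrow> real) \<Rightarrow> (real ^ 'd::finite \<Rightarrow> real) \<Rightarrow> real \<Rightarrow> real" where
  "rho_crit_scaled \<theta> V L =
     1 / L ^ CARD('d) *
     (\<Sum>\<^sub>\<infinity>j\<in>{1..}. \<Sum>\<^sub>\<infinity>x\<in>UNIV - {0}. \<theta> j * exp (- real j * V (scaled_site L x)))"

definition stable_coeff :: "'d::finite itself \<Rightarrow> real \<Rightarrow> real \<Rightarrow> real" where
  "stable_coeff (_ :: 'd itself) \<gamma> \<delta> =
     - (Gamma (1 + \<gamma>) / \<bar>\<gamma>\<bar>) *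
     (\<integral>x. ((1 + norm x powr \<delta>) powr \<bar>\<gamma>\<bar> - norm x powr (\<delta> * \<bar>\<gamma>\<bar>)
            - \<bar>\<gamma>\<bar> * norm x powr (- \<delta> * (1 + \<gamma>))) \<partial>(lborel :: (real ^ 'd) measure))"

text \<open>
  If \<open>X\<close>, \<open>Y\<close> are independent with law \<open>\<mu>\<close> and \<open>a, b > 0\<close>, then \<open>a X + b Y\<close> has the law of
  \<open>c X + s\<close> for some \<open>c > 0\<close> and real \<open>s\<close>.
\<close>

definition stable_distribution :: "real measure \<Rightarrow> bool" where
  "stable_distribution \<mu> \<longleftrightarrow> real_distribution \<mu> \<and>
     (\<forall>a>0. \<forall>b>0. \<exists>c>0. \<exists>s.
        distr \<mu> borel (\<lambda>x. a * x) \<star> distr \<mu> borel (\<lambda>x. b * x) = distr \<mu> borel (\<lambda>x. c * x + s))"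

end

theory Submission
  imports Defs
begin

text \<open>
Write \<open>d\<close> for the dimension, \<open>a = d / \<delta>\<close> and \<open>s = a - \<gamma>\<close>; the hypotheses say \<open>1 < a < \<gamma> + 2\<close>,
so \<open>-1 < \<gamma> < 0\<close> and \<open>1 < s < 2\<close>, and the scaling exponent is \<open>\<alpha> = d / s\<close>.

Without the constraint on the total size, the multiplicities under the product weights are
independent Poisson variables. Since \<open>V 0 = 0\<close>, the site \<open>0\<close> contributes the coefficients
\<open>c\<^sub>m\<close> of \<open>exp (\<Sum>j. j powr (\<gamma> - 1) * w ^ j)\<close>, and the other sites together contribute the
coefficients \<open>q\<^sub>h\<close> of \<open>exp (\<Sum>j. j powr (\<gamma> - 1) * \<Theta> (j / L powr \<delta>) * w ^ j)\<close>, where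
\<open>\<Theta> v = (\<Sum>x \<noteq> 0. exp (- v * norm x powr \<delta>))\<close>. Marking one part of a spatial partition gives a
recursion that characterises these coefficients. Hence the law of \<open>H\<^sub>0\<close> is
\<open>P(H\<^sub>0 = m) = c\<^sub>m q\<^bsub>n - m\<^esub> / Z\<close> (\<open>occupation_law\<close>). Let \<open>H'\<close> have the normalised law
\<open>q\<close>; its mean is \<open>rho_crit_scaled \<theta> V L * L ^ d\<close>, so \<open>H\<^sub>0\<close> centred as in the theorem is
\<open>- (H' - E H')\<close> reweighted by \<open>c\<^bsub>n - H'\<^esub>\<close>. Two facts give the theorem.

First, \<open>- (H' - E H') / L powr \<alpha>\<close> converges to a stable law. For \<open>Re z \<ge> 0\<close> its transform at
\<open>z\<close> is the exponential of
\<open>\<Sum>j. j powr (\<gamma> - 1) * \<Theta> (j / L powr \<delta>) * (exp (- z y) - 1 + z y)\<close>, \<open>y = j / L powr \<alpha>\<close>.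
Counting lattice points in balls gives \<open>\<Theta> v ~ C v powr (- a)\<close> as \<open>v \<rightarrow> 0\<close>, and because
\<open>\<alpha> < \<delta>\<close> only small \<open>v\<close> matter on the scale \<open>y\<close>. So the sum is a Riemann sum
with limit \<open>\<Psi> z = C * integral of y powr (- s - 1) * (exp (- z y) - 1 + z y)\<close> over \<open>y > 0\<close>
(\<open>rate_series_limit\<close>). The function \<open>\<Psi>\<close> is homogeneous of degree \<open>s\<close>, which makes the limit
stable; its value at \<open>1\<close> is \<open>stable_coeff\<close> by Tonelli's theorem. Imaginary \<open>z\<close> give weak
convergence by Levy's continuity theorem, real \<open>z\<close> give the Laplace transform. The limit law itself
is a subsequential limit, which exists because centring and \<open>\<bar>x\<bar> \<le> 2 exp x - x\<close> give tightness.

Second, the reweighting is asymptotically trivial. The coefficients satisfy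
\<open>c\<^sub>m ~ C' m powr (\<gamma> - 1)\<close> (\<open>exp_coeff_powr_asymp\<close>), a function that varies slowly at the scale
\<open>L powr \<alpha>\<close> around \<open>n - E H'\<close>, which is of order \<open>L powr d\<close> as \<open>\<rho>\<close> exceeds the critical
density. The only danger is \<open>n - H'\<close> much smaller than its mean, where \<open>c\<close> is polynomially larger;
there an exponential moment of \<open>H' - E H'\<close> at \<open>1 / (2 L powr \<delta>)\<close>, bounded uniformly in \<open>L\<close>,
gives a probability of order \<open>exp (- const * L powr (d - \<delta>))\<close>. So the normalised weight tends
to \<open>1\<close> in mean (\<open>tilt_expectation_limit\<close>), and the conditioned and unconditioned laws have the same
limit.
\<close>

section \<open>Coefficients of the exponential of a power series\<close>

text \<open>
The coefficients of \<open>exp (\<Sum>j. (a j / j) * w ^ j)\<close>. With this normalisation the recursion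
\<open>exp_coeff_rec\<close> has integral weights, and it is the recursion that marking a part of a partition
produces.
\<close>

definition exp_coeff :: "(nat \<Rightarrow> real) \<Rightarrow> nat \<Rightarrow> real" where
  "exp_coeff a = fps_nth (fps_exp 1 oo Abs_fps (\<lambda>j. a j / real j))"

lemma exp_coeff_0: "exp_coeff a 0 = 1"
  by (simp add: exp_coeff_def fps_compose_nth)

text \<open>
Compare coefficients in \<open>E' = E * B'\<close> for \<open>E = exp B\<close>.
\<close>

lemma exp_coeff_rec:
  "real n * exp_coeff a n = (\<Sum>j=1..n. a j * exp_coeff a (n - j))"
proof (cases n)
  case (Suc m)
  define B where "B = Abs_fps (\<lambda>j. a j / real j)"
  have B0: "fps_nth B 0 = 0" by (simp add: B_def)
  have d: "fps_deriv (fps_exp 1 oo B) = (fps_exp 1 oo B) * fps_deriv B"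
    using fps_compose_deriv[OF B0, of "fps_exp 1"] by simp
  have "real n * exp_coeff a n = fps_nth (fps_deriv (fps_exp 1 oo B)) m"
    by (simp add: Suc exp_coeff_def B_def)
  also have "\<dots> = (\<Sum>i=0..m. exp_coeff a i * a (Suc (m - i)))"
    unfolding d by (simp add: fps_mult_nth exp_coeff_def B_def)
  also have "\<dots> = (\<Sum>j=1..n. a j * exp_coeff a (n - j))"
    by (rule sum.reindex_bij_witness[of _ "\<lambda>j. n - j" "\<lambda>i. n - i"])
       (auto simp: Suc Suc_diff_le)
  finally show ?thesis .
qed auto

lemma exp_coeff_unique:
  assumes "W 0 = 1" "\<And>n. n > 0 \<Longrightarrow> real n * W n = (\<Sum>j=1..n. a j * W (n - j))"
  shows "W n = exp_coeff a n"
proof (induction n rule: less_induct)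
  case (less n)
  show ?case
  proof (cases "n = 0")
    case False
    then have "real n * W n = real n * exp_coeff a n"
      using assms(2)[of n] exp_coeff_rec[of n a] less by simp
    with False show ?thesis by simp
  qed (simp add: assms(1) exp_coeff_0)
qed

lemma exp_coeff_nonneg:
  assumes "\<And>j. j \<ge> 1 \<Longrightarrow> a j \<ge> 0"
  shows "exp_coeff a n \<ge> 0"
proof (induction n rule: less_induct)
  case (less n)
  show ?case
  proof (cases "n = 0")
    case False
    have "real n * exp_coeff a n \<ge> 0"
      unfolding exp_coeff_rec using assms less by (intro sum_nonneg mult_nonneg_nonneg) auto
    with False show ?thesis by (simp add: zero_le_mult_iff)
  qed (simp add: exp_coeff_0)
qed

text \<open>
Iterated Cauchy products. The bound on the sum of norms is what makes the expansion of the
exponential absolutely convergent as a double series.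
\<close>

lemma power_series_pow_sums:
  fixes B :: "real fps" and w :: "'a::{real_normed_field,banach}"
  assumes S: "summable (\<lambda>k. norm (of_real (fps_nth B k) * w ^ k))"
  defines "s \<equiv> (\<Sum>k. norm (of_real (fps_nth B k) * w ^ k))"
  shows "summable (\<lambda>k. norm (of_real (fps_nth (B ^ N) k) * w ^ k))
     \<and> (\<Sum>k. norm (of_real (fps_nth (B ^ N) k) * w ^ k)) \<le> s ^ N
     \<and> (\<lambda>k. of_real (fps_nth (B ^ N) k) * w ^ k) sums (\<Sum>k. of_real (fps_nth B k) * w ^ k) ^ N"
proof (induction N)
  case 0
  have 1: "(\<lambda>k. of_real (fps_nth (B ^ 0) k) * w ^ k) = (\<lambda>k. if k = 0 then 1 else 0)"
    by auto
  have 2: "(\<lambda>k. norm (of_real (fps_nth (B ^ 0) k) * w ^ k)) = (\<lambda>k. if k = 0 then 1 else 0)"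
    by auto
  show ?case
    unfolding 1 2 using sums_single[of 0 "\<lambda>_. 1::'a"] sums_single[of 0 "\<lambda>_. 1::real"]
    by (simp add: sums_iff)
next
  case (Suc N)
  let ?f = "\<lambda>k. of_real (fps_nth B k) * w ^ k" and ?g = "\<lambda>k. of_real (fps_nth (B ^ N) k) * w ^ k"
  have eq: "(\<Sum>i\<le>k. ?f i * ?g (k - i)) = of_real (fps_nth (B ^ Suc N) k) * w ^ k" for k
  proof -
    have "(\<Sum>i\<le>k. ?f i * ?g (k - i)) = (\<Sum>i\<le>k. of_real (fps_nth B i * fps_nth (B^N) (k - i)) * w ^ k)"
      by (intro sum.cong) (auto simp: algebra_simps simp flip: power_add)
    then show ?thesis
      by (simp add: fps_mult_nth sum_distrib_right atLeast0AtMost)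
  qed
  have "(\<lambda>k. \<Sum>i\<le>k. ?f i * ?g (k - i)) sums ((\<Sum>k. ?f k) * (\<Sum>k. ?g k))"
    using Suc S by (intro Cauchy_product_sums) auto
  then have 1: "(\<lambda>k. of_real (fps_nth (B ^ Suc N) k) * w ^ k) sums (\<Sum>k. ?f k) ^ Suc N"
    unfolding eq using Suc by (simp add: sums_iff)
  have c: "(\<lambda>k. \<Sum>i\<le>k. norm (?f i) * norm (?g (k - i))) sums (s * (\<Sum>k. norm (?g k)))"
    unfolding s_def using Suc S by (intro Cauchy_product_sums) auto
  have le: "norm (of_real (fps_nth (B ^ Suc N) k) * w ^ k) \<le> (\<Sum>i\<le>k. norm (?f i) * norm (?g (k - i)))" for k
    unfolding eq[symmetric] norm_mult[symmetric] by (rule norm_sum)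
  have 2: "summable (\<lambda>k. norm (of_real (fps_nth (B ^ Suc N) k) * w ^ k))"
    by (rule summable_comparison_test'[OF sums_summable[OF c], of 0]) (use le in auto)
  have "s \<ge> 0" unfolding s_def by (intro suminf_nonneg S) auto
  have "(\<Sum>k. norm (of_real (fps_nth (B ^ Suc N) k) * w ^ k)) \<le> s * (\<Sum>k. norm (?g k))"
    using suminf_le[OF le 2 sums_summable[OF c]] c by (simp add: sums_iff)
  also have "\<dots> \<le> s * s ^ N"
    using Suc \<open>s \<ge> 0\<close> by (intro mult_left_mono) auto
  finally show ?case using 1 2 by simp
qed

text \<open>
Expand \<open>exp\<close> and then every power of the inner series, and exchange the two absolutely convergent
sums. No disc of convergence enters, so \<open>w\<close> may lie on its boundary; characteristic functions
need \<open>\<bar>w\<bar> = 1\<close>.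
\<close>

lemma exp_coeff_sums:
  fixes w :: "'a::{real_normed_field,banach}"
  assumes S: "summable (\<lambda>j. norm (of_real (a j / real j) * w ^ j))"
  shows "summable (\<lambda>k. norm (of_real (exp_coeff a k) * w ^ k))"
    and "(\<lambda>k. of_real (exp_coeff a k) * w ^ k) sums exp (\<Sum>j. of_real (a j / real j) * w ^ j)"
proof -
  define B where "B = Abs_fps (\<lambda>j. a j / real j)"
  have B0: "fps_nth B 0 = 0" by (simp add: B_def)
  have S': "summable (\<lambda>k. norm (of_real (fps_nth B k) * w ^ k))"
    using S by (simp add: B_def)
  define s where "s = (\<Sum>k. norm (of_real (fps_nth B k) * w ^ k))"
  note P = power_series_pow_sums[OF S', folded s_def]
  define F where "F = (\<lambda>(N, k). of_real (fps_nth (B ^ N) k / fact N) * w ^ k :: 'a)"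
  have nF: "norm (F (N, k)) = norm (of_real (fps_nth (B ^ N) k) * w ^ k) / fact N" for N k
    unfolding F_def by (simp add: norm_mult norm_divide)
  have hs: "((\<lambda>k. F (N, k)) has_sum ((\<Sum>j. of_real (a j / real j) * w ^ j) ^ N / fact N)) UNIV" for N
  proof (rule norm_summable_imp_has_sum)
    show "summable (\<lambda>k. norm (F (N, k)))"
      unfolding nF using P[of N] by (intro summable_divide) auto
    have "(\<lambda>k. of_real (fps_nth (B ^ N) k) * w ^ k / fact N) sums ((\<Sum>j. of_real (a j / real j) * w ^ j) ^ N / fact N)"
      using P[of N] by (intro sums_divide) (auto simp: B_def)
    then show "(\<lambda>k. F (N, k)) sums ((\<Sum>j. of_real (a j / real j) * w ^ j) ^ N / fact N)"
      by (simp add: F_def)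
  qed
  have hsn: "((\<lambda>k. norm (F (N, k))) has_sum ((\<Sum>k. norm (of_real (fps_nth (B ^ N) k) * w ^ k)) / fact N)) UNIV" for N
    unfolding nF using P[of N]
    by (intro norm_summable_imp_has_sum sums_divide) (auto simp: summable_divide)
  have abs: "(\<lambda>x. norm (F x)) summable_on (UNIV \<times> UNIV)"
  proof (rule summable_on_SigmaI[OF hsn])
    have "summable (\<lambda>N. s ^ N / fact N)"
      using summable_exp[of s] by (simp add: divide_inverse mult.commute)
    then have "(\<lambda>N. s ^ N / fact N) summable_on UNIV"
    proof (intro norm_summable_imp_summable_on)
      have "s \<ge> 0" unfolding s_def by (intro suminf_nonneg S') auto
      then have "norm (s ^ N / fact N) = s ^ N / fact N" for N by simp
      then show "summable (\<lambda>N. s ^ N / fact N) \<Longrightarrow> summable (\<lambda>N. norm (s ^ N / fact N))" by simp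
    qed
    then show "(\<lambda>N. (\<Sum>k. norm (of_real (fps_nth (B ^ N) k) * w ^ k)) / fact N) summable_on UNIV"
      by (rule summable_on_comparison_test)
         (use P in \<open>auto intro!: divide_right_mono divide_nonneg_nonneg suminf_nonneg\<close>)
  qed auto
  have sF: "F summable_on (UNIV \<times> UNIV)"
    using abs by (rule abs_summable_summable)
  have fin: "(\<Sum>\<^sub>\<infinity>N. F (N, k)) = of_real (exp_coeff a k) * w ^ k" for k
  proof -
    have "(\<Sum>\<^sub>\<infinity>N. F (N, k)) = (\<Sum>\<^sub>\<infinity>N\<in>{0..k}. F (N, k))"
      by (rule infsum_cong_neutral)
         (use B0 in \<open>auto simp: F_def startsby_zero_power_prefix\<close>)
    also have "\<dots> = of_real (exp_coeff a k) * w ^ k"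
      by (simp add: F_def exp_coeff_def fps_compose_nth B_def sum_distrib_left divide_inverse mult_ac)
    finally show ?thesis .
  qed
  have tot: "(F has_sum exp (\<Sum>j. of_real (a j / real j) * w ^ j)) (UNIV \<times> UNIV)"
  proof -
    have "(\<lambda>N. (\<Sum>j. of_real (a j / real j) * w ^ j) ^ N / fact N) sums exp (\<Sum>j. of_real (a j / real j) * w ^ j)"
      using exp_converges[of "(\<Sum>j. of_real (a j / real j) * w ^ j)"]
      by (simp add: scaleR_conv_of_real divide_inverse mult.commute)
    moreover have "((\<lambda>N. (\<Sum>j. of_real (a j / real j) * w ^ j) ^ N / fact N) has_sum infsum F (UNIV \<times> UNIV)) UNIV"
      by (rule has_sum_SigmaD[OF has_sum_infsum[OF sF]]) (use hs in auto)
    ultimately have "infsum F (UNIV \<times> UNIV) = exp (\<Sum>j. of_real (a j / real j) * w ^ j)"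
      using has_sum_imp_sums sums_unique2 by blast
    then show ?thesis using has_sum_infsum[OF sF] by simp
  qed
  let ?S = "exp (\<Sum>j. of_real (a j / real j) * w ^ j)"
  have tot': "((\<lambda>(k, N). F (N, k)) has_sum ?S) (UNIV \<times> UNIV)"
    using tot by (subst (asm) has_sum_swap) auto
  have abs': "(\<lambda>(k, N). F (N, k)) abs_summable_on (UNIV \<times> UNIV)"
    using abs by (subst (asm) summable_on_swap) (auto simp: case_prod_unfold)
  have rows: "(\<lambda>N. norm (F (N, k))) summable_on UNIV" for k
    using iffD1[OF Infinite_Sum.abs_summable_on_Sigma_iff abs'] by simp
  have main: "((\<lambda>k. of_real (exp_coeff a k) * w ^ k) has_sum ?S) UNIV"
    by (rule has_sum_SigmaD[OF tot'])
       (use has_sum_infsum[OF abs_summable_summable[OF rows]] in \<open>auto simp: fin\<close>)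
  have "(\<lambda>k. \<Sum>\<^sub>\<infinity>N. norm (F (N, k))) summable_on UNIV"
    using conjunct2[OF iffD1[OF Infinite_Sum.abs_summable_on_Sigma_iff abs'], THEN abs_summable_summable] by simp
  then have "(\<lambda>k. norm (of_real (exp_coeff a k) * w ^ k)) summable_on UNIV"
    by (rule summable_on_comparison_test)
       (use norm_infsum_bound[OF rows] in \<open>auto simp: fin\<close>)
  then show "summable (\<lambda>k. norm (of_real (exp_coeff a k) * w ^ k))"
    by (rule summable_on_imp_summable)
  show "(\<lambda>k. of_real (exp_coeff a k) * w ^ k) sums ?S"
    using main by (rule has_sum_imp_sums)
qed

section \<open>Enumeration of spatial partitions\<close>

text \<open>
The part of \<open>weight\<close> that belongs to one site, with general Poisson parameters \<open>b j\<close>.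
\<close>

definition mset_weight :: "(nat \<Rightarrow> real) \<Rightarrow> nat multiset \<Rightarrow> real" where
  "mset_weight b M = (\<Prod>j\<in>set_mset M. b j ^ count M j / fact (count M j))"

definition family_weight :: "(int ^ 'd \<Rightarrow> nat \<Rightarrow> real) \<Rightarrow> 'd partition_family \<Rightarrow> real" where
  "family_weight b p = (\<Prod>x\<in>part_supp p. mset_weight (b x) (p x))"

text \<open>
Restricting the sites to a set \<open>X\<close> treats the origin (\<open>X = {0}\<close>) and its complement alike.
\<close>

definition partitions_on :: "(int ^ 'd) set \<Rightarrow> nat \<Rightarrow> ('d::finite) partition_family set" where
  "partitions_on X n = {p \<in> spatial_partitions n. part_supp p \<subseteq> X}"

lemma mset_weight_superset:
  assumes "finite T" "set_mset M \<subseteq> T"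
  shows "mset_weight b M = (\<Prod>j\<in>T. b j ^ count M j / fact (count M j))"
  unfolding mset_weight_def using assms
  by (intro prod.mono_neutral_left) (auto simp: not_in_iff)

lemma mset_weight_add:
  "mset_weight b (add_mset j M) * real (Suc (count M j)) = b j * mset_weight b M"
proof -
  define T where "T = insert j (set_mset M)"
  have T: "finite T" "j \<in> T" "set_mset M \<subseteq> T" "set_mset (add_mset j M) \<subseteq> T"
    by (auto simp: T_def)
  have "(\<Prod>i\<in>T - {j}. b i ^ count (add_mset j M) i / fact (count (add_mset j M) i))
      = (\<Prod>i\<in>T - {j}. b i ^ count M i / fact (count M i))"
    by (intro prod.cong) auto
  then show ?thesis
    unfolding mset_weight_superset[OF T(1,3)] mset_weight_superset[OF T(1,4)]
      prod.remove[OF T(1,2)]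
    by (simp add: field_simps del: of_nat_Suc fact_Suc) (simp add: field_simps)
qed

lemma family_weight_superset:
  assumes "finite S" "part_supp p \<subseteq> S"
  shows "family_weight b p = (\<Prod>x\<in>S. mset_weight (b x) (p x))"
  unfolding family_weight_def using assms
  by (intro prod.mono_neutral_left) (auto simp: part_supp_def mset_weight_def)

text \<open>
Mecke's formula for the weights: removing a marked part \<open>j\<close> at \<open>x\<close> costs exactly one factor
\<open>b x j\<close>, because the multiplicity of the marking cancels against the factorial.
\<close>

lemma family_weight_add:
  assumes "finite (part_supp p)"
  shows "family_weight b (p(x := add_mset j (p x))) * real (Suc (count (p x) j)) = b x j * family_weight b p"
proof -
  define S where "S = insert x (part_supp p)"
  have S: "finite S" "x \<in> S" "part_supp p \<subseteq> S" "part_supp (p(x := add_mset j (p x))) \<subseteq> S"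
    using assms by (auto simp: S_def part_supp_def)
  have eq: "(\<Prod>y\<in>S - {x}. mset_weight (b y) ((p(x := add_mset j (p x))) y))
      = (\<Prod>y\<in>S - {x}. mset_weight (b y) (p y))"
    by (intro prod.cong) auto
  show ?thesis
    unfolding family_weight_superset[OF S(1,3)] family_weight_superset[OF S(1,4)]
      prod.remove[OF S(1,2)] eq
    using mset_weight_add[of "b x" j "p x"] by (simp del: of_nat_Suc) 
qed

lemma weight_eq_family_weight:
  "weight \<theta> V L p = family_weight (\<lambda>x j. \<theta> j / real j * exp (- real j * V (scaled_site L x))) p"
  by (simp add: weight_def family_weight_def mset_weight_def part_mult_def)

lemma sum_mset_eq_sum_count: "(\<Sum>j\<in>set_mset M. j * count M j) = \<Sum>\<^sub># (M :: nat multiset)"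
proof -
  have "(\<Sum>j\<in>T. j * count M j) = \<Sum>\<^sub># M" if "finite T" "set_mset M \<subseteq> T" for T
    using that(2)
  proof (induction M)
    case (add x M)
    have "(\<Sum>j\<in>T. j * count (add_mset x M) j) = (\<Sum>j\<in>T. j * count M j + (if j = x then x else 0))"
      by (intro sum.cong) auto
    also have "\<dots> = \<Sum>\<^sub># (add_mset x M)"
      using add that(1) by (simp add: sum.distrib)
    finally show ?case .
  qed auto
  then show ?thesis by auto
qed

lemma occupation_eq: "occupation p x = \<Sum>\<^sub># (p x)"
  by (simp add: occupation_def part_mult_def sum_mset_eq_sum_count)

lemma sum_occupation_superset:
  assumes "finite S" "part_supp p \<subseteq> S"
  shows "(\<Sum>x\<in>part_supp p. occupation p x) = (\<Sum>x\<in>S. \<Sum>\<^sub># (p x))"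
  unfolding occupation_eq using assms
  by (intro sum.mono_neutral_left) (auto simp: part_supp_def)

lemma partitions_on_0: "partitions_on X 0 = {\<lambda>_. {#}}"
proof -
  have "p = (\<lambda>_. {#})" if "p \<in> partitions_on X 0" for p
  proof (rule ext)
    fix x
    have "x \<notin> part_supp p"
      using that by (force simp: partitions_on_def spatial_partitions_def occupation_eq part_supp_def
           sum_mset_0_iff dest: multi_nonempty_split)
    then show "p x = {#}" by (simp add: part_supp_def)
  qed
  moreover have "(\<lambda>_. {#}) \<in> partitions_on X 0"
    by (simp add: partitions_on_def spatial_partitions_def part_supp_def)
  ultimately show ?thesis by blast
qed

lemma add_part_bij:
  assumes x: "x \<in> X" and j: "1 \<le> j" "j \<le> n"
  shows "bij_betw (\<lambda>p. p(x := add_mset j (p x))) (partitions_on X (n - j))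
     {p \<in> partitions_on X n. j \<in># p x}"
proof (rule bij_betw_byWitness[where f' = "\<lambda>p. p(x := p x - {#j#})"])
  have occ: "(\<Sum>y\<in>part_supp (p(x := M)). occupation (p(x := M)) y) + \<Sum>\<^sub># (p x)
     = (\<Sum>y\<in>part_supp p. occupation p y) + \<Sum>\<^sub># M"
    if "finite (part_supp p)" for p :: "'a partition_family" and M
  proof -
    define S where "S = insert x (part_supp p)"
    have S: "finite S" "x \<in> S" "part_supp p \<subseteq> S" "part_supp (p(x := M)) \<subseteq> S"
      using that by (auto simp: S_def part_supp_def)
    have "(\<Sum>y\<in>S - {x}. \<Sum>\<^sub># ((p(x := M)) y)) = (\<Sum>y\<in>S - {x}. \<Sum>\<^sub># (p y))"
      by (intro sum.cong) auto
    then show ?thesis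
      unfolding sum_occupation_superset[OF S(1,3)] sum_occupation_superset[OF S(1,4)]
        sum.remove[OF S(1,2)] by simp
  qed
  have fin: "finite (part_supp (p(x := M)))" if "finite (part_supp p)" for p :: "'a partition_family" and M
    by (rule finite_subset[of _ "insert x (part_supp p)"]) (use that in \<open>auto simp: part_supp_def\<close>)
  have sub: "part_supp (p(x := M)) \<subseteq> X" if "part_supp p \<subseteq> X" for p :: "'a partition_family" and M
    using that x by (auto simp: part_supp_def)
  show "\<forall>p\<in>partitions_on X (n - j). (p(x := add_mset j (p x)))(x := (p(x := add_mset j (p x))) x - {#j#}) = p"
    by simp
  show "\<forall>p\<in>{p \<in> partitions_on X n. j \<in># p x}. (p(x := p x - {#j#}))(x := add_mset j ((p(x := p x - {#j#})) x)) = p"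
    by simp
  show "(\<lambda>p. p(x := add_mset j (p x))) ` partitions_on X (n - j) \<subseteq> {p \<in> partitions_on X n. j \<in># p x}"
  proof safe
    fix p assume p: "p \<in> partitions_on X (n - j)"
    then have "finite (part_supp p)" "part_supp p \<subseteq> X"
      by (auto simp: partitions_on_def spatial_partitions_def)
    with p occ[of p "add_mset j (p x)"] fin[of p "add_mset j (p x)"] sub[of p "add_mset j (p x)"] j
    show "p(x := add_mset j (p x)) \<in> partitions_on X n"
      by (auto simp: partitions_on_def spatial_partitions_def)
  qed auto
  show "(\<lambda>p. p(x := p x - {#j#})) ` {p \<in> partitions_on X n. j \<in># p x} \<subseteq> partitions_on X (n - j)"
  proof safe
    fix p assume p: "p \<in> partitions_on X n" "j \<in># p x"
    then have "finite (part_supp p)" "part_supp p \<subseteq> X"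
      by (auto simp: partitions_on_def spatial_partitions_def)
    moreover have "\<Sum>\<^sub># (p x) = j + \<Sum>\<^sub># (p x - {#j#})"
      using p(2) by (metis sum_mset.remove)
    ultimately show "p(x := p x - {#j#}) \<in> partitions_on X (n - j)"
      using p occ[of p "p x - {#j#}"] fin[of p "p x - {#j#}"] sub[of p "p x - {#j#}"]
      by (auto simp: partitions_on_def spatial_partitions_def dest: in_diffD)
  qed
qed

definition partition_sum :: "(int ^ 'd \<Rightarrow> nat \<Rightarrow> real) \<Rightarrow> (int ^ 'd) set \<Rightarrow> nat \<Rightarrow> ennreal" where
  "partition_sum b X n = (\<integral>\<^sup>+p. ennreal (family_weight b p) \<partial>count_space (partitions_on X n :: ('d::finite) partition_family set))"

lemma family_weight_nonneg:
  assumes "\<And>x j. 1 \<le> j \<Longrightarrow> 0 \<le> b x j" "p \<in> spatial_partitions n"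
  shows "family_weight b p \<ge> 0"
  unfolding family_weight_def mset_weight_def using assms
  by (intro prod_nonneg ballI divide_nonneg_nonneg zero_le_power) (auto simp: spatial_partitions_def)

lemma total_eq_sum_parts:
  assumes p: "p \<in> partitions_on X n"
  shows "n = (\<Sum>x\<in>part_supp p. \<Sum>j=1..n. j * count (p x) j)"
proof -
  have "set_mset (p x) \<subseteq> {1..n}" if x: "x \<in> part_supp p" for x
  proof
    fix j assume j: "j \<in># p x"
    have "j \<le> \<Sum>\<^sub># (p x)" using j by (metis le_add1 sum_mset.remove)
    also have "\<dots> \<le> (\<Sum>x\<in>part_supp p. \<Sum>\<^sub># (p x))"
      using p x by (intro member_le_sum) (auto simp: partitions_on_def spatial_partitions_def)
    also have "\<dots> = n" using p by (simp add: partitions_on_def spatial_partitions_def occupation_eq)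
    finally show "j \<in> {1..n}" using p j by (auto simp: partitions_on_def spatial_partitions_def)
  qed
  then have "(\<Sum>j=1..n. j * count (p x) j) = \<Sum>\<^sub># (p x)" if "x \<in> part_supp p" for x
    using that unfolding sum_mset_eq_sum_count[symmetric]
    by (intro sum.mono_neutral_right) (auto simp: not_in_iff)
  then show ?thesis
    using p by (simp add: partitions_on_def spatial_partitions_def occupation_eq)
qed

lemma partition_sum_remove_part:
  fixes b :: "int ^ 'd::finite \<Rightarrow> nat \<Rightarrow> real"
  assumes b: "\<And>x j. 1 \<le> j \<Longrightarrow> 0 \<le> b x j" and x: "x \<in> X" and j: "1 \<le> j" "j \<le> n"
  shows "(\<integral>\<^sup>+p. of_nat (count (p x) j) * ennreal (family_weight b p) \<partial>count_space (partitions_on X n))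
    = ennreal (b x j) * partition_sum b X (n - j)"
proof -
  let ?h = "\<lambda>p::'d partition_family. p(x := add_mset j (p x))"
  have "(\<integral>\<^sup>+p. of_nat (count (p x) j) * ennreal (family_weight b p) \<partial>count_space (partitions_on X n))
     = (\<integral>\<^sup>+p. of_nat (count (p x) j) * ennreal (family_weight b p) \<partial>count_space {p \<in> partitions_on X n. j \<in># p x})"
    by (intro nn_integral_count_space_eq) (auto simp: not_in_iff)
  also have "\<dots> = (\<integral>\<^sup>+p. of_nat (count (?h p x) j) * ennreal (family_weight b (?h p)) \<partial>count_space (partitions_on X (n - j)))"
    by (rule nn_integral_bij_count_space[symmetric]) (rule add_part_bij[OF x j])
  also have "\<dots> = (\<integral>\<^sup>+p. ennreal (b x j) * ennreal (family_weight b p) \<partial>count_space (partitions_on X (n - j)))"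
  proof (intro nn_integral_cong)
    fix p assume "p \<in> space (count_space (partitions_on X (n - j)))"
    then have p: "p \<in> partitions_on X (n - j)" by simp
    then have fin: "finite (part_supp p)" by (auto simp: partitions_on_def spatial_partitions_def)
    have "?h p \<in> partitions_on X n"
      using add_part_bij[OF x j] p by (auto simp: bij_betw_def)
    then have "family_weight b (?h p) \<ge> 0"
      by (intro family_weight_nonneg b) (auto simp: partitions_on_def)
    moreover have "family_weight b p \<ge> 0"
      using p by (intro family_weight_nonneg b) (auto simp: partitions_on_def)
    ultimately show "of_nat (count (?h p x) j) * ennreal (family_weight b (?h p)) = ennreal (b x j) * ennreal (family_weight b p)"
      using family_weight_add[OF fin, of b x j] b[OF j(1), of x]
      by (simp add: ennreal_of_nat_eq_real_of_nat mult.commute flip: ennreal_mult del: of_nat_Suc)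
  qed
  also have "\<dots> = ennreal (b x j) * partition_sum b X (n - j)"
    unfolding partition_sum_def by (rule nn_integral_cmult) auto
  finally show ?thesis .
qed

text \<open>
Each spatial partition of \<open>n\<close> has total part size \<open>n\<close>, so summing \<open>n * weight\<close> is the same
as summing over partitions with a marked part, counted with the size of that part. Removing the
marked part leaves a partition of \<open>n - j\<close>.
\<close>

lemma partition_sum_rec:
  fixes b :: "int ^ 'd::finite \<Rightarrow> nat \<Rightarrow> real"
  assumes b: "\<And>x j. 1 \<le> j \<Longrightarrow> 0 \<le> b x j"
  shows "of_nat n * partition_sum b X n
     = (\<Sum>j=1..n. of_nat j * (\<integral>\<^sup>+x. ennreal (b x j) \<partial>count_space X) * partition_sum b X (n - j))"
proof -
  let ?P = "partitions_on X n :: 'd partition_family set"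
  let ?w = "\<lambda>p. ennreal (family_weight b p)"
  have "of_nat n * partition_sum b X n = (\<integral>\<^sup>+p. of_nat n * ?w p \<partial>count_space ?P)"
    unfolding partition_sum_def by (rule nn_integral_cmult[symmetric]) auto
  also have "\<dots> = (\<integral>\<^sup>+p. (\<Sum>j=1..n. of_nat j * (\<integral>\<^sup>+x. of_nat (count (p x) j) * ?w p \<partial>count_space X)) \<partial>count_space ?P)"
  proof (intro nn_integral_cong)
    fix p :: "'d partition_family" assume "p \<in> space (count_space ?P)"
    then have p: "p \<in> ?P" by simp
    then have supp: "finite (part_supp p)" "part_supp p \<subseteq> X"
      by (auto simp: partitions_on_def spatial_partitions_def)
    have "(of_nat n :: ennreal) = of_nat (\<Sum>x\<in>part_supp p. \<Sum>j=1..n. j * count (p x) j)"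
      using total_eq_sum_parts[OF p] by simp
    also have "\<dots> * ?w p = (\<Sum>x\<in>part_supp p. \<Sum>j=1..n. of_nat j * (of_nat (count (p x) j) * ?w p))"
      by (simp add: sum_distrib_right mult.assoc)
    also have "\<dots> = (\<Sum>j=1..n. of_nat j * (\<Sum>x\<in>part_supp p. of_nat (count (p x) j) * ?w p))"
      by (subst sum.swap) (simp add: sum_distrib_left)
    also have "\<dots> = (\<Sum>j=1..n. of_nat j * (\<integral>\<^sup>+x. of_nat (count (p x) j) * ?w p \<partial>count_space X))"
      using supp by (subst nn_integral_count_space'[where A = "part_supp p"]) (auto simp: part_supp_def)
    finally show "of_nat n * ?w p = \<dots>" .
  qed
  also have "\<dots> = (\<Sum>j=1..n. of_nat j * (\<integral>\<^sup>+p. (\<integral>\<^sup>+x. of_nat (count (p x) j) * ?w p \<partial>count_space X) \<partial>count_space ?P))"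
    by (simp add: nn_integral_sum nn_integral_cmult)
  also have "\<dots> = (\<Sum>j=1..n. of_nat j * (\<integral>\<^sup>+x. ennreal (b x j) * partition_sum b X (n - j) \<partial>count_space X))"
  proof (intro sum.cong refl arg_cong2[where f = "(*)"])
    fix j assume j: "j \<in> {1..n}"
    have "(\<integral>\<^sup>+p. (\<integral>\<^sup>+x. of_nat (count (p x) j) * ?w p \<partial>count_space X) \<partial>count_space ?P)
       = (\<integral>\<^sup>+x. (\<integral>\<^sup>+p. of_nat (count (p x) j) * ?w p \<partial>count_space ?P) \<partial>count_space X)"
      by (rule nn_integral_count_space_nn_integral) auto
    also have "\<dots> = (\<integral>\<^sup>+x. ennreal (b x j) * partition_sum b X (n - j) \<partial>count_space X)"
      using j by (intro nn_integral_cong partition_sum_remove_part b) auto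
    finally show "(\<integral>\<^sup>+p. (\<integral>\<^sup>+x. of_nat (count (p x) j) * ?w p \<partial>count_space X) \<partial>count_space ?P) = \<dots>" .
  qed
  also have "\<dots> = (\<Sum>j=1..n. of_nat j * (\<integral>\<^sup>+x. ennreal (b x j) \<partial>count_space X) * partition_sum b X (n - j))"
    by (simp add: nn_integral_multc mult.assoc)
  finally show ?thesis .
qed

text \<open>
Removing a marked part and differentiating the exponential lead to the same recursion.
\<close>

lemma partition_sum_eq_exp_coeff:
  fixes b :: "int ^ 'd::finite \<Rightarrow> nat \<Rightarrow> real"
  assumes b: "\<And>x j. 1 \<le> j \<Longrightarrow> 0 \<le> b x j"
    and a: "\<And>j. 1 \<le> j \<Longrightarrow> of_nat j * (\<integral>\<^sup>+x. ennreal (b x j) \<partial>count_space X) = ennreal (a j)"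
    and a0: "\<And>j. 1 \<le> j \<Longrightarrow> 0 \<le> a j"
  shows "partition_sum b X n = ennreal (exp_coeff a n)"
proof (induction n rule: less_induct)
  case (less n)
  show ?case
  proof (cases "n = 0")
    case True
    then show ?thesis
      by (simp add: partition_sum_def partitions_on_0 exp_coeff_0 nn_integral_count_space_finite
          family_weight_def part_supp_def)
  next
    case False
    have "of_nat n * partition_sum b X n = (\<Sum>j=1..n. ennreal (a j * exp_coeff a (n - j)))"
      using a a0 by (subst partition_sum_rec[where b = b])
        (auto simp: b less ennreal_mult exp_coeff_nonneg intro!: sum.cong)
    also have "\<dots> = ennreal (real n * exp_coeff a n)"
      unfolding exp_coeff_rec using a0 by (intro sum_ennreal mult_nonneg_nonneg exp_coeff_nonneg) auto
    also have "\<dots> = of_nat n * ennreal (exp_coeff a n)"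
      using a0 by (simp add: ennreal_mult exp_coeff_nonneg ennreal_of_nat_eq_real_of_nat)
    finally show ?thesis
      using False by (simp add: ennreal_mult_cancel_left)
  qed
qed

text \<open>
A family is the same as its partition at the origin together with its restriction to the other sites.
\<close>

lemma partitions_split_bij:
  fixes n m :: nat assumes "m \<le> n"
  shows "bij_betw (\<lambda>(p, q). \<lambda>x. if x = 0 then p 0 else q x)
     ((partitions_on {0} m :: 'd partition_family set) \<times> partitions_on (- {0}) (n - m))
     {p \<in> (spatial_partitions n :: ('d::finite) partition_family set). occupation p 0 = m}"
proof (rule bij_betw_byWitness[where f' = "\<lambda>r. ((\<lambda>x. if x = 0 then r 0 else {#}), (\<lambda>x. if x = 0 then {#} else r x))"])
  let ?S = "{p \<in> (spatial_partitions n :: 'd partition_family set). occupation p 0 = m}"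
  let ?T = "(partitions_on {0} m :: 'd partition_family set) \<times> (partitions_on (- {0}) (n - m) :: 'd partition_family set)"
  show "\<forall>a\<in>?T. (\<lambda>r. ((\<lambda>x. if x = 0 then r 0 else {#}), (\<lambda>x. if x = 0 then {#} else r x))) ((\<lambda>(p, q). \<lambda>x. if x = 0 then p 0 else q x) a) = a"
    by (auto simp: partitions_on_def part_supp_def fun_eq_iff)
  show "\<forall>a'\<in>?S. (\<lambda>(p, q). \<lambda>x. if x = 0 then p 0 else q x) ((\<lambda>r. ((\<lambda>x. if x = 0 then r 0 else {#}), (\<lambda>x. if x = 0 then {#} else r x))) a') = a'"
    by (auto simp: fun_eq_iff)
  have supp: "part_supp (\<lambda>x. if x = 0 then p 0 else q x) \<subseteq> insert 0 (part_supp q)" for p q :: "'d partition_family"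
    by (auto simp: part_supp_def)
  show "(\<lambda>(p, q). \<lambda>x. if x = 0 then p 0 else q x) ` ?T \<subseteq> ?S"
  proof (rule image_subsetI)
    fix a assume "a \<in> ?T"
    then obtain p q where a: "a = (p, q)" and p: "p \<in> partitions_on {0} m" and q: "q \<in> partitions_on (- {0}) (n - m)"
      by auto
    let ?r = "\<lambda>x. if x = 0 then p 0 else q x"
    have fq: "finite (part_supp q)" "0 \<notin> part_supp q" and psup: "part_supp p \<subseteq> {0}"
      using p q by (auto simp: partitions_on_def spatial_partitions_def)
    have "m = (\<Sum>x\<in>part_supp p. occupation p x)" "n - m = (\<Sum>x\<in>part_supp q. occupation q x)"
      using p q by (auto simp: partitions_on_def spatial_partitions_def)
    then have m: "m = \<Sum>\<^sub># (p 0)" and nm: "n - m = (\<Sum>x\<in>part_supp q. \<Sum>\<^sub># (q x))"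
      unfolding sum_occupation_superset[OF _ psup, simplified] by (auto simp: occupation_eq)
    have "occupation ?r 0 = m" by (simp add: occupation_eq m)
    have "(\<Sum>x\<in>part_supp ?r. occupation ?r x) = (\<Sum>x\<in>insert 0 (part_supp q). \<Sum>\<^sub># (?r x))"
      using fq supp[of p q] by (intro sum_occupation_superset) auto
    also have "\<dots> = \<Sum>\<^sub># (p 0) + (\<Sum>x\<in>part_supp q. \<Sum>\<^sub># (?r x))"
      using fq by (subst sum.insert) auto
    also have "(\<Sum>x\<in>part_supp q. \<Sum>\<^sub># (?r x)) = (\<Sum>x\<in>part_supp q. \<Sum>\<^sub># (q x))"
      using fq by (intro sum.cong) auto
    finally have "(\<Sum>x\<in>part_supp ?r. occupation ?r x) = n"
      using m nm assms by simp
    moreover have "finite (part_supp ?r)" using finite_subset[OF supp[of p q]] fq by simp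
    moreover have "\<forall>x. \<forall>j\<in>#?r x. j \<ge> 1"
      using p q by (auto simp: partitions_on_def spatial_partitions_def)
    ultimately have "?r \<in> ?S" using \<open>occupation ?r 0 = m\<close> by (simp add: spatial_partitions_def)
    then show "(case a of (p, q) \<Rightarrow> \<lambda>x. if x = 0 then p 0 else q x) \<in> ?S" by (simp add: a)
  qed
  show "(\<lambda>r. ((\<lambda>x. if x = 0 then r 0 else {#}), (\<lambda>x. if x = 0 then {#} else r x))) ` ?S \<subseteq> ?T"
  proof (rule image_subsetI)
    fix r assume "r \<in> ?S"
    then have r: "r \<in> spatial_partitions n" and m: "occupation r 0 = m" by auto
    let ?p = "\<lambda>x. if x = 0 then r 0 else {#}" and ?q = "\<lambda>x. if x = 0 then {#} else r x"
    have fr: "finite (part_supp r)" and n: "n = (\<Sum>x\<in>insert 0 (part_supp r). \<Sum>\<^sub># (r x))"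
      using r sum_occupation_superset[of "insert 0 (part_supp r)" r] by (auto simp: spatial_partitions_def)
    have ps: "part_supp ?p \<subseteq> {0}" and qs: "part_supp ?q \<subseteq> part_supp r - {0}"
      by (auto simp: part_supp_def split: if_splits)
    have "(\<Sum>x\<in>part_supp ?p. occupation ?p x) = occupation r 0"
      by (subst sum_occupation_superset[OF _ ps]) (auto simp: occupation_eq)
    then have p: "?p \<in> partitions_on {0} m"
      using r ps finite_subset[OF ps] by (auto simp: m partitions_on_def spatial_partitions_def)
    have "(\<Sum>x\<in>part_supp ?q. occupation ?q x) = (\<Sum>x\<in>part_supp r - {0}. \<Sum>\<^sub># (?q x))"
      using fr qs by (intro sum_occupation_superset) auto
    also have "\<dots> = (\<Sum>x\<in>part_supp r - {0}. \<Sum>\<^sub># (r x))"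
      by (intro sum.cong) auto
    finally have "(\<Sum>x\<in>part_supp ?q. occupation ?q x) = n - m"
      using n fr by (simp add: sum.insert_remove occupation_eq flip: m)
    then have "?q \<in> partitions_on (- {0}) (n - m)"
      using r qs finite_subset[OF qs] fr by (auto simp: m partitions_on_def spatial_partitions_def)
    with p show "(?p, ?q) \<in> ?T" by simp
  qed
qed

lemma partition_sum_split:
  fixes b :: "int ^ 'd::finite \<Rightarrow> nat \<Rightarrow> real"
  assumes b: "\<And>x j. 1 \<le> j \<Longrightarrow> 0 \<le> b x j" and "m \<le> n"
  shows "(\<integral>\<^sup>+p. ennreal (family_weight b p) \<partial>count_space {p \<in> spatial_partitions n. occupation p 0 = m})
    = partition_sum b {0} m * partition_sum b (- {0}) (n - m)"
proof -
  let ?P = "partitions_on {0} m :: 'd partition_family set"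
  let ?Q = "partitions_on (- {0}) (n - m) :: 'd partition_family set"
  have w: "ennreal (family_weight b (\<lambda>x. if x = 0 then p 0 else q x)) = ennreal (family_weight b p) * ennreal (family_weight b q)"
    if p: "p \<in> ?P" and q: "q \<in> ?Q" for p q
  proof -
    have fq: "finite (part_supp q)" "0 \<notin> part_supp q" and psup: "part_supp p \<subseteq> {0}"
      using p q by (auto simp: partitions_on_def spatial_partitions_def)
    have "family_weight b (\<lambda>x. if x = 0 then p 0 else q x)
       = (\<Prod>x\<in>insert 0 (part_supp q). mset_weight (b x) (if x = 0 then p 0 else q x))"
      using fq by (intro family_weight_superset) (auto simp: part_supp_def)
    also have "\<dots> = mset_weight (b 0) (p 0) * (\<Prod>x\<in>part_supp q. mset_weight (b x) (if x = 0 then p 0 else q x))"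
      using fq by (subst prod.insert) auto
    also have "(\<Prod>x\<in>part_supp q. mset_weight (b x) (if x = 0 then p 0 else q x)) = family_weight b q"
      unfolding family_weight_def using fq by (intro prod.cong) auto
    also have "mset_weight (b 0) (p 0) = family_weight b p"
      by (subst family_weight_superset[OF _ psup]) auto
    finally have "family_weight b (\<lambda>x. if x = 0 then p 0 else q x) = family_weight b p * family_weight b q"
      by simp
    moreover have "family_weight b p \<ge> 0" "family_weight b q \<ge> 0"
      using p q by (auto simp: partitions_on_def intro!: family_weight_nonneg b)
    ultimately show ?thesis by (simp add: ennreal_mult)
  qed
  have "(\<integral>\<^sup>+p. ennreal (family_weight b p) \<partial>count_space {p \<in> spatial_partitions n. occupation p 0 = m})
     = (\<integral>\<^sup>+a. ennreal (family_weight b ((\<lambda>(p, q). \<lambda>x. if x = 0 then p 0 else q x) a)) \<partial>count_space (?P \<times> ?Q))"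
    by (rule nn_integral_bij_count_space[symmetric]) (rule partitions_split_bij[OF assms(2)])
  also have "\<dots> = (\<integral>\<^sup>+a. (ennreal (family_weight b (fst a)) * indicator ?P (fst a)) *
       (ennreal (family_weight b (snd a)) * indicator ?Q (snd a)) \<partial>count_space UNIV)"
    by (subst nn_integral_count_space_indicator)
       (auto intro!: nn_integral_cong simp: w split: split_indicator)
  also have "\<dots> = (\<integral>\<^sup>+p. \<integral>\<^sup>+q. (ennreal (family_weight b p) * indicator ?P p) *
       (ennreal (family_weight b q) * indicator ?Q q) \<partial>count_space UNIV \<partial>count_space UNIV)"
    by (subst nn_integral_fst_count_space[symmetric]) simp
  also have "\<dots> = partition_sum b {0} m * partition_sum b (- {0}) (n - m)"
    by (simp add: nn_integral_cmult nn_integral_multc partition_sum_def nn_integral_count_space_indicator)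
  finally show ?thesis .
qed

section \<open>The law of the occupation of the origin\<close>

lemma has_sum_of_nn_integral_count_space:
  fixes f :: "'a \<Rightarrow> real"
  assumes f: "\<And>x. x \<in> A \<Longrightarrow> 0 \<le> f x" and c: "0 \<le> c"
    and I: "(\<integral>\<^sup>+x. ennreal (f x) \<partial>count_space A) = ennreal c"
  shows "(f has_sum c) A"
proof -
  have int: "integrable (count_space A) f"
    using f I by (intro integrableI_nonneg) auto
  have "infsetsum f A = c"
    unfolding infsetsum_def using f I c
    by (subst integral_eq_nn_integral) auto
  moreover have abs: "Infinite_Set_Sum.abs_summable_on f A"
    using int by (simp add: Infinite_Set_Sum.abs_summable_on_def)
  then have "f summable_on A"
    using abs_summable_equivalent abs_summable_summable by blast
  ultimately show ?thesis
    using has_sum_infsum infsetsum_infsum[OF abs] by metis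
qed

lemma occupation_le:
  assumes "p \<in> spatial_partitions n"
  shows "occupation p x \<le> n"
proof (cases "x \<in> part_supp p")
  case True
  then show ?thesis
    using assms member_le_sum[of x "part_supp p" "occupation p"] by (auto simp: spatial_partitions_def)
next
  case False
  then show ?thesis by (simp add: part_supp_def occupation_eq)
qed

text \<open>
The weights factorise over the origin and its complement. Both factors are coefficients of
exponentials, so the law of the occupation is explicit.
\<close>

lemma occupation_law:
  fixes V :: "real ^ 'd::finite \<Rightarrow> real" and B :: "nat \<Rightarrow> bool"
  assumes \<theta>: "\<And>j. 1 \<le> j \<Longrightarrow> 0 \<le> \<theta> j"
    and a0: "\<And>j. 1 \<le> j \<Longrightarrow> a0 j = \<theta> j * exp (- real j * V 0)"
    and a1: "\<And>j. 1 \<le> j \<Longrightarrow> 0 \<le> a1 j"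
      "\<And>j. 1 \<le> j \<Longrightarrow> (\<integral>\<^sup>+x. ennreal (\<theta> j * exp (- real j * V (scaled_site L x))) \<partial>count_space (- {0})) = ennreal (a1 j)"
  shows "measure (spatial_measure \<theta> V L n) {p \<in> spatial_partitions n. B (occupation p 0)}
    = (\<Sum>m | m \<le> n \<and> B m. exp_coeff a0 m * exp_coeff a1 (n - m)) / (\<Sum>m\<le>n. exp_coeff a0 m * exp_coeff a1 (n - m))"
proof -
  define b where "b = (\<lambda>x j. \<theta> j / real j * exp (- real j * V (scaled_site L x)))"
  define Z where "Z = (\<Sum>m\<le>n. exp_coeff a0 m * exp_coeff a1 (n - m))"
  let ?S = "spatial_partitions n :: 'd partition_family set"
  have b: "0 \<le> b x j" if "1 \<le> j" for x j using \<theta>[OF that] by (simp add: b_def)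
  have jb: "real j * b x j = \<theta> j * exp (- real j * V (scaled_site L x))" if "1 \<le> j" for x j
    using that by (simp add: b_def)
  have a0_nn: "0 \<le> a0 j" if "1 \<le> j" for j using \<theta>[OF that] a0[OF that] by simp
  have ss0: "scaled_site L (0 :: int ^ 'd) = 0" by (simp add: scaled_site_def vec_eq_iff)
  have bj: "of_nat j * (\<integral>\<^sup>+x. ennreal (b x j) \<partial>count_space X) = (\<integral>\<^sup>+x. ennreal (real j * b x j) \<partial>count_space X)"
    if "1 \<le> j" for j X
    using b[OF that]
    by (simp add: ennreal_mult ennreal_of_nat_eq_real_of_nat nn_integral_cmult)
  have P0: "partition_sum b {0} m = ennreal (exp_coeff a0 m)" for m
  proof (rule partition_sum_eq_exp_coeff[OF b])
    fix j :: nat assume j: "1 \<le> j"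
    show "of_nat j * (\<integral>\<^sup>+x. ennreal (b x j) \<partial>count_space {0}) = ennreal (a0 j)"
      unfolding bj[OF j] jb[OF j] using a0[OF j] by (simp add: nn_integral_count_space_finite ss0)
  qed (use a0_nn in auto)
  have P1: "partition_sum b (- {0}) m = ennreal (exp_coeff a1 m)" for m
  proof (rule partition_sum_eq_exp_coeff[OF b])
    fix j :: nat assume j: "1 \<le> j"
    show "of_nat j * (\<integral>\<^sup>+x. ennreal (b x j) \<partial>count_space (- {0})) = ennreal (a1 j)"
      unfolding bj[OF j] jb[OF j] using a1(2)[OF j] by simp
  qed (use a1 in auto)
  have nn: "0 \<le> exp_coeff a0 m" "0 \<le> exp_coeff a1 m" for m
    using a0_nn a1(1) by (auto intro!: exp_coeff_nonneg)
  have slice: "(\<integral>\<^sup>+p. ennreal (family_weight b p) * indicator {p \<in> ?S. B (occupation p 0)} p \<partial>count_space ?S)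
      = ennreal (\<Sum>m | m \<le> n \<and> B m. exp_coeff a0 m * exp_coeff a1 (n - m))" for B :: "nat \<Rightarrow> bool"
  proof -
    have "(\<integral>\<^sup>+p. ennreal (family_weight b p) * indicator {p \<in> ?S. B (occupation p 0)} p \<partial>count_space ?S)
       = (\<integral>\<^sup>+p. (\<Sum>m | m \<le> n \<and> B m. ennreal (family_weight b p) * indicator {p \<in> ?S. occupation p 0 = m} p) \<partial>count_space ?S)"
    proof (intro nn_integral_cong)
      fix p :: "'d partition_family" assume "p \<in> space (count_space ?S)"
      then have p: "p \<in> ?S" by simp
      have "(\<Sum>m | m \<le> n \<and> B m. ennreal (family_weight b p) * indicator {p \<in> ?S. occupation p 0 = m} p)
         = (\<Sum>m | m \<le> n \<and> B m. if occupation p 0 = m then ennreal (family_weight b p) else 0)"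
        using p by (intro sum.cong) (auto simp: indicator_def)
      also have "\<dots> = ennreal (family_weight b p) * indicator {p \<in> ?S. B (occupation p 0)} p"
        using p occupation_le[OF p, of 0] by (subst sum.delta') (auto simp: indicator_def)
      finally show "ennreal (family_weight b p) * indicator {p \<in> ?S. B (occupation p 0)} p = (\<Sum>m | m \<le> n \<and> B m. ennreal (family_weight b p) * indicator {p \<in> ?S. occupation p 0 = m} p)" ..
    qed
    also have "\<dots> = (\<Sum>m | m \<le> n \<and> B m. \<integral>\<^sup>+p. ennreal (family_weight b p) \<partial>count_space {p \<in> ?S. occupation p 0 = m})"
      by (subst nn_integral_sum)
         (auto intro!: sum.cong nn_integral_cong simp: nn_integral_count_space_indicator split: split_indicator)
    also have "\<dots> = (\<Sum>m | m \<le> n \<and> B m. ennreal (exp_coeff a0 m * exp_coeff a1 (n - m)))"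
      by (intro sum.cong refl) (simp add: partition_sum_split[OF b] P0 P1 ennreal_mult nn)
    also have "\<dots> = ennreal (\<Sum>m | m \<le> n \<and> B m. exp_coeff a0 m * exp_coeff a1 (n - m))"
      by (intro sum_ennreal mult_nonneg_nonneg nn)
    finally show ?thesis .
  qed
  have Z0: "Z \<ge> 0" unfolding Z_def by (intro sum_nonneg mult_nonneg_nonneg nn)
  have wnn: "family_weight b p \<ge> 0" if "p \<in> ?S" for p
    using family_weight_nonneg[OF b that] by simp
  have "(family_weight b has_sum Z) ?S"
  proof (rule has_sum_of_nn_integral_count_space[OF wnn Z0])
    have "(\<integral>\<^sup>+p. ennreal (family_weight b p) \<partial>count_space ?S)
      = (\<integral>\<^sup>+p. ennreal (family_weight b p) * indicator {p \<in> ?S. True} p \<partial>count_space ?S)"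
      by (intro nn_integral_cong) auto
    also have "\<dots> = ennreal Z"
      unfolding slice[of "\<lambda>_. True"] Z_def by (simp add: atMost_def)
    finally show "(\<integral>\<^sup>+p. ennreal (family_weight b p) \<partial>count_space ?S) = ennreal Z" .
  qed
  then have pf: "partition_fun \<theta> V L n = Z"
    unfolding partition_fun_def weight_eq_family_weight b_def[symmetric] by (simp add: infsumI)
  let ?T = "{p \<in> ?S. B (occupation p 0)}"
  have "emeasure (spatial_measure \<theta> V L n) ?T
     = (\<integral>\<^sup>+p. ennreal (family_weight b p / Z) * indicator ?T p \<partial>count_space ?S)"
    unfolding spatial_measure_def point_measure_def weight_eq_family_weight b_def[symmetric] pf
    by (subst emeasure_density) auto
  also have "\<dots> = (\<integral>\<^sup>+p. ennreal (1 / Z) * (ennreal (family_weight b p) * indicator ?T p) \<partial>count_space ?S)"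
    using wnn Z0 by (intro nn_integral_cong) (auto simp: ennreal_mult[symmetric] split: split_indicator)
  also have "\<dots> = ennreal (1 / Z) * ennreal (\<Sum>m | m \<le> n \<and> B m. exp_coeff a0 m * exp_coeff a1 (n - m))"
    by (subst nn_integral_cmult) (auto simp: slice)
  also have "\<dots> = ennreal ((\<Sum>m | m \<le> n \<and> B m. exp_coeff a0 m * exp_coeff a1 (n - m)) / Z)"
    using Z0 nn by (simp add: ennreal_mult[symmetric] sum_nonneg)
  finally show ?thesis
    using Z0 nn by (simp add: measure_def Z_def sum_nonneg divide_nonneg_nonneg)
qed

section \<open>Coefficient asymptotics at the origin\<close>

text \<open>
Tannery's theorem with a bound that holds in all terms at once.
\<close>

lemma tendsto_suminf_dominated:
  fixes f :: "'b \<Rightarrow> nat \<Rightarrow> 'a::{real_normed_algebra,banach}"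
  assumes "\<And>k. ((\<lambda>n. f n k) \<longlongrightarrow> g k) F" "eventually (\<lambda>n. \<forall>k. norm (f n k) \<le> B k) F" "summable B" "F \<noteq> bot"
  shows "((\<lambda>n. \<Sum>k. f n k) \<longlongrightarrow> (\<Sum>k. g k)) F"
proof -
  have "eventually (\<lambda>(k, n). norm (f n k) \<le> B k) (at_top \<times>\<^sub>F F)"
    unfolding eventually_prod_filter
    by (intro exI[of _ "\<lambda>_. True"] exI[of _ "\<lambda>n. \<forall>k. norm (f n k) \<le> B k"]) (use assms(2) in auto)
  then show ?thesis
    using tannerys_theorem[of "\<lambda>k n. f n k" g F B] assms by simp
qed

text \<open>
Comparison with the integral of \<open>x powr \<gamma>\<close>, in the form of the mean value theorem.
\<close>

lemma sum_powr_le: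
  fixes \<gamma> :: real
  assumes "-1 < \<gamma>" "\<gamma> \<le> 0"
  shows "(\<Sum>j=1..n. real j powr \<gamma>) \<le> real n powr (\<gamma> + 1) / (\<gamma> + 1)"
proof (induction n)
  case (Suc n)
  have "real (Suc n) powr \<gamma> * (\<gamma> + 1) \<le> real (Suc n) powr (\<gamma> + 1) - real n powr (\<gamma> + 1)"
  proof (cases "n = 0")
    case True
    with assms show ?thesis by simp
  next
    case False
    have der: "((\<lambda>a. a powr (\<gamma> + 1)) has_real_derivative (\<gamma> + 1) * x powr \<gamma>) (at x)" if "x > 0" for x
      using has_real_derivative_powr[OF that, of "\<gamma> + 1"] by simp
    have "\<exists>z>real n. z < real (Suc n) \<and> real (Suc n) powr (\<gamma> + 1) - real n powr (\<gamma> + 1)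
        = (real (Suc n) - real n) * ((\<gamma> + 1) * z powr \<gamma>)"
      using False by (intro MVT2 der) auto
    then obtain z where z: "real n < z" "z < real (Suc n)"
      "real (Suc n) powr (\<gamma> + 1) - real n powr (\<gamma> + 1) = (\<gamma> + 1) * z powr \<gamma>" by auto
    have "real (Suc n) powr \<gamma> \<le> z powr \<gamma>"
      using z False assms by (intro powr_mono2') auto
    with z assms show ?thesis by (simp add: mult.commute)
  qed
  with Suc assms show ?case by (simp add: field_simps)
qed (use assms in auto)

lemma exp_coeff_powr_summable:
  assumes "\<gamma> < 0"
  shows "summable (exp_coeff (\<lambda>j. real j powr \<gamma>))"
    and "suminf (exp_coeff (\<lambda>j. real j powr \<gamma>)) > 0"
proof -
  have "summable (\<lambda>j. real j powr (\<gamma> - 1))"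
    using assms by (simp add: summable_real_powr_iff)
  then have S: "summable (\<lambda>j. norm (of_real (real j powr \<gamma> / real j) * (1::real) ^ j))"
  proof (rule summable_cong[THEN iffD1, rotated])
    show "eventually (\<lambda>j. real j powr (\<gamma> - 1) = norm (of_real (real j powr \<gamma> / real j) * (1::real) ^ j)) sequentially"
      using eventually_gt_at_top[of 0]
      by eventually_elim (simp add: powr_diff)
  qed
  have "exp_coeff (\<lambda>j. real j powr \<gamma>) sums exp (\<Sum>j. real j powr \<gamma> / real j)"
    using exp_coeff_sums(2)[OF S] by simp
  then show "summable (exp_coeff (\<lambda>j. real j powr \<gamma>))" "suminf (exp_coeff (\<lambda>j. real j powr \<gamma>)) > 0"
    by (auto simp: sums_iff)
qed

text \<open>
Induction through the recursion \<open>n c\<^sub>n = (\<Sum>j. j powr \<gamma> * c\<^bsub>n - j\<^esub>)\<close>. For \<open>j \<ge> n / 2\<close> the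
power is at most a constant times \<open>n powr \<gamma>\<close> and the \<open>c\<close> are summable. For \<open>j < n / 2\<close> the
induction hypothesis gives \<open>K n powr (\<gamma> - 1)\<close> times \<open>n powr (\<gamma> + 1)\<close>, smaller than needed by
\<open>n powr \<gamma>\<close>; since this tends to \<open>0\<close>, \<open>K\<close> is reproduced as soon as \<open>n\<close> is large.
\<close>

lemma exp_coeff_powr_bound:
  assumes \<gamma>: "-1 < \<gamma>" "\<gamma> < 0"
  obtains K where "\<And>n. n \<ge> 1 \<Longrightarrow> exp_coeff (\<lambda>j. real j powr \<gamma>) n \<le> K * real n powr (\<gamma> - 1)" "K > 0"
proof -
  define c where "c = exp_coeff (\<lambda>j. real j powr \<gamma>)"
  define C where "C = suminf c"
  have c0: "c n \<ge> 0" for n unfolding c_def by (rule exp_coeff_nonneg) auto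
  have sc: "summable c" unfolding c_def by (rule exp_coeff_powr_summable[OF \<gamma>(2)])
  have rec: "real n * c n = (\<Sum>j=1..n. real j powr \<gamma> * c (n - j))" for n
    unfolding c_def by (rule exp_coeff_rec)
  define C2 where "C2 = 2 powr (1 - \<gamma>) / (\<gamma> + 1)"
  have C2: "C2 > 0" using \<gamma> by (simp add: C2_def)
  have "((\<lambda>n. C2 * real n powr \<gamma>) \<longlongrightarrow> 0) sequentially"
    using tendsto_mult_right_zero[OF tendsto_neg_powr[OF \<gamma>(2) filterlim_real_sequentially]] by blast
  then have "eventually (\<lambda>n. C2 * real n powr \<gamma> < 1/2) sequentially"
    by (rule order_tendstoD) auto
  then obtain N where N: "\<And>n. n \<ge> N \<Longrightarrow> C2 * real n powr \<gamma> < 1/2"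
    by (auto simp: eventually_sequentially)
  \<comment> \<open>large enough for the first contribution and for all \<open>n \<le> N\<close>\<close>
  define K where "K = 2 * C * 2 powr (- \<gamma>) + (\<Sum>n\<le>N. c n * real n powr (1 - \<gamma>)) + 1"
  have C0: "C \<ge> 0" unfolding C_def by (intro suminf_nonneg sc c0)
  have K: "K > 0" "K \<ge> 2 * C * 2 powr (- \<gamma>)"
    unfolding K_def using C0 c0 by (auto intro!: add_nonneg_pos add_nonneg_nonneg sum_nonneg)
  have small: "c n \<le> K * real n powr (\<gamma> - 1)" if "n \<ge> 1" "n \<le> N" for n
  proof -
    have "c n * real n powr (1 - \<gamma>) \<le> (\<Sum>n\<le>N. c n * real n powr (1 - \<gamma>))"
      using that c0 by (intro member_le_sum) auto
    also have "\<dots> \<le> K" unfolding K_def using C0 by simp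
    finally have "c n * real n powr (1 - \<gamma>) * real n powr (\<gamma> - 1) \<le> K * real n powr (\<gamma> - 1)"
      by (intro mult_right_mono) auto
    then show ?thesis using that by (simp add: mult.assoc powr_add[symmetric])
  qed
  have "c n \<le> K * real n powr (\<gamma> - 1)" if "n \<ge> 1" for n
    using that
  proof (induction n rule: less_induct)
    case (less n)
    show ?case
    proof (cases "n \<le> N")
      case False
      have n: "real n > 0" using less by simp
      have hp: "(real n / 2) powr e = 2 powr (- e) * real n powr e" for e
        by (simp add: powr_divide powr_minus_divide)
      have bound: "real j powr \<gamma> * c (n - j) \<le> 2 powr (- \<gamma>) * real n powr \<gamma> * c (n - j)
          + K * 2 powr (1 - \<gamma>) * real n powr (\<gamma> - 1) * real j powr \<gamma>" if j: "j \<in> {1..n}" for j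
      proof (cases "2 * j \<ge> n")
        case True
        have "real j powr \<gamma> \<le> (real n / 2) powr \<gamma>"
          using True n \<gamma> by (intro powr_mono2') auto
        then have "real j powr \<gamma> * c (n - j) \<le> 2 powr (- \<gamma>) * real n powr \<gamma> * c (n - j)"
          unfolding hp by (intro mult_right_mono c0)
        moreover have "0 \<le> K * 2 powr (1 - \<gamma>) * real n powr (\<gamma> - 1) * real j powr \<gamma>"
          using K by simp
        ultimately show ?thesis by linarith
      next
        case False
        then have "n - j < n" "1 \<le> n - j" using j by auto
        then have "c (n - j) \<le> K * real (n - j) powr (\<gamma> - 1)" using less by blast
        also have "\<dots> \<le> K * (real n / 2) powr (\<gamma> - 1)"
          using K n \<gamma> False j by (intro mult_left_mono powr_mono2') (auto simp: of_nat_diff)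
        finally have "real j powr \<gamma> * c (n - j) \<le> real j powr \<gamma> * (K * (real n / 2) powr (\<gamma> - 1))"
          by (intro mult_left_mono) auto
        moreover have "0 \<le> 2 powr (- \<gamma>) * real n powr \<gamma> * c (n - j)" using c0 by simp
        ultimately show ?thesis unfolding hp by (simp add: mult_ac)
      qed
      have "real n * c n \<le> (\<Sum>j=1..n. 2 powr (- \<gamma>) * real n powr \<gamma> * c (n - j)
          + K * 2 powr (1 - \<gamma>) * real n powr (\<gamma> - 1) * real j powr \<gamma>)"
        unfolding rec by (rule sum_mono) (rule bound)
      also have "\<dots> = 2 powr (- \<gamma>) * real n powr \<gamma> * (\<Sum>j=1..n. c (n - j))
          + K * 2 powr (1 - \<gamma>) * real n powr (\<gamma> - 1) * (\<Sum>j=1..n. real j powr \<gamma>)"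
        by (simp add: sum.distrib sum_distrib_left)
      also have "\<dots> \<le> 2 powr (- \<gamma>) * real n powr \<gamma> * C
          + K * 2 powr (1 - \<gamma>) * real n powr (\<gamma> - 1) * (real n powr (\<gamma> + 1) / (\<gamma> + 1))"
      proof (intro add_mono mult_left_mono)
        have "(\<Sum>j=1..n. c (n - j)) = (\<Sum>i<n. c i)"
          by (rule sum.reindex_bij_witness[of _ "\<lambda>i. n - i" "\<lambda>j. n - j"]) auto
        then show "(\<Sum>j=1..n. c (n - j)) \<le> C"
          unfolding C_def using sum_le_suminf[OF sc, of "{..<n}"] c0 by simp
        show "(\<Sum>j=1..n. real j powr \<gamma>) \<le> real n powr (\<gamma> + 1) / (\<gamma> + 1)"
          using \<gamma> by (intro sum_powr_le) auto
      qed (use K in auto)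
      also have "K * 2 powr (1 - \<gamma>) * real n powr (\<gamma> - 1) * (real n powr (\<gamma> + 1) / (\<gamma> + 1))
          = real n powr \<gamma> * (K * (C2 * real n powr \<gamma>))"
        unfolding C2_def by (simp add: powr_add[symmetric] mult_ac)
      also have "\<dots> \<le> real n powr \<gamma> * (K * (1/2))"
        using N[of n] False K by (intro mult_left_mono) auto
      also have "2 powr (- \<gamma>) * real n powr \<gamma> * C \<le> real n powr \<gamma> * (K / 2)"
      proof -
        have "(2 * C * 2 powr (- \<gamma>)) * real n powr \<gamma> \<le> K * real n powr \<gamma>"
          using K(2) by (intro mult_right_mono) auto
        then show ?thesis by (simp add: mult_ac)
      qed
      finally have "real n * c n \<le> K * real n powr \<gamma>" by (simp add: mult_ac)
      then have "c n \<le> K * real n powr \<gamma> / real n" using n by (simp add: field_simps)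
      then show ?thesis using n by (simp add: powr_diff)
    qed (use small less in auto)
  qed
  with K that show ?thesis unfolding c_def by blast
qed

text \<open>
In the normalised recursion the terms with small \<open>k = n - j\<close> converge, dominated, to the sum of all
\<open>c\<^sub>k\<close>; by \<open>exp_coeff_powr_bound\<close> the terms with \<open>k > n / 2\<close> are \<open>O(n powr \<gamma>)\<close>.
\<close>

lemma exp_coeff_powr_asymp:
  assumes \<gamma>: "-1 < \<gamma>" "\<gamma> < 0"
  shows "(\<lambda>n. exp_coeff (\<lambda>j. real j powr \<gamma>) n * real n powr (1 - \<gamma>))
     \<longlonglongrightarrow> suminf (exp_coeff (\<lambda>j. real j powr \<gamma>))"
proof -
  define c where "c = exp_coeff (\<lambda>j. real j powr \<gamma>)"
  have c0: "c n \<ge> 0" for n unfolding c_def by (rule exp_coeff_nonneg) auto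
  have sc: "summable c" unfolding c_def by (rule exp_coeff_powr_summable[OF \<gamma>(2)])
  have rec: "real n * c n = (\<Sum>j=1..n. real j powr \<gamma> * c (n - j))" for n
    unfolding c_def by (rule exp_coeff_rec)
  obtain K where K: "\<And>n. n \<ge> 1 \<Longrightarrow> c n \<le> K * real n powr (\<gamma> - 1)" "K > 0"
    using exp_coeff_powr_bound[OF \<gamma>] unfolding c_def by blast
  define g where "g = (\<lambda>n k. if 2 * k \<le> n then c k * (real (n - k) / real n) powr \<gamma> else 0)"
  define h where "h = (\<lambda>n. \<Sum>k | k < n \<and> n < 2 * k. c k * (real (n - k) / real n) powr \<gamma>)"
  have eq: "c n * real n powr (1 - \<gamma>) = (\<Sum>k. g n k) + h n" if n: "n \<ge> 1" for n
  proof -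
    have "c n * real n powr (1 - \<gamma>) = (real n * c n) * real n powr (- \<gamma>)"
      using n by (simp add: powr_diff powr_minus field_simps)
    also have "real n * c n = (\<Sum>k<n. real (n - k) powr \<gamma> * c k)"
      unfolding rec by (rule sum.reindex_bij_witness[of _ "\<lambda>i. n - i" "\<lambda>j. n - j"]) auto
    also have "\<dots> * real n powr (- \<gamma>) = (\<Sum>k<n. c k * (real (n - k) / real n) powr \<gamma>)"
      unfolding sum_distrib_right by (intro sum.cong) (auto simp: powr_divide powr_minus field_simps)
    also have "\<dots> = (\<Sum>k\<in>{k. k < n \<and> 2 * k \<le> n} \<union> {k. k < n \<and> n < 2 * k}. c k * (real (n - k) / real n) powr \<gamma>)"
      by (intro sum.cong) auto
    also have "\<dots> = (\<Sum>k | k < n \<and> 2 * k \<le> n. c k * (real (n - k) / real n) powr \<gamma>) + h n"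
      unfolding h_def by (intro sum.union_disjoint) auto
    also have "(\<Sum>k | k < n \<and> 2 * k \<le> n. c k * (real (n - k) / real n) powr \<gamma>) = (\<Sum>k | k < n \<and> 2 * k \<le> n. g n k)"
      by (intro sum.cong) (auto simp: g_def)
    also have "\<dots> = (\<Sum>k. g n k)"
      using n by (intro suminf_finite[symmetric]) (auto simp: g_def)
    finally show ?thesis .
  qed
  have glim: "(\<lambda>n. \<Sum>k. g n k) \<longlonglongrightarrow> (\<Sum>k. c k)"
  proof (rule tendsto_suminf_dominated)
    have "summable (\<lambda>k. 2 powr (- \<gamma>) * c k)" by (intro summable_mult sc)
    then show "summable (\<lambda>k. 2 powr (- \<gamma>) * c k)" .
    have "norm (g n k) \<le> 2 powr (- \<gamma>) * c k" for n k
    proof (cases "2 * k \<le> n \<and> n > 0")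
      case True
      then have "(real (n - k) / real n) powr \<gamma> \<le> (1/2) powr \<gamma>"
        using \<gamma> by (intro powr_mono2') (auto simp: field_simps of_nat_diff)
      also have "\<dots> = 2 powr (- \<gamma>)" by (simp add: powr_divide powr_minus_divide)
      finally have "c k * (real (n - k) / real n) powr \<gamma> \<le> c k * 2 powr (- \<gamma>)"
        using c0[of k] by (intro mult_left_mono) auto
      then show ?thesis using True c0[of k] by (simp add: g_def mult.commute)
    qed (use c0 in \<open>auto simp: g_def\<close>)
    then show "eventually (\<lambda>n. \<forall>k. norm (g n k) \<le> 2 powr (- \<gamma>) * c k) sequentially" by simp
    show "(\<lambda>n. g n k) \<longlonglongrightarrow> c k" for k
    proof -
      have "(\<lambda>n. real (n - k) / real n) \<longlonglongrightarrow> 1"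
      proof (rule Lim_transform_eventually)
        show "(\<lambda>n. 1 - real k / real n) \<longlonglongrightarrow> 1"
          using tendsto_diff[OF tendsto_const lim_const_over_n[of "real k"], of 1] by simp
        show "eventually (\<lambda>n. 1 - real k / real n = real (n - k) / real n) sequentially"
          using eventually_gt_at_top[of k] by eventually_elim (simp add: of_nat_diff field_simps)
      qed
      then have A: "(\<lambda>n. c k * (real (n - k) / real n) powr \<gamma>) \<longlonglongrightarrow> c k * 1 powr \<gamma>"
        by (intro tendsto_intros) auto
      have B: "eventually (\<lambda>n. c k * (real (n - k) / real n) powr \<gamma> = g n k) sequentially"
        using eventually_ge_at_top[of "2 * k"] by eventually_elim (simp add: g_def)
      show ?thesis using Lim_transform_eventually[OF A B] by simp
    qed
  qed simp
  have hlim: "h \<longlonglongrightarrow> 0"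
  proof (rule tendsto_sandwich[OF _ _ tendsto_const])
    show "eventually (\<lambda>n. 0 \<le> h n) sequentially"
      unfolding h_def by (intro always_eventually allI sum_nonneg mult_nonneg_nonneg c0) auto
    define D where "D = K * 2 powr (1 - \<gamma>) / (\<gamma> + 1)"
    show "eventually (\<lambda>n. h n \<le> D * real n powr \<gamma>) sequentially"
      using eventually_ge_at_top[of 1]
    proof eventually_elim
      case (elim n)
      then have n: "real n > 0" by simp
      have hp: "(real n / 2) powr e = 2 powr (- e) * real n powr e" for e
        by (simp add: powr_divide powr_minus_divide)
      have sp: "(real (n - k) / real n) powr \<gamma> = real n powr (- \<gamma>) * real (n - k) powr \<gamma>" for k
        by (subst powr_divide) (simp_all only: of_nat_0_le_iff powr_minus divide_inverse mult.commute)
      have "h n \<le> (\<Sum>k | k < n \<and> n < 2 * k. K * (real n / 2) powr (\<gamma> - 1) * (real (n - k) / real n) powr \<gamma>)"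
        unfolding h_def
      proof (intro sum_mono mult_right_mono)
        fix k assume k: "k \<in> {k. k < n \<and> n < 2 * k}"
        then have "c k \<le> K * real k powr (\<gamma> - 1)" by (intro K) auto
        also have "\<dots> \<le> K * (real n / 2) powr (\<gamma> - 1)"
          using k K n \<gamma> by (intro mult_left_mono powr_mono2') auto
        finally show "c k \<le> K * (real n / 2) powr (\<gamma> - 1)" .
      qed auto
      also have "\<dots> \<le> (\<Sum>k<n. K * (real n / 2) powr (\<gamma> - 1) * (real (n - k) / real n) powr \<gamma>)"
        using K by (intro sum_mono2) auto
      also have "\<dots> = K * (real n / 2) powr (\<gamma> - 1) * real n powr (- \<gamma>) * (\<Sum>j=1..n. real j powr \<gamma>)"
      proof -
        have r: "(\<Sum>k<n. real (n - k) powr \<gamma>) = (\<Sum>j=1..n. real j powr \<gamma>)"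
          by (rule sum.reindex_bij_witness[of _ "\<lambda>i. n - i" "\<lambda>j. n - j"]) auto
        show ?thesis unfolding r[symmetric] sp sum_distrib_left by (simp only: mult.assoc)
      qed
      also have "\<dots> \<le> K * (real n / 2) powr (\<gamma> - 1) * real n powr (- \<gamma>) * (real n powr (\<gamma> + 1) / (\<gamma> + 1))"
        using K \<gamma> by (intro mult_left_mono sum_powr_le) auto
      also have "\<dots> = D * real n powr \<gamma>"
      proof -
        have r: "real n powr \<gamma> = real n powr (\<gamma> - 1) * real n powr (- \<gamma>) * real n powr (\<gamma> + 1)"
          by (simp only: powr_add[symmetric]) simp
        show ?thesis
          unfolding D_def hp r by (simp only: times_divide_eq_right times_divide_eq_left mult_ac minus_diff_eq)
      qed
      finally show ?case .
    qed
    show "(\<lambda>n. D * real n powr \<gamma>) \<longlonglongrightarrow> 0"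
      using tendsto_mult_right_zero[OF tendsto_neg_powr[OF \<gamma>(2) filterlim_real_sequentially]] by blast
  qed
  have A: "(\<lambda>n. (\<Sum>k. g n k) + h n) \<longlonglongrightarrow> (\<Sum>k. c k) + 0"
    by (intro tendsto_add glim hlim)
  have B: "eventually (\<lambda>n. (\<Sum>k. g n k) + h n = c n * real n powr (1 - \<gamma>)) sequentially"
    using eventually_ge_at_top[of 1] by eventually_elim (simp add: eq)
  show ?thesis
    using Lim_transform_eventually[OF A B] by (simp add: c_def)
qed

section \<open>Counting lattice points\<close>

definition real_site :: "int ^ 'd::finite \<Rightarrow> real ^ 'd" where
  "real_site x = (\<chi> i. real_of_int (x $ i))"

lemma norm_scaled_site: "L > 0 \<Longrightarrow> norm (scaled_site L x) = norm (real_site x) / L"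
proof -
  assume L: "L > 0"
  have "scaled_site L x = (1 / L) *\<^sub>R real_site x"
    by (simp add: scaled_site_def real_site_def vec_eq_iff)
  with L show ?thesis by simp
qed

lemma norm_real_site_ge_1:
  assumes "x \<noteq> 0"
  shows "norm (real_site x) \<ge> 1"
proof -
  obtain i where "x $ i \<noteq> 0" using assms by (auto simp: vec_eq_iff)
  then have "1 \<le> \<bar>real_site x $ i\<bar>" by (simp add: real_site_def)
  also have "\<dots> \<le> norm (real_site x)" by (rule component_le_norm_cart)
  finally show ?thesis .
qed

definition unit_cell :: "int ^ 'd::finite \<Rightarrow> (real ^ 'd) set" where
  "unit_cell x = {y. \<forall>i. \<lfloor>y $ i\<rfloor> = x $ i}"

lemma unit_cell_measurable [measurable]: "unit_cell x \<in> sets borel"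
  unfolding unit_cell_def by measurable

lemma emeasure_unit_cell: "emeasure lborel (unit_cell (x :: int ^ 'd::finite)) = 1"
proof -
  define u where "u = (\<chi> i. real_of_int (x $ i) + 1)"
  have d: "(u - real_site x) \<bullet> b = 1" if "b \<in> Basis" for b
    using that by (auto simp: Basis_vec_def inner_axis u_def real_site_def)
  have le: "real_site x \<bullet> b \<le> u \<bullet> b" if "b \<in> Basis" for b
    using d[OF that] by (simp add: inner_diff_left)
  have "emeasure lborel (box (real_site x) u) \<le> emeasure lborel (unit_cell x)"
    by (intro emeasure_mono) (auto simp: unit_cell_def mem_box_cart real_site_def u_def floor_eq_iff less_imp_le)
  moreover have "emeasure lborel (unit_cell x) \<le> emeasure lborel (cbox (real_site x) u)"
    by (intro emeasure_mono) (auto simp: unit_cell_def mem_box_cart real_site_def u_def floor_eq_iff less_imp_le)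
  moreover have "emeasure lborel (box (real_site x) u) = 1" "emeasure lborel (cbox (real_site x) u) = 1"
    using le d by (simp_all add: emeasure_lborel_box emeasure_lborel_cbox)
  ultimately show ?thesis by (simp add: antisym)
qed

definition lattice_count :: "'d::finite itself \<Rightarrow> real \<Rightarrow> real" where
  "lattice_count _ R = real (card {x :: int ^ 'd. x \<noteq> 0 \<and> norm (real_site x) \<le> R})"

lemma finite_lattice_ball: "finite {x :: int ^ 'd::finite. norm (real_site x) \<le> R}"
proof (rule finite_subset)
  show "{x :: int ^ 'd. norm (real_site x) \<le> R} \<subseteq> vec_lambda ` (PiE UNIV (\<lambda>_. {- \<lceil>R\<rceil>..\<lceil>R\<rceil>}))"
  proof safe
    fix x :: "int ^ 'd" assume x: "norm (real_site x) \<le> R"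
    have "\<bar>x $ i\<bar> \<le> \<lceil>R\<rceil>" for i
    proof -
      have "\<bar>real_site x $ i\<bar> \<le> R" using component_le_norm_cart[of "real_site x" i] x by simp
      then have "real_of_int \<bar>x $ i\<bar> \<le> R" by (simp add: real_site_def)
      then show ?thesis by linarith
    qed
    then have "vec_nth x \<in> PiE UNIV (\<lambda>_. {- \<lceil>R\<rceil>..\<lceil>R\<rceil>})" by (auto simp: abs_le_iff) (smt (verit))
    then show "x \<in> vec_lambda ` (PiE UNIV (\<lambda>_. {- \<lceil>R\<rceil>..\<lceil>R\<rceil>}))"
      by (metis image_eqI vec_nth_inverse)
  qed
qed (intro finite_imageI finite_PiE, auto)

text \<open>
The unit cells whose lattice points lie in the ball of radius \<open>R\<close> are disjoint and have volume one.
Their union lies between the balls of radius \<open>R - d\<close> and \<open>R + d\<close>, since a cell has diameter at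
most \<open>d\<close>. The summand \<open>1\<close> stands for the origin, which \<open>lattice_count\<close> leaves out.
\<close>

lemma lattice_count_sandwich:
  defines "d \<equiv> CARD('d::finite)"
  assumes R: "R \<ge> 0"
  shows "lattice_count TYPE('d) R + 1 \<le> unit_ball_vol d * (R + d) ^ d"
    and "R \<ge> d \<Longrightarrow> unit_ball_vol d * (R - d) ^ d \<le> lattice_count TYPE('d) R + 1"
proof -
  define A where "A = {x :: int ^ 'd. norm (real_site x) \<le> R}"
  have fin: "finite A" unfolding A_def by (rule finite_lattice_ball)
  have "real_site (0 :: int ^ 'd) = 0" by (simp add: real_site_def vec_eq_iff)
  then have "A = insert 0 {x. x \<noteq> 0 \<and> norm (real_site x) \<le> R}"
    using R by (auto simp: A_def)
  then have cA: "real (card A) = lattice_count TYPE('d) R + 1"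
    using fin by (simp add: lattice_count_def)
  have "emeasure lborel (\<Union>x\<in>A. unit_cell x) = (\<Sum>x\<in>A. emeasure lborel (unit_cell x))"
    using fin by (intro sum_emeasure[symmetric])
      (auto simp: disjoint_family_on_def unit_cell_def vec_eq_iff)
  then have em: "emeasure lborel (\<Union>x\<in>A. unit_cell x) = ennreal (lattice_count TYPE('d) R + 1)"
    by (simp add: emeasure_unit_cell cA[symmetric] ennreal_of_nat_eq_real_of_nat)
  have dist: "norm (y - real_site x) \<le> d" if "y \<in> unit_cell x" for x :: "int ^ 'd" and y
  proof -
    have "norm (y - real_site x) \<le> (\<Sum>i\<in>UNIV. \<bar>(y - real_site x) $ i\<bar>)" by (rule norm_le_l1_cart)
    also have "\<dots> \<le> (\<Sum>i\<in>(UNIV :: 'd set). 1)"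
    proof (rule sum_mono)
      fix i have "\<lfloor>y $ i\<rfloor> = x $ i" using that by (simp add: unit_cell_def)
      then show "\<bar>(y - real_site x) $ i\<bar> \<le> 1" unfolding real_site_def by simp linarith
    qed
    finally show ?thesis by (simp add: d_def)
  qed
  have "(\<Union>x\<in>A. unit_cell x) \<subseteq> cball 0 (R + d)"
  proof safe
    fix x y assume "x \<in> A" "y \<in> unit_cell x"
    then have "norm (real_site x) \<le> R" "norm (y - real_site x) \<le> d" using dist by (auto simp: A_def)
    then have "norm y \<le> R + d" using norm_triangle_sub[of y "real_site x"] by simp
    then show "y \<in> cball 0 (R + d)" by simp
  qed
  then have "ennreal (lattice_count TYPE('d) R + 1) \<le> emeasure lborel (cball (0 :: real ^ 'd) (R + d))"
    unfolding em[symmetric] by (intro emeasure_mono) auto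
  also have "\<dots> = ennreal (unit_ball_vol d * (R + d) ^ d)"
    using R by (simp add: emeasure_cball d_def)
  finally show "lattice_count TYPE('d) R + 1 \<le> unit_ball_vol d * (R + d) ^ d"
    using R by (subst (asm) ennreal_le_iff) (auto intro!: mult_nonneg_nonneg)
  assume Rd: "R \<ge> d"
  have "cball 0 (R - d) \<subseteq> (\<Union>x\<in>A. unit_cell x)"
  proof
    fix y :: "real ^ 'd" assume y: "y \<in> cball 0 (R - d)"
    define x :: "int ^ 'd" where "x = (\<chi> i. \<lfloor>y $ i\<rfloor>)"
    have yx: "y \<in> unit_cell x" by (simp add: unit_cell_def x_def)
    have "norm (real_site x) \<le> norm y + norm (y - real_site x)"
      using norm_triangle_sub[of "real_site x" y] by (simp add: norm_minus_commute)
    also have "\<dots> \<le> R" using y dist[OF yx] by simp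
    finally show "y \<in> (\<Union>x\<in>A. unit_cell x)" using yx by (auto simp: A_def)
  qed
  then have "emeasure lborel (cball (0 :: real ^ 'd) (R - d)) \<le> ennreal (lattice_count TYPE('d) R + 1)"
    unfolding em[symmetric] using fin by (intro emeasure_mono) auto
  also have "emeasure lborel (cball (0 :: real ^ 'd) (R - d)) = ennreal (unit_ball_vol d * (R - d) ^ d)"
    using Rd by (simp add: emeasure_cball d_def)
  finally show "unit_ball_vol d * (R - d) ^ d \<le> lattice_count TYPE('d) R + 1"
    by (subst (asm) ennreal_le_iff) (auto simp: lattice_count_def)
qed

text \<open>
Nonzero lattice points have norm at least one, so the count vanishes for \<open>R < 1\<close>. Therefore every
exponent above the dimension is allowed, uniformly in \<open>R\<close>; the larger ones yield fast decay of
\<open>site_sum\<close> at infinity.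
\<close>

lemma lattice_count_bound:
  assumes p: "p \<ge> real CARD('d::finite)"
  obtains K where "K > 0" "\<And>R. R \<ge> 0 \<Longrightarrow> lattice_count TYPE('d) R \<le> K * R powr p"
proof -
  define d where "d = CARD('d)"
  define K where "K = unit_ball_vol d * (1 + d) ^ d"
  have K: "K > 0" by (simp add: K_def)
  have "lattice_count TYPE('d) R \<le> K * R powr p" if R: "R \<ge> 0" for R
  proof (cases "R < 1")
    case True
    have "{x :: int ^ 'd. x \<noteq> 0 \<and> norm (real_site x) \<le> R} = {}"
    proof safe
      fix x :: "int ^ 'd" assume "x \<noteq> 0" "norm (real_site x) \<le> R"
      with norm_real_site_ge_1[of x] True show "x \<in> {}" by simp
    qed
    then have "lattice_count TYPE('d) R = 0"
      unfolding lattice_count_def by (simp only: card.empty of_nat_0)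
    with K show ?thesis by simp
  next
    case False
    have "lattice_count TYPE('d) R \<le> unit_ball_vol d * (R + d) ^ d"
      using lattice_count_sandwich(1)[where 'd = 'd, OF R] by (simp add: d_def)
    also have "\<dots> \<le> unit_ball_vol d * ((1 + d) * R) ^ d"
      using False mult_left_mono[of 1 R "real d"] by (intro mult_left_mono power_mono) (auto simp: algebra_simps)
    also have "\<dots> = K * R powr d"
      using False by (simp add: K_def power_mult_distrib powr_realpow)
    also have "\<dots> \<le> K * R powr p"
      using K False p by (intro mult_left_mono powr_mono) (auto simp: d_def)
    finally show ?thesis .
  qed
  with K that show ?thesis by blast
qed

lemma lattice_count_asymp:
  "((\<lambda>R. lattice_count TYPE('d::finite) R / R ^ CARD('d)) \<longlongrightarrow> unit_ball_vol CARD('d)) at_top"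
proof -
  define d where "d = CARD('d)"
  define w where "w = unit_ball_vol d"
  have dpos: "d > 0" by (simp add: d_def)
  have inv: "((\<lambda>R::real. c / R) \<longlongrightarrow> 0) at_top" for c :: real
    by (intro tendsto_divide_0[OF tendsto_const] filterlim_at_top_imp_at_infinity filterlim_ident)
  have inv': "((\<lambda>R::real. 1 / R ^ d) \<longlongrightarrow> 0) at_top"
    by (intro tendsto_divide_0[OF tendsto_const] filterlim_at_top_imp_at_infinity filterlim_pow_at_top dpos filterlim_ident)
  have up: "((\<lambda>R. w * (1 + d / R) ^ d - 1 / R ^ d) \<longlongrightarrow> w * (1 + 0) ^ d - 0) at_top"
    by (intro tendsto_intros inv inv')
  have lo: "((\<lambda>R. w * (1 - d / R) ^ d - 1 / R ^ d) \<longlongrightarrow> w * (1 - 0) ^ d - 0) at_top"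
    by (intro tendsto_intros inv inv')
  have "((\<lambda>R. lattice_count TYPE('d) R / R ^ d) \<longlongrightarrow> w) at_top"
  proof (rule tendsto_sandwich)
    show "eventually (\<lambda>R. lattice_count TYPE('d) R / R ^ d \<le> w * (1 + d / R) ^ d - 1 / R ^ d) at_top"
      using eventually_gt_at_top[of 0]
    proof eventually_elim
      case (elim R)
      have "lattice_count TYPE('d) R \<le> w * (R + d) ^ d - 1"
        using lattice_count_sandwich(1)[where 'd = 'd, of R] elim by (simp add: d_def w_def)
      then have "lattice_count TYPE('d) R / R ^ d \<le> (w * (R + d) ^ d - 1) / R ^ d"
        using elim by (intro divide_right_mono) auto
      also have "\<dots> = w * ((R + d) / R) ^ d - 1 / R ^ d"
        by (simp add: diff_divide_distrib power_divide)
      also have "(R + d) / R = 1 + d / R" using elim by (simp add: add_divide_distrib)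
      finally show ?case .
    qed
    show "eventually (\<lambda>R. w * (1 - d / R) ^ d - 1 / R ^ d \<le> lattice_count TYPE('d) R / R ^ d) at_top"
      using eventually_gt_at_top[of "real d"]
    proof eventually_elim
      case (elim R)
      then have R: "R > 0" using dpos by linarith
      have "w * (R - d) ^ d - 1 \<le> lattice_count TYPE('d) R"
        using lattice_count_sandwich(2)[where 'd = 'd, of R] elim R by (simp add: d_def w_def)
      then have "(w * (R - d) ^ d - 1) / R ^ d \<le> lattice_count TYPE('d) R / R ^ d"
        using R by (intro divide_right_mono) auto
      moreover have "(w * (R - d) ^ d - 1) / R ^ d = w * ((R - d) / R) ^ d - 1 / R ^ d"
        unfolding power_divide by (simp only: diff_divide_distrib times_divide_eq_right)
      moreover have "(R - d) / R = 1 - d / R" using R by (simp add: diff_divide_distrib)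
      ultimately show ?case by simp
    qed
  qed (use up lo in auto)
  then show ?thesis by (simp add: d_def w_def)
qed

section \<open>Sums over the sites away from the origin\<close>

text \<open>
Write \<open>exp (- f x)\<close> as the integral of \<open>exp (- u)\<close> over \<open>u \<ge> f x\<close> and use Tonelli. This turns
sums over lattice points into lattice counts and volume integrals into ball volumes.
\<close>

lemma layer_cake_exp:
  assumes "sigma_finite_measure M" and [measurable]: "f \<in> borel_measurable M"
    and f: "\<And>x. x \<in> space M \<Longrightarrow> 0 \<le> f x"
  shows "(\<integral>\<^sup>+x. ennreal (exp (- f x)) \<partial>M)
    = (\<integral>\<^sup>+u. ennreal (exp (- u)) * emeasure M {x \<in> space M. f x \<le> u} * indicator {0..} u \<partial>lborel)"
proof -
  interpret sigma_finite_measure M by fact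
  interpret pair_sigma_finite lborel M ..
  have e: "ennreal (exp (- r)) = (\<integral>\<^sup>+u. ennreal (exp (- u)) * indicator {r..} u \<partial>lborel)" for r :: real
  proof -
    have "(\<integral>\<^sup>+u. ennreal (exp (- u)) * indicator {r..} u \<partial>lborel) = ennreal (0 - (- exp (- r)))"
    proof (rule nn_integral_FTC_atLeast)
      show "((\<lambda>u::real. - exp (- u)) \<longlongrightarrow> 0) at_top"
        by real_asymp
      show "((\<lambda>u::real. - exp (- u)) has_real_derivative exp (- x)) (at x)" for x
        by (auto intro!: derivative_eq_intros)
    qed auto
    then show ?thesis by simp
  qed
  have "(\<integral>\<^sup>+x. ennreal (exp (- f x)) \<partial>M) = (\<integral>\<^sup>+x. \<integral>\<^sup>+u. ennreal (exp (- u)) * indicator {f x..} u \<partial>lborel \<partial>M)"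
    by (intro nn_integral_cong e)
  also have "\<dots> = (\<integral>\<^sup>+u. \<integral>\<^sup>+x. ennreal (exp (- u)) * indicator {f x..} u \<partial>M \<partial>lborel)"
    by (rule Fubini') (simp add: indicator_def)
  also have "\<dots> = (\<integral>\<^sup>+u. ennreal (exp (- u)) * emeasure M {x \<in> space M. f x \<le> u} * indicator {0..} u \<partial>lborel)"
  proof (intro nn_integral_cong)
    fix u :: real
    have "(\<integral>\<^sup>+x. ennreal (exp (- u)) * indicator {f x..} u \<partial>M) = (\<integral>\<^sup>+x. ennreal (exp (- u)) * indicator {x \<in> space M. f x \<le> u} x \<partial>M)"
      by (intro nn_integral_cong) (auto simp: indicator_def)
    also have "\<dots> = ennreal (exp (- u)) * emeasure M {x \<in> space M. f x \<le> u}"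
      by (simp add: nn_integral_cmult)
    also have "\<dots> = ennreal (exp (- u)) * emeasure M {x \<in> space M. f x \<le> u} * indicator {0..} u"
    proof (cases "0 \<le> u")
      case False
      then have "{x \<in> space M. f x \<le> u} = {}" using f by force
      then show ?thesis by (simp only: emeasure_empty) simp
    qed auto
    finally show "(\<integral>\<^sup>+x. ennreal (exp (- u)) * indicator {f x..} u \<partial>M) = \<dots>" .
  qed
  finally show ?thesis .
qed

lemma powr_le_iff_le_root:
  fixes x v u \<delta> :: real
  assumes "x \<ge> 0" "v > 0" "\<delta> > 0" "u \<ge> 0"
  shows "v * x powr \<delta> \<le> u \<longleftrightarrow> x \<le> (u / v) powr (1 / \<delta>)"
proof -
  have "v * x powr \<delta> \<le> u \<longleftrightarrow> x powr \<delta> \<le> ((u / v) powr (1 / \<delta>)) powr \<delta>"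
    using assms by (simp add: powr_powr field_simps)
  also have "\<dots> \<longleftrightarrow> x \<le> (u / v) powr (1 / \<delta>)"
    using assms powr_mono2[of \<delta> x] powr_less_mono2[of \<delta> "(u / v) powr (1 / \<delta>)" x] by fastforce
  finally show ?thesis .
qed

lemma nn_integral_Gamma:
  assumes "x > 0"
  shows "(\<integral>\<^sup>+u. ennreal (u powr (x - 1) * exp (- u)) * indicator {0..} u \<partial>lborel) = ennreal (Gamma x)"
proof -
  have "((\<lambda>u. if u \<in> {0..} then u powr (x - 1) / exp u else 0) has_integral Gamma x) UNIV"
    using Gamma_integral_real[OF assms] by (subst has_integral_restrict_UNIV)
  then have "(\<integral>\<^sup>+u. ennreal (if u \<in> {0..} then u powr (x - 1) / exp u else 0) \<partial>lborel) = ennreal (Gamma x)"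
    by (rule nn_integral_has_integral_lborel[rotated 2]) auto
  moreover have "(\<integral>\<^sup>+u. ennreal (if u \<in> {0..} then u powr (x - 1) / exp u else 0) \<partial>lborel)
     = (\<integral>\<^sup>+u. ennreal (u powr (x - 1) * exp (- u)) * indicator {0..} u \<partial>lborel)"
    by (intro nn_integral_cong) (simp add: exp_minus divide_inverse indicator_def)
  ultimately show ?thesis by simp
qed

text \<open>
\<open>site_sum TYPE('d) \<delta> (j / L powr \<delta>)\<close> is the sum of \<open>exp (- j * V (x / L))\<close> over all
\<open>x \<noteq> 0\<close>: the geometry of the model enters through this function of one variable only.
\<close>

definition site_sum :: "'d::finite itself \<Rightarrow> real \<Rightarrow> real \<Rightarrow> real" where
  "site_sum _ \<delta> v = (\<Sum>\<^sub>\<infinity>x\<in>- {0 :: int ^ 'd}. exp (- v * norm (real_site x) powr \<delta>))"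

lemma site_sum_layer_cake:
  assumes \<delta>: "\<delta> > 0" and v: "v > 0"
  shows "(\<integral>\<^sup>+x. ennreal (exp (- v * norm (real_site x) powr \<delta>)) \<partial>count_space (- {0 :: int ^ 'd::finite}))
     = (\<integral>\<^sup>+u. ennreal (exp (- u) * lattice_count TYPE('d) ((u / v) powr (1 / \<delta>))) * indicator {0..} u \<partial>lborel)"
proof -
  have "(\<integral>\<^sup>+x. ennreal (exp (- (v * norm (real_site x) powr \<delta>))) \<partial>count_space (- {0 :: int ^ 'd}))
    = (\<integral>\<^sup>+u. ennreal (exp (- u)) * emeasure (count_space (- {0 :: int ^ 'd})) {x \<in> space (count_space (- {0})). v * norm (real_site x) powr \<delta> \<le> u} * indicator {0..} u \<partial>lborel)"
    by (rule layer_cake_exp) (use v in \<open>auto intro!: sigma_finite_measure_count_space_countable\<close>)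
  also have "\<dots> = (\<integral>\<^sup>+u. ennreal (exp (- u) * lattice_count TYPE('d) ((u / v) powr (1 / \<delta>))) * indicator {0..} u \<partial>lborel)"
  proof (intro nn_integral_cong)
    fix u :: real
    show "ennreal (exp (- u)) * emeasure (count_space (- {0 :: int ^ 'd})) {x \<in> space (count_space (- {0})). v * norm (real_site x) powr \<delta> \<le> u} * indicator {0..} u
      = ennreal (exp (- u) * lattice_count TYPE('d) ((u / v) powr (1 / \<delta>))) * indicator {0..} u"
    proof (cases "u \<ge> 0")
      case True
      let ?R = "(u / v) powr (1 / \<delta>)"
      have eq: "{x \<in> space (count_space (- {0 :: int ^ 'd})). v * norm (real_site x) powr \<delta> \<le> u} = {x. x \<noteq> 0 \<and> norm (real_site x) \<le> ?R}"
        using powr_le_iff_le_root[OF norm_ge_zero v \<delta> True] by auto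
      have "finite {x :: int ^ 'd. x \<noteq> 0 \<and> norm (real_site x) \<le> ?R}"
        by (rule finite_subset[OF _ finite_lattice_ball[of ?R]]) auto
      then have "emeasure (count_space (- {0 :: int ^ 'd})) {x. x \<noteq> 0 \<and> norm (real_site x) \<le> ?R} = ennreal (lattice_count TYPE('d) ?R)"
        by (subst emeasure_count_space_finite) (auto simp: lattice_count_def ennreal_of_nat_eq_real_of_nat)
      then show ?thesis unfolding eq by (simp add: ennreal_mult lattice_count_def)
    qed simp
  qed
  finally show ?thesis by simp
qed

lemma borel_measurable_lattice_count [measurable]: "lattice_count TYPE('d::finite) \<in> borel_measurable borel"
proof (rule borel_measurable_mono, rule monoI)
  fix x y :: real assume "x \<le> y"
  then have sub: "{z :: int ^ 'd. z \<noteq> 0 \<and> norm (real_site z) \<le> x} \<subseteq> {z. z \<noteq> 0 \<and> norm (real_site z) \<le> y}"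
    by (blast intro: order_trans)
  have fin: "finite {z :: int ^ 'd. z \<noteq> 0 \<and> norm (real_site z) \<le> y}"
    by (rule finite_subset[OF _ finite_lattice_ball[of y]]) blast
  show "lattice_count TYPE('d) x \<le> lattice_count TYPE('d) y"
    unfolding lattice_count_def of_nat_le_iff by (rule card_mono[OF fin sub])
qed

lemma nn_integral_site_sum_bound:
  assumes \<delta>: "\<delta> > 0" and p: "p \<ge> real CARD('d::finite) / \<delta>"
  obtains K where "K > 0" "\<And>v. v > 0 \<Longrightarrow> (\<integral>\<^sup>+x. ennreal (exp (- v * norm (real_site x) powr \<delta>)) \<partial>count_space (- {0 :: int ^ 'd})) \<le> ennreal (K * v powr (- p))"
proof -
  have p0: "p > 0" using p by (rule less_le_trans[rotated]) (use \<delta> in simp)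
  obtain K where K: "K > 0" "\<And>R. R \<ge> 0 \<Longrightarrow> lattice_count TYPE('d) R \<le> K * R powr (p * \<delta>)"
  proof -
    have "real CARD('d) \<le> p * \<delta>" using p \<delta> by (simp add: pos_divide_le_eq)
    from lattice_count_bound[OF this] that show thesis by blast
  qed
  show thesis
  proof
    show "K * Gamma (p + 1) > 0" using K p0 by simp
    fix v :: real assume v: "v > 0"
    have "(\<integral>\<^sup>+x. ennreal (exp (- v * norm (real_site x) powr \<delta>)) \<partial>count_space (- {0 :: int ^ 'd}))
      \<le> (\<integral>\<^sup>+u. ennreal (K * v powr (- p)) * (ennreal (u powr (p + 1 - 1) * exp (- u)) * indicator {0..} u) \<partial>lborel)"
      unfolding site_sum_layer_cake[OF \<delta> v]
    proof (intro nn_integral_mono)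
      fix u :: real
      show "ennreal (exp (- u) * lattice_count TYPE('d) ((u / v) powr (1 / \<delta>))) * indicator {0..} u
        \<le> ennreal (K * v powr (- p)) * (ennreal (u powr (p + 1 - 1) * exp (- u)) * indicator {0..} u)"
      proof (cases "u \<ge> 0")
        case True
        have "lattice_count TYPE('d) ((u / v) powr (1 / \<delta>)) \<le> K * ((u / v) powr (1 / \<delta>)) powr (p * \<delta>)"
          by (intro K) auto
        also have "\<dots> = K * (v powr (- p) * u powr p)"
          using \<delta> True v by (simp add: powr_powr powr_divide powr_minus_divide)
        finally have "exp (- u) * lattice_count TYPE('d) ((u / v) powr (1 / \<delta>)) \<le> exp (- u) * (K * (v powr (- p) * u powr p))"
          by (intro mult_left_mono) auto
        then have "ennreal (exp (- u) * lattice_count TYPE('d) ((u / v) powr (1 / \<delta>))) \<le> ennreal (K * v powr (- p) * (u powr p * exp (- u)))"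
          by (intro ennreal_leI) (simp add: mult_ac)
        with True K show ?thesis by (simp add: ennreal_mult)
      qed simp
    qed
    also have "\<dots> = ennreal (K * v powr (- p)) * ennreal (Gamma (p + 1))"
      using p0 by (subst nn_integral_cmult) (auto simp: nn_integral_Gamma[of "p + 1", simplified])
    also have "\<dots> = ennreal (K * Gamma (p + 1) * v powr (- p))"
      using K p0 by (simp add: ennreal_mult[symmetric] mult_ac)
    finally show "(\<integral>\<^sup>+x. ennreal (exp (- v * norm (real_site x) powr \<delta>)) \<partial>count_space (- {0 :: int ^ 'd})) \<le> ennreal (K * Gamma (p + 1) * v powr (- p))" .
  qed
qed

lemma
  assumes \<delta>: "\<delta> > 0" and v: "v > 0"
  shows site_sum_has_sum: "((\<lambda>x. exp (- v * norm (real_site x) powr \<delta>)) has_sum site_sum TYPE('d::finite) \<delta> v) (- {0 :: int ^ 'd})"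
    and nn_integral_site_sum: "(\<integral>\<^sup>+x. ennreal (exp (- v * norm (real_site x) powr \<delta>)) \<partial>count_space (- {0 :: int ^ 'd})) = ennreal (site_sum TYPE('d) \<delta> v)"
    and site_sum_nonneg: "site_sum TYPE('d) \<delta> v \<ge> 0"
proof -
  let ?I = "\<integral>\<^sup>+x. ennreal (exp (- v * norm (real_site x) powr \<delta>)) \<partial>count_space (- {0 :: int ^ 'd})"
  obtain K where "?I \<le> ennreal (K * v powr (- (real CARD('d) / \<delta>)))"
    using nn_integral_site_sum_bound[OF \<delta> order_refl, where 'd = 'd] v by blast
  also have "\<dots> < top" by simp
  finally have I: "?I = ennreal (enn2real ?I)" by simp
  define c where "c = enn2real ?I"
  have c: "c \<ge> 0" "?I = ennreal c" unfolding c_def by (rule enn2real_nonneg) (rule I)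
  have h: "((\<lambda>x. exp (- v * norm (real_site x) powr \<delta>)) has_sum c) (- {0 :: int ^ 'd})"
    by (rule has_sum_of_nn_integral_count_space) (use c in auto)
  then have "site_sum TYPE('d) \<delta> v = c" by (simp add: site_sum_def infsumI)
  with h c show "((\<lambda>x. exp (- v * norm (real_site x) powr \<delta>)) has_sum site_sum TYPE('d::finite) \<delta> v) (- {0 :: int ^ 'd})"
    "(\<integral>\<^sup>+x. ennreal (exp (- v * norm (real_site x) powr \<delta>)) \<partial>count_space (- {0 :: int ^ 'd})) = ennreal (site_sum TYPE('d) \<delta> v)"
    "site_sum TYPE('d) \<delta> v \<ge> 0" by auto
qed

lemma site_sum_bound:
  assumes \<delta>: "\<delta> > 0" and p: "p \<ge> real CARD('d::finite) / \<delta>"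
  obtains K where "K > 0" "\<And>v. v > 0 \<Longrightarrow> site_sum TYPE('d) \<delta> v \<le> K * v powr (- p)"
proof -
  obtain K where K: "K > 0" "\<And>v. v > 0 \<Longrightarrow> (\<integral>\<^sup>+x. ennreal (exp (- v * norm (real_site x) powr \<delta>)) \<partial>count_space (- {0 :: int ^ 'd})) \<le> ennreal (K * v powr (- p))"
    using nn_integral_site_sum_bound[OF \<delta> p] by blast
  have "site_sum TYPE('d) \<delta> v \<le> K * v powr (- p)" if v: "v > 0" for v
    using K(2)[OF v] K(1) unfolding nn_integral_site_sum[OF \<delta> v] by (subst (asm) ennreal_le_iff) auto
  with K that show ?thesis by blast
qed

text \<open>
Every site in the sum has norm at least one, so half of the exponent can be spent on a factor
\<open>exp (v / 2)\<close> that does not depend on the site.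
\<close>

lemma site_sum_exp_le:
  assumes \<delta>: "\<delta> > 0" and v: "v > 0"
  shows "exp (v / 2) * site_sum TYPE('d::finite) \<delta> v \<le> site_sum TYPE('d) \<delta> (v / 2)"
proof (rule has_sum_mono)
  show "((\<lambda>x. exp (v / 2) * exp (- v * norm (real_site x) powr \<delta>)) has_sum exp (v / 2) * site_sum TYPE('d) \<delta> v) (- {0 :: int ^ 'd})"
    by (intro has_sum_cmult_right site_sum_has_sum \<delta> v)
  show "((\<lambda>x. exp (- (v / 2) * norm (real_site x) powr \<delta>)) has_sum site_sum TYPE('d) \<delta> (v / 2)) (- {0 :: int ^ 'd})"
    using v by (intro site_sum_has_sum \<delta>) auto
  fix x :: "int ^ 'd" assume "x \<in> - {0}"
  then have "norm (real_site x) powr \<delta> \<ge> 1"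
    using norm_real_site_ge_1[of x] \<delta> by (simp add: ge_one_powr_ge_zero)
  then have "v / 2 * 1 \<le> v / 2 * norm (real_site x) powr \<delta>" using v by (intro mult_left_mono) auto
  then show "exp (v / 2) * exp (- v * norm (real_site x) powr \<delta>) \<le> exp (- (v / 2) * norm (real_site x) powr \<delta>)"
    by (simp add: exp_add[symmetric])
qed

text \<open>
The integral of \<open>exp (- norm x powr \<delta>)\<close>, see \<open>nn_integral_exp_norm\<close>.
\<close>

definition volume_const :: "'d::finite itself \<Rightarrow> real \<Rightarrow> real" where
  "volume_const _ \<delta> = unit_ball_vol CARD('d) * Gamma (real CARD('d) / \<delta> + 1)"

lemma volume_const_pos: "\<delta> > 0 \<Longrightarrow> volume_const TYPE('d::finite) \<delta> > 0"
  unfolding volume_const_def by (intro mult_pos_pos unit_ball_vol_pos Gamma_real_pos add_nonneg_pos) auto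

lemma nn_integral_exp_norm:
  assumes \<delta>: "\<delta> > 0" and y: "y > 0"
  shows "(\<integral>\<^sup>+x. ennreal (exp (- y * norm x powr \<delta>)) \<partial>(lborel :: (real ^ 'd::finite) measure))
    = ennreal (volume_const TYPE('d) \<delta> * y powr (- (real CARD('d) / \<delta>)))"
proof -
  define a where "a = real CARD('d) / \<delta>"
  define w where "w = unit_ball_vol CARD('d)"
  have a: "a > 0" using \<delta> by (simp add: a_def)
  have Ga: "(\<integral>\<^sup>+u. ennreal (u powr (a + 1 - 1) * exp (- u)) * indicator {0..} u \<partial>lborel) = ennreal (Gamma (a + 1))"
    using a by (intro nn_integral_Gamma) simp
  have "(\<integral>\<^sup>+x. ennreal (exp (- (y * norm x powr \<delta>))) \<partial>(lborel :: (real ^ 'd) measure))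
    = (\<integral>\<^sup>+u. ennreal (exp (- u)) * emeasure (lborel :: (real ^ 'd) measure) {x \<in> space lborel. y * norm x powr \<delta> \<le> u} * indicator {0..} u \<partial>lborel)"
    using y by (intro layer_cake_exp) (auto intro: lborel.sigma_finite_measure_axioms)
  also have "\<dots> = (\<integral>\<^sup>+u. ennreal (w * y powr (- a)) * (ennreal (u powr (a + 1 - 1) * exp (- u)) * indicator {0..} u) \<partial>lborel)"
  proof (intro nn_integral_cong)
    fix u :: real
    show "ennreal (exp (- u)) * emeasure (lborel :: (real ^ 'd) measure) {x \<in> space lborel. y * norm x powr \<delta> \<le> u} * indicator {0..} u
      = ennreal (w * y powr (- a)) * (ennreal (u powr (a + 1 - 1) * exp (- u)) * indicator {0..} u)"
    proof (cases "u \<ge> 0")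
      case True
      have "{x \<in> space lborel. y * norm x powr \<delta> \<le> u} = cball (0 :: real ^ 'd) ((u / y) powr (1 / \<delta>))"
        by (auto simp: powr_le_iff_le_root[OF norm_ge_zero y \<delta> True])
      then have "emeasure (lborel :: (real ^ 'd) measure) {x \<in> space lborel. y * norm x powr \<delta> \<le> u}
         = ennreal (w * ((u / y) powr (1 / \<delta>)) ^ CARD('d))"
        by (simp add: emeasure_cball w_def)
      also have "((u / y) powr (1 / \<delta>)) ^ CARD('d) = (u / y) powr a"
        using y \<delta> by (cases "u = 0") (simp_all add: powr_power a_def zero_power)
      also have "(u / y) powr a = y powr (- a) * u powr a"
        using True y by (simp add: powr_divide powr_minus_divide)
      finally show ?thesis
        using True by (simp add: ennreal_mult[symmetric] w_def mult_ac)
    qed simp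
  qed
  also have "\<dots> = ennreal (w * y powr (- a)) * ennreal (Gamma (a + 1))"
    unfolding Ga[symmetric] by (rule nn_integral_cmult) simp
  also have "\<dots> = ennreal (volume_const TYPE('d) \<delta> * y powr (- a))"
    using a by (simp add: ennreal_mult[symmetric] volume_const_def w_def a_def mult_ac)
  finally show ?thesis by (simp add: a_def)
qed

text \<open>
After the layer-cake formula the claim is \<open>lattice_count R ~ unit_ball_vol * R ^ d\<close> under the
integral; the uniform bound on the count dominates.
\<close>

lemma site_sum_asymp:
  assumes \<delta>: "\<delta> > 0"
  defines "a \<equiv> real CARD('d::finite) / \<delta>"
  shows "((\<lambda>v. v powr a * site_sum TYPE('d) \<delta> v) \<longlongrightarrow> volume_const TYPE('d) \<delta>) (at_right 0)"
proof (rule tendsto_at_right_sequentially[of 0 1])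
  define w where "w = unit_ball_vol CARD('d)"
  let ?N = "lattice_count TYPE('d)"
  have a: "a > 0" using \<delta> by (simp add: a_def)
  obtain K where K: "K > 0" "\<And>R. R \<ge> 0 \<Longrightarrow> ?N R \<le> K * R powr real CARD('d)"
    using lattice_count_bound[OF order_refl, where 'd = 'd] by blast
  fix S :: "nat \<Rightarrow> real" assume S: "\<And>n. 0 < S n" "S \<longlonglongrightarrow> 0"
  define f where "f = (\<lambda>n u. S n powr a * (exp (- u) * ?N ((u / S n) powr (1 / \<delta>))) * indicator {0..} u)"
  define F where "F = (\<lambda>u::real. w * (u powr (a + 1 - 1) * exp (- u)) * indicator {0..} u)"
  define W where "W = (\<lambda>u::real. K * (u powr (a + 1 - 1) * exp (- u)) * indicator {0..} u)"
  have Ga: "(\<integral>\<^sup>+u. ennreal (u powr (a + 1 - 1) * exp (- u)) * indicator {0..} u \<partial>lborel) = ennreal (Gamma (a + 1))"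
    using a by (intro nn_integral_Gamma) simp
  have nnG: "(\<integral>\<^sup>+u. ennreal (c * (u powr (a + 1 - 1) * exp (- u)) * indicator {0..} u) \<partial>lborel) = ennreal (c * Gamma (a + 1))" if "c \<ge> 0" for c
  proof -
    have "(\<integral>\<^sup>+u. ennreal (c * (u powr (a + 1 - 1) * exp (- u)) * indicator {0..} u) \<partial>lborel)
       = (\<integral>\<^sup>+u. ennreal c * (ennreal (u powr (a + 1 - 1) * exp (- u)) * indicator {0..} u) \<partial>lborel)"
      using that by (intro nn_integral_cong) (auto simp: ennreal_mult split: split_indicator)
    also have "\<dots> = ennreal (c * Gamma (a + 1))"
    proof -
      have "ennreal (c * Gamma (a + 1)) = ennreal c * ennreal (Gamma (a + 1))"
        using a that by (simp add: ennreal_mult)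
      then show ?thesis unfolding Ga[symmetric] by (simp only: nn_integral_cmult) (rule nn_integral_cmult, simp)
    qed
    finally show ?thesis .
  qed
  have fm: "f n \<in> borel_measurable lborel" for n unfolding f_def by measurable
  have Fm: "F \<in> borel_measurable lborel" unfolding F_def by measurable
  have Wm: "W \<in> borel_measurable lborel" unfolding W_def by measurable
  have f0: "0 \<le> f n u" for n u by (simp add: f_def lattice_count_def)
  have F0: "0 \<le> F u" for u by (simp add: F_def w_def)
  have W0: "0 \<le> W u" for u using K by (simp add: W_def)
  have fint: "integral\<^sup>L lborel (f n) = S n powr a * site_sum TYPE('d) \<delta> (S n)" for n
  proof -
    have "(\<integral>\<^sup>+u. ennreal (f n u) \<partial>lborel) = (\<integral>\<^sup>+u. ennreal (S n powr a) * (ennreal (exp (- u) * ?N ((u / S n) powr (1 / \<delta>))) * indicator {0..} u) \<partial>lborel)"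
      by (intro nn_integral_cong) (auto simp: f_def ennreal_mult lattice_count_def split: split_indicator)
    also have "\<dots> = ennreal (S n powr a * site_sum TYPE('d) \<delta> (S n))"
    proof -
      have "(\<integral>\<^sup>+u. ennreal (exp (- u) * ?N ((u / S n) powr (1 / \<delta>))) * indicator {0..} u \<partial>lborel) = ennreal (site_sum TYPE('d) \<delta> (S n))"
        unfolding site_sum_layer_cake[OF \<delta> S(1), symmetric] by (rule nn_integral_site_sum[OF \<delta> S(1)])
      then show ?thesis
        using site_sum_nonneg[OF \<delta> S(1)[of n], where 'd = 'd]
        by (subst nn_integral_cmult) (simp_all add: ennreal_mult)
    qed
    finally have "(\<integral>\<^sup>+u. ennreal (f n u) \<partial>lborel) = ennreal (S n powr a * site_sum TYPE('d) \<delta> (S n))" .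
    then show ?thesis
      unfolding integral_eq_nn_integral[OF fm AE_I2[OF f0]]
      using site_sum_nonneg[OF \<delta> S(1)[of n], where 'd = 'd] by simp
  qed
  have w0: "w \<ge> 0" by (simp add: w_def)
  have Fint: "integral\<^sup>L lborel F = volume_const TYPE('d) \<delta>"
    unfolding integral_eq_nn_integral[OF Fm AE_I2[OF F0]]
    unfolding F_def nnG[OF w0] using w0 a by (simp add: volume_const_def w_def a_def)
  have "(\<lambda>n. integral\<^sup>L lborel (f n)) \<longlonglongrightarrow> integral\<^sup>L lborel F"
  proof (rule integral_dominated_convergence[where w = W])
    show "F \<in> borel_measurable lborel" "f n \<in> borel_measurable lborel" for n
      by (rule Fm, rule fm)
    show "integrable lborel W"
    proof (rule integrableI_nonneg[OF Wm AE_I2[OF W0]])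
      show "(\<integral>\<^sup>+u. ennreal (W u) \<partial>lborel) < \<infinity>"
        unfolding W_def nnG[OF less_imp_le[OF K(1)]] by simp
    qed
    have b: "f n u \<le> W u" for n u
    proof (cases "u \<ge> 0")
      case True
      have "?N ((u / S n) powr (1 / \<delta>)) \<le> K * ((u / S n) powr (1 / \<delta>)) powr real CARD('d)" by (intro K) auto
      also have "\<dots> = K * (S n powr (- a) * u powr a)"
        using S True by (simp add: powr_powr a_def powr_divide powr_minus_divide)
      finally have "(S n powr a * exp (- u)) * ?N ((u / S n) powr (1 / \<delta>)) \<le> (S n powr a * exp (- u)) * (K * (S n powr (- a) * u powr a))"
        by (intro mult_left_mono) auto
      also have "\<dots> = K * (u powr a * exp (- u)) * (S n powr a * S n powr (- a))" by (simp only: mult_ac)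
      also have "S n powr a * S n powr (- a) = 1" using S(1)[of n] by (simp add: powr_add[symmetric])
      finally show ?thesis using True by (simp add: f_def W_def mult_ac)
    qed (simp add: f_def W_def)
    show "AE u in lborel. norm (f n u) \<le> W u" for n
      using b[of n] f0[of n] by simp
    show "AE u in lborel. (\<lambda>n. f n u) \<longlonglongrightarrow> F u"
    proof (intro AE_I2)
      fix u :: real
      show "(\<lambda>n. f n u) \<longlonglongrightarrow> F u"
      proof (cases "u > 0")
        case True
        have "filterlim (\<lambda>n. (u / S n) powr (1 / \<delta>)) at_top sequentially"
        proof (rule filterlim_compose[of "\<lambda>x. x powr (1 / \<delta>)" at_top at_top])
          show "filterlim (\<lambda>x. x powr (1 / \<delta>)) at_top at_top" using \<delta> by real_asymp
          have "filterlim S (at_right 0) sequentially"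
            by (rule tendsto_imp_filterlim_at_right[OF S(2)]) (simp add: S(1))
          then have "filterlim (\<lambda>n. inverse (S n)) at_top sequentially"
            by (rule filterlim_compose[OF filterlim_inverse_at_top_right])
          then show "filterlim (\<lambda>n. u / S n) at_top sequentially"
            unfolding divide_inverse by (rule filterlim_tendsto_pos_mult_at_top[OF tendsto_const True])
        qed
        then have "(\<lambda>n. ?N ((u / S n) powr (1 / \<delta>)) / ((u / S n) powr (1 / \<delta>)) ^ CARD('d)) \<longlonglongrightarrow> w"
          unfolding w_def by (rule filterlim_compose[OF lattice_count_asymp])
        then have "(\<lambda>n. u powr a * exp (- u) * (?N ((u / S n) powr (1 / \<delta>)) / ((u / S n) powr (1 / \<delta>)) ^ CARD('d))) \<longlonglongrightarrow> u powr a * exp (- u) * w"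
          by (intro tendsto_intros)
        moreover have "u powr a * exp (- u) * (?N ((u / S n) powr (1 / \<delta>)) / ((u / S n) powr (1 / \<delta>)) ^ CARD('d)) = f n u" for n
        proof -
          have "((u / S n) powr (1 / \<delta>)) ^ CARD('d) = u powr a / S n powr a"
            using True S(1)[of n] by (simp add: powr_power power_divide a_def powr_divide)
          then show ?thesis using True by (simp add: f_def field_simps)
        qed
        moreover have "u powr a * exp (- u) * w = F u" using True by (simp add: F_def)
        ultimately show ?thesis by simp
      next
        case False
        have "f n u = 0 \<and> F u = 0" for n
        proof (cases "u = 0")
          case True
          have "?N 0 \<le> K * 0 powr real CARD('d)" by (rule K) simp
          then have "?N 0 = 0" by (simp add: lattice_count_def)
          then show ?thesis using a True by (simp add: f_def F_def)
        qed (use False in \<open>simp add: f_def F_def\<close>)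
        then show ?thesis by simp
      qed
    qed
  qed
  then show "(\<lambda>n. S n powr a * site_sum TYPE('d) \<delta> (S n)) \<longlonglongrightarrow> volume_const TYPE('d) \<delta>"
    by (simp add: fint Fint)
qed simp

section \<open>Riemann sums for the jump intensity\<close>

lemma integrable_min_powr:
  assumes "1 < s" "s < 2"
  shows "integrable lborel (\<lambda>y::real. indicator {0<..} y * min (y powr (1 - s)) (y powr (- s)))"
proof (rule integrableI_nonneg)
  have 1: "(\<integral>\<^sup>+y. ennreal (if y \<in> {0..1} then y powr (1 - s) else 0) \<partial>lborel) < \<infinity>"
  proof -
    have "((\<lambda>y. y powr (1 - s)) has_integral (1 powr (1 - s + 1) / (1 - s + 1))) {0..1}"
      using assms by (intro has_integral_powr_from_0) auto
    then have "((\<lambda>y. if y \<in> {0..1} then y powr (1 - s) else 0) has_integral (1 powr (1 - s + 1) / (1 - s + 1))) UNIV"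
      by (subst has_integral_restrict_UNIV)
    then show ?thesis by (subst nn_integral_has_integral_lborel) auto
  qed
  have 2: "(\<integral>\<^sup>+y. ennreal (if y \<in> {1..} then y powr (- s) else 0) \<partial>lborel) < \<infinity>"
  proof -
    have "((\<lambda>y. y powr (- s)) has_integral (- (1 powr (- s + 1)) / (- s + 1))) {1..}"
      using assms by (intro has_integral_powr_to_inf) auto
    then have "((\<lambda>y. if y \<in> {1..} then y powr (- s) else 0) has_integral (- (1 powr (- s + 1)) / (- s + 1))) UNIV"
      by (subst has_integral_restrict_UNIV)
    then show ?thesis by (subst nn_integral_has_integral_lborel) auto
  qed
  have "(\<integral>\<^sup>+y. ennreal (indicator {0<..} y * min (y powr (1 - s)) (y powr (- s))) \<partial>lborel)
     \<le> (\<integral>\<^sup>+y. ennreal (if y \<in> {0..1} then y powr (1 - s) else 0) + ennreal (if y \<in> {1..} then y powr (- s) else 0) \<partial>lborel)"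
    by (intro nn_integral_mono) (auto simp: indicator_def intro!: ennreal_leI add_increasing2 add_increasing simp flip: ennreal_plus)
  also have "\<dots> < \<infinity>" using 1 2 by (subst nn_integral_add) auto
  finally show "(\<integral>\<^sup>+y. ennreal (indicator {0<..} y * min (y powr (1 - s)) (y powr (- s))) \<partial>lborel) < \<infinity>" .
qed (auto simp: indicator_def)

text \<open>
Rounding up to the grid of mesh \<open>1 / N\<close> sends Lebesgue measure on the half-line to \<open>1 / N\<close> times
counting measure. This rewrites series as integrals, to which dominated convergence applies.
\<close>

lemma distr_ceiling:
  assumes N: "N > (0::real)"
  shows "distr (restrict_space lborel {0<..}) (count_space UNIV) (\<lambda>y. nat \<lceil>y * N\<rceil>)
     = density (count_space UNIV) (\<lambda>j. if j = 0 then 0 else ennreal (1 / N))"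
proof (rule measure_eqI_countable[where A = UNIV])
  fix j :: nat
  have m: "(\<lambda>y. nat \<lceil>y * N\<rceil>) \<in> measurable (restrict_space lborel {0<..}) (count_space UNIV)"
    by (rule measurable_restrict_space1) measurable
  have "(\<lambda>y. nat \<lceil>y * N\<rceil>) -` {j} \<inter> space (restrict_space lborel {0<..}) = (if j = 0 then {} else {(real j - 1) / N<..real j / N})"
  proof -
    have eq: "y > 0 \<and> nat \<lceil>y * N\<rceil> = j \<longleftrightarrow> j \<noteq> 0 \<and> (real j - 1) / N < y \<and> y \<le> real j / N" for y
    proof -
      have "y > 0 \<and> nat \<lceil>y * N\<rceil> = j \<longleftrightarrow> y * N > 0 \<and> \<lceil>y * N\<rceil> = int j"
      proof (cases "y > 0")
        case True
        then have "y * N > 0" using N by simp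
        moreover from this have "\<lceil>y * N\<rceil> > 0" by simp
        ultimately show ?thesis using True by auto
      qed (use N in \<open>simp add: zero_less_mult_iff\<close>)
      also have "\<dots> \<longleftrightarrow> y * N > 0 \<and> real j - 1 < y * N \<and> y * N \<le> real j"
        by (simp add: ceiling_eq_iff)
      also have "\<dots> \<longleftrightarrow> j \<noteq> 0 \<and> real j - 1 < y * N \<and> y * N \<le> real j"
        by (cases j) auto
      finally show ?thesis by (simp only: pos_divide_less_eq[OF N] pos_le_divide_eq[OF N])
    qed
    have "(\<lambda>y. nat \<lceil>y * N\<rceil>) -` {j} \<inter> space (restrict_space lborel {0<..}) = {y. y > 0 \<and> nat \<lceil>y * N\<rceil> = j}"
      unfolding space_restrict_space space_lborel space_borel vimage_def by blast
    also have "\<dots> = {y. j \<noteq> 0 \<and> (real j - 1) / N < y \<and> y \<le> real j / N}"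
      unfolding eq ..
    also have "\<dots> = (if j = 0 then {} else {(real j - 1) / N<..real j / N})"
      by (cases "j = 0") (simp_all add: greaterThanAtMost_def greaterThan_def atMost_def Int_def)
    finally show ?thesis .
  qed
  moreover have "emeasure lborel {(real j - 1) / N<..real j / N} = ennreal (1 / N)"
    using N by (subst emeasure_lborel_Ioc) (auto simp: divide_right_mono diff_divide_distrib)
  moreover have "{(real j - 1) / N<..real j / N} \<subseteq> {0<..}" if "j \<noteq> 0"
  proof -
    have "0 \<le> (real j - 1) / N" using that N by simp
    then show ?thesis by auto
  qed
  ultimately show "emeasure (distr (restrict_space lborel {0<..}) (count_space UNIV) (\<lambda>y. nat \<lceil>y * N\<rceil>)) {j}
     = emeasure (density (count_space UNIV) (\<lambda>j. if j = 0 then 0 else ennreal (1 / N))) {j}"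
    by (subst emeasure_distr[OF m]) (auto simp: emeasure_restrict_space emeasure_density nn_integral_count_space_indicator[symmetric])
qed auto

lemma series_as_integral:
  fixes F :: "nat \<Rightarrow> 'a::{banach, second_countable_topology}"
  assumes N: "N > 0" and F: "F 0 = 0"
    and int: "integrable lborel (\<lambda>y. indicator {0<..} y *\<^sub>R (N *\<^sub>R F (nat \<lceil>y * N\<rceil>)))"
  shows "summable (\<lambda>j. norm (F j))"
    and "(LINT y|lborel. indicator {0<..} y *\<^sub>R (N *\<^sub>R F (nat \<lceil>y * N\<rceil>))) = (\<Sum>j. F j)"
proof -
  let ?D = "density (count_space UNIV) (\<lambda>j::nat. ennreal (if j = 0 then 0 else 1 / N))"
  have m: "(\<lambda>y. nat \<lceil>y * N\<rceil>) \<in> measurable (restrict_space lborel {0<..}) (count_space UNIV)"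
    by (rule measurable_restrict_space1) measurable
  have D: "distr (restrict_space lborel {0<..}) (count_space UNIV) (\<lambda>y. nat \<lceil>y * N\<rceil>) = ?D"
    unfolding distr_ceiling[OF N] by (intro density_cong) auto
  have eqF: "(if j = 0 then 0 else 1 / N) *\<^sub>R (N *\<^sub>R F j) = F j" for j
    using N F by simp
  have "integrable (restrict_space lborel {0<..}) (\<lambda>y. N *\<^sub>R F (nat \<lceil>y * N\<rceil>))"
    using int by (subst integrable_restrict_space) auto
  then have "integrable ?D (\<lambda>j. N *\<^sub>R F j)"
    unfolding D[symmetric] by (subst integrable_distr_eq[OF m]) auto
  then have "integrable (count_space UNIV) (\<lambda>j. (if j = 0 then 0 else 1 / N) *\<^sub>R (N *\<^sub>R F j))"
    using N by (subst (asm) integrable_density) auto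
  then have i: "integrable (count_space UNIV) F" unfolding eqF .
  then show "summable (\<lambda>j. norm (F j))" by (simp add: integrable_count_space_nat_iff)
  have "(LINT y|lborel. indicator {0<..} y *\<^sub>R (N *\<^sub>R F (nat \<lceil>y * N\<rceil>))) = (LINT y|restrict_space lborel {0<..}. N *\<^sub>R F (nat \<lceil>y * N\<rceil>))"
    by (subst integral_restrict_space) auto
  also have "\<dots> = (LINT j|?D. N *\<^sub>R F j)"
    unfolding D[symmetric] by (subst integral_distr[OF m]) auto
  also have "\<dots> = (LINT j|count_space UNIV. (if j = 0 then 0 else 1 / N) *\<^sub>R (N *\<^sub>R F j))"
    using N by (intro integral_density) auto
  also have "\<dots> = (LINT j|count_space UNIV. F j)" unfolding eqF ..
  also have "\<dots> = (\<Sum>j. F j)" by (rule integral_count_space_nat[OF i])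
  finally show "(LINT y|lborel. indicator {0<..} y *\<^sub>R (N *\<^sub>R F (nat \<lceil>y * N\<rceil>))) = (\<Sum>j. F j)" .
qed

text \<open>
What the rest of the argument needs to know about the lattice: bounds and small-argument asymptotics
of \<open>\<Theta>\<close>, which is going to be \<open>site_sum\<close>. The dimension appears only through \<open>a = d / \<delta>\<close>.
\<close>

locale site_profile =
  fixes \<Theta> :: "real \<Rightarrow> real" and \<gamma> \<delta> a cvol :: real
  assumes \<delta>_pos: "\<delta> > 0" and \<gamma>_neg: "\<gamma> < 0"
    and a_gt: "1 < a" and a_less: "a < \<gamma> + 2"
    and \<Theta>_nonneg: "\<And>v. v > 0 \<Longrightarrow> 0 \<le> \<Theta> v"
    and \<Theta>_bound: "\<And>p. a \<le> p \<Longrightarrow> \<exists>K>0. \<forall>v>0. \<Theta> v \<le> K * v powr (- p)"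
    and \<Theta>_asymp: "((\<lambda>v. v powr a * \<Theta> v) \<longlongrightarrow> cvol) (at_right 0)"
    and \<Theta>_exp: "\<And>v. v > 0 \<Longrightarrow> exp (v / 2) * \<Theta> v \<le> \<Theta> (v / 2)"
    and cvol_pos: "cvol > 0"
begin

definition s where "s = a - \<gamma>"
definition \<alpha> where "\<alpha> = \<delta> * a / s"
text \<open>
The expected number of parts equal to \<open>j\<close> at all sites other than the origin, when the total size
is free.
\<close>

definition rate where "rate L j = real j powr (\<gamma> - 1) * \<Theta> (real j / L powr \<delta>)"

lemma exponent_facts: "-1 < \<gamma>" "1 < s" "s < 2" "0 < \<alpha>" "\<alpha> < \<delta>" "\<alpha> * s = \<delta> * a" "\<delta> < \<delta> * a"
proof -
  show "-1 < \<gamma>" using a_gt a_less by auto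
  show s: "1 < s" "s < 2" using a_gt a_less \<gamma>_neg by (auto simp: s_def)
  show "\<alpha> * s = \<delta> * a" using s by (simp add: \<alpha>_def)
  show "0 < \<alpha>" using s \<delta>_pos a_gt by (simp add: \<alpha>_def)
  have "\<delta> * a < \<delta> * s" using \<delta>_pos \<gamma>_neg by (intro mult_strict_left_mono) (auto simp: s_def)
  then show "\<alpha> < \<delta>" using s by (simp add: \<alpha>_def pos_divide_less_eq)
  show "\<delta> < \<delta> * a" using \<delta>_pos a_gt by simp
qed

lemma rate_nonneg: "L > 0 \<Longrightarrow> rate L j \<ge> 0"
proof (cases "j = 0")
  case False
  moreover assume "L > 0"
  ultimately show ?thesis
    unfolding rate_def by (intro mult_nonneg_nonneg \<Theta>_nonneg) auto
qed (simp add: rate_def)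

lemma rate_0 [simp]: "rate L 0 = 0" by (simp add: rate_def)

text \<open>
\<open>\<alpha>\<close> is the exponent for which the powers of \<open>L\<close> cancel here; this is \<open>\<alpha> s = \<delta> a\<close>.
\<close>

lemma rate_rescaled:
  assumes L: "L > 0" and j: "j > 0"
  defines "y \<equiv> real j / L powr \<alpha>"
  shows "L powr \<alpha> * rate L j = y powr (- s - 1) * ((real j / L powr \<delta>) powr a * \<Theta> (real j / L powr \<delta>))"
proof -
  have y: "real j = y * L powr \<alpha>" "y > 0" using L j by (auto simp: y_def)
  have v: "(real j / L powr \<delta>) powr a = y powr a * L powr ((\<alpha> - \<delta>) * a)"
    unfolding y(1) using L y(2) by (simp add: powr_mult powr_divide powr_powr powr_diff left_diff_distrib)
  have "L powr \<alpha> * real j powr (\<gamma> - 1) = L powr \<alpha> * (y powr (\<gamma> - 1) * L powr (\<alpha> * (\<gamma> - 1)))"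
    unfolding y(1) using L y(2) by (simp add: powr_mult powr_powr)
  also have "\<dots> = y powr (\<gamma> - 1) * L powr (\<alpha> + \<alpha> * (\<gamma> - 1))"
    by (simp add: powr_add)
  also have "\<alpha> + \<alpha> * (\<gamma> - 1) = (\<alpha> - \<delta>) * a"
    using exponent_facts(6) by (simp add: s_def algebra_simps)
  also have "y powr (\<gamma> - 1) = y powr (- s - 1) * y powr a"
    by (simp add: s_def flip: powr_add)
  finally have "L powr \<alpha> * real j powr (\<gamma> - 1) = y powr (- s - 1) * (real j / L powr \<delta>) powr a"
    unfolding v by (simp only: mult_ac)
  then show ?thesis unfolding rate_def by (simp only: mult.assoc[symmetric])
qed

text \<open>
Integral against the Levy measure of the limit.
\<close>

definition jump_integral :: "(real \<Rightarrow> complex) \<Rightarrow> complex" where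
  "jump_integral g = cvol *\<^sub>R (LINT y|lborel. indicator {0<..} y *\<^sub>R (y powr (- s - 1) *\<^sub>R g y))"

lemma weighted_bound:
  fixes g :: "real \<Rightarrow> complex"
  assumes G: "\<And>y. y > 0 \<Longrightarrow> norm (g y) \<le> G * y ^ 2" "\<And>y. y > 0 \<Longrightarrow> norm (g y) \<le> G * y" and z: "z > 0"
  shows "norm (g z) * z powr (- s - 1) \<le> G * min (z powr (1 - s)) (z powr (- s))"
proof -
  have "norm (g z) * z powr (- s - 1) \<le> (G * z ^ 2) * z powr (- s - 1)"
    by (intro mult_right_mono G z) auto
  also have "\<dots> = G * z powr (1 - s)"
  proof -
    have "z ^ 2 * z powr (- s - 1) = z powr (2 + (- s - 1))"
      unfolding powr_add using z by simp
    then show ?thesis by (simp add: mult.assoc)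
  qed
  finally have 1: "norm (g z) * z powr (- s - 1) \<le> G * z powr (1 - s)" .
  have "norm (g z) * z powr (- s - 1) \<le> (G * z) * z powr (- s - 1)"
    by (intro mult_right_mono G z) auto
  also have "\<dots> = G * z powr (- s)"
  proof -
    have "z * z powr (- s - 1) = z powr (1 + (- s - 1))"
      unfolding powr_add using z by simp
    then show ?thesis by (simp add: mult.assoc)
  qed
  finally show ?thesis using 1 by (simp add: min_def)
qed

lemma jump_integrable:
  assumes [measurable]: "g \<in> borel_measurable borel"
    and G: "\<And>y. y > 0 \<Longrightarrow> norm (g y) \<le> G * y ^ 2" "\<And>y. y > 0 \<Longrightarrow> norm (g y) \<le> G * y"
  shows "integrable lborel (\<lambda>y. indicator {0<..} y *\<^sub>R (y powr (- s - 1) *\<^sub>R (g y :: complex)))"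
proof (rule Bochner_Integration.integrable_bound)
  show "integrable lborel (\<lambda>y. G * (indicator {0<..} y * min (y powr (1 - s)) (y powr (- s))))"
    using integrable_min_powr[OF exponent_facts(2,3)] by (rule integrable_mult_right)
  show "AE y in lborel. norm (indicator {0<..} y *\<^sub>R (y powr (- s - 1) *\<^sub>R g y)) \<le> norm (G * (indicator {0<..} y * min (y powr (1 - s)) (y powr (- s))))"
  proof (intro AE_I2)
    fix y :: real
    show "norm (indicator {0<..} y *\<^sub>R (y powr (- s - 1) *\<^sub>R g y)) \<le> norm (G * (indicator {0<..} y * min (y powr (1 - s)) (y powr (- s))))"
      using weighted_bound[of g G y] G by (auto split: split_indicator simp: mult.commute intro: order_trans[OF _ abs_ge_self])
  qed
qed measurable

text \<open>
Read the series as the integral of a step function with mesh \<open>1 / L powr \<alpha>\<close>. The step function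
evaluates a decreasing majorant at the right end of each cell, so the majorant at \<open>y\<close> itself
dominates. Pointwise, the argument of \<open>\<Theta>\<close> is of order \<open>L powr (\<alpha> - \<delta>)\<close> and tends to \<open>0\<close>.
\<close>

lemma rate_series_limit:
  fixes L :: "nat \<Rightarrow> real" and g :: "real \<Rightarrow> complex"
  assumes L: "\<And>k. L k > 0" "filterlim L at_top sequentially"
    and g: "continuous_on UNIV g"
    and G: "\<And>y. y > 0 \<Longrightarrow> norm (g y) \<le> G * y ^ 2" "\<And>y. y > 0 \<Longrightarrow> norm (g y) \<le> G * y"
  shows "summable (\<lambda>j. norm (rate (L k) j *\<^sub>R g (real j / L k powr \<alpha>)))"
    and "(\<lambda>k. \<Sum>j. rate (L k) j *\<^sub>R g (real j / L k powr \<alpha>)) \<longlonglongrightarrow> jump_integral g"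
proof -
  have G0: "G \<ge> 0" using order_trans[OF norm_ge_zero G(2)[of 1]] by simp
  have gm [measurable]: "g \<in> borel_measurable borel" using g by (rule borel_measurable_continuous_onI)
  obtain K where K: "K > 0" "\<And>v. v > 0 \<Longrightarrow> \<Theta> v \<le> K * v powr (- a)"
    using \<Theta>_bound[OF order_refl] by blast
  define N where "N = (\<lambda>k. L k powr \<alpha>)"
  have N: "N k > 0" for k using L(1)[of k] by (simp add: N_def)
  define W where "W = (\<lambda>y::real. K * G * (indicator {0<..} y * min (y powr (1 - s)) (y powr (- s))))"
  have iW: "integrable lborel W"
    unfolding W_def by (rule integrable_mult_right) (rule integrable_min_powr[OF exponent_facts(2,3)])
  define F where "F = (\<lambda>k j. rate (L k) j *\<^sub>R g (real j / N k))"
  define h where "h = (\<lambda>k y. indicator {0<..} y *\<^sub>R (N k *\<^sub>R F k (nat \<lceil>y * N k\<rceil>)))"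
  have hm: "h k \<in> borel_measurable lborel" for k
    unfolding h_def by measurable
  define yy where "yy = (\<lambda>k y. real (nat \<lceil>y * N k\<rceil>) / N k)"
  have yy: "y \<le> yy k y" "yy k y \<le> y + 1 / N k" "nat \<lceil>y * N k\<rceil> > 0" if "y > 0" for k y
  proof -
    have p: "y * N k > 0" using that N[of k] by simp
    then show "nat \<lceil>y * N k\<rceil> > 0" by simp
    have r: "real (nat \<lceil>y * N k\<rceil>) = real_of_int \<lceil>y * N k\<rceil>" using p by simp
    have "y * N k \<le> real_of_int \<lceil>y * N k\<rceil>" "real_of_int \<lceil>y * N k\<rceil> \<le> y * N k + 1" by linarith+
    then show "y \<le> yy k y" "yy k y \<le> y + 1 / N k"
      unfolding yy_def r using N[of k] by (simp_all add: field_simps)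
  qed
  define T where "T = (\<lambda>k y. (yy k y * N k / L k powr \<delta>) powr a * \<Theta> (yy k y * N k / L k powr \<delta>))"
  have h_eq: "h k y = (yy k y powr (- s - 1) * T k y) *\<^sub>R g (yy k y)" if y: "y > 0" for k y
  proof -
    have j: "real (nat \<lceil>y * N k\<rceil>) = yy k y * N k" using N[of k] by (simp add: yy_def)
    have Nk: "L k powr \<alpha> = N k" by (simp add: N_def)
    show ?thesis
      using rate_rescaled[OF L(1) yy(3)[OF y], of k k, unfolded Nk j] y
      unfolding h_def F_def T_def yy_def[symmetric] j
      using N[of k] by simp
  qed
  have bound: "norm (h k y) \<le> W y" for k y
  proof (cases "y > 0")
    case True
    define z where "z = yy k y"
    have z: "z \<ge> y" "z > 0" using yy(1)[OF True, of k] True by (auto simp: z_def)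
    define v where "v = z * N k / L k powr \<delta>"
    have v: "v > 0" using z N[of k] L(1)[of k] by (simp add: v_def)
    have "T k y \<le> v powr a * (K * v powr (- a))"
      unfolding T_def z_def[symmetric] v_def[symmetric] by (intro mult_left_mono K v) auto
    also have "\<dots> = K * (v powr a * v powr (- a))" by (simp only: mult_ac)
    also have "v powr a * v powr (- a) = 1" using v by (simp add: powr_add[symmetric])
    finally have T: "T k y \<le> K" by simp
    have T0: "T k y \<ge> 0"
      unfolding T_def z_def[symmetric] v_def[symmetric] by (intro mult_nonneg_nonneg \<Theta>_nonneg v) auto
    have "norm (h k y) = z powr (- s - 1) * T k y * norm (g z)"
      using T0 by (simp add: h_eq[OF True] z_def)
    also have "\<dots> \<le> z powr (- s - 1) * K * norm (g z)"
      by (intro mult_right_mono mult_left_mono T) auto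
    also have "\<dots> \<le> K * G * min (z powr (1 - s)) (z powr (- s))"
    proof -
      have "norm (g z) * z powr (- s - 1) \<le> G * min (z powr (1 - s)) (z powr (- s))"
        by (intro weighted_bound G z)
      then have "K * (norm (g z) * z powr (- s - 1)) \<le> K * (G * min (z powr (1 - s)) (z powr (- s)))"
        using K by (intro mult_left_mono) auto
      then show ?thesis by (simp only: mult_ac)
    qed
    also have "\<dots> \<le> K * G * min (y powr (1 - s)) (y powr (- s))"
      using K G0 z True exponent_facts by (intro mult_left_mono min.mono powr_mono2') auto
    finally show ?thesis using True by (simp add: W_def)
  qed (simp add: h_def W_def)
  have ih: "integrable lborel (h k)" for k
    by (intro Bochner_Integration.integrable_bound[OF iW hm] AE_I2)
       (rule order_trans[OF bound], simp)
  have F0: "F k 0 = 0" for k by (simp add: F_def)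
  note ser = series_as_integral[OF N F0 ih[unfolded h_def]]
  show "summable (\<lambda>j. norm (rate (L k) j *\<^sub>R g (real j / L k powr \<alpha>)))"
    using ser(1)[of k] by (simp add: F_def N_def)
  define lim where "lim = (\<lambda>y. cvol *\<^sub>R (indicator {0<..} y *\<^sub>R (y powr (- s - 1) *\<^sub>R g y)))"
  have Nlim: "filterlim N at_top sequentially"
    unfolding N_def by (rule filterlim_compose[OF _ L(2)]) (use exponent_facts in real_asymp)
  have "(\<lambda>k. integral\<^sup>L lborel (h k)) \<longlonglongrightarrow> integral\<^sup>L lborel lim"
  proof (rule integral_dominated_convergence[OF _ hm iW])
    show "lim \<in> borel_measurable lborel" unfolding lim_def by measurable
    show "AE y in lborel. norm (h k y) \<le> W y" for k using bound by simp
    show "AE y in lborel. (\<lambda>k. h k y) \<longlonglongrightarrow> lim y"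
    proof (intro AE_I2)
      fix y :: real
      show "(\<lambda>k. h k y) \<longlonglongrightarrow> lim y"
      proof (cases "y > 0")
        case True
        have "(\<lambda>k. 1 / N k) \<longlonglongrightarrow> 0"
          by (intro tendsto_divide_0[OF tendsto_const] filterlim_at_top_imp_at_infinity Nlim)
        then have up: "(\<lambda>k. y + 1 / N k) \<longlonglongrightarrow> y" using tendsto_add[OF tendsto_const] by fastforce
        have ylim: "(\<lambda>k. yy k y) \<longlonglongrightarrow> y"
          by (rule tendsto_sandwich[OF _ _ tendsto_const up]) (use yy[OF True] in auto)
        have "(\<lambda>k. L k powr (\<alpha> - \<delta>)) \<longlonglongrightarrow> 0"
          by (rule tendsto_neg_powr[OF _ L(2)]) (use exponent_facts in auto)
        then have "(\<lambda>k. yy k y * L k powr (\<alpha> - \<delta>)) \<longlonglongrightarrow> y * 0" by (intro tendsto_mult ylim)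
        then have v0: "(\<lambda>k. yy k y * N k / L k powr \<delta>) \<longlonglongrightarrow> 0"
          by (simp add: N_def powr_diff)
        have "filterlim (\<lambda>k. yy k y * N k / L k powr \<delta>) (at_right 0) sequentially"
        proof (rule tendsto_imp_filterlim_at_right[OF v0])
          have "yy k y * N k / L k powr \<delta> > 0" for k
            using yy(1)[OF True, of k] True N[of k] L(1)[of k] by simp
          then show "eventually (\<lambda>k. yy k y * N k / L k powr \<delta> > 0) sequentially" by simp
        qed
        then have Tlim: "(\<lambda>k. T k y) \<longlonglongrightarrow> cvol"
          unfolding T_def by (rule filterlim_compose[OF \<Theta>_asymp])
        have glim: "(\<lambda>k. g (yy k y)) \<longlonglongrightarrow> g y"
          using g ylim by (intro isCont_tendsto_compose[of y g]) (auto simp: continuous_on_eq_continuous_at)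
        have "(\<lambda>k. (yy k y powr (- s - 1) * T k y) *\<^sub>R g (yy k y)) \<longlonglongrightarrow> (y powr (- s - 1) * cvol) *\<^sub>R g y"
          using True by (intro tendsto_intros ylim Tlim glim) auto
        then show ?thesis using True by (simp add: h_eq lim_def mult.commute)
      qed (simp add: h_def lim_def)
    qed
  qed
  moreover have "integral\<^sup>L lborel lim = jump_integral g"
    unfolding lim_def jump_integral_def by (rule integral_scaleR_right)
  moreover have "integral\<^sup>L lborel (h k) = (\<Sum>j. rate (L k) j *\<^sub>R g (real j / L k powr \<alpha>))" for k
    unfolding h_def ser(2) by (simp add: F_def N_def)
  ultimately show "(\<lambda>k. \<Sum>j. rate (L k) j *\<^sub>R g (real j / L k powr \<alpha>)) \<longlonglongrightarrow> jump_integral g"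
    by simp
qed

end

section \<open>Mass and Laplace transform away from the origin\<close>

text \<open>
The quadratic bound controls small jumps and the linear bound large ones; both follow from the mean
value inequality, since \<open>exp (- x)\<close> is bounded by one on the right half-plane.
\<close>

lemma exp_remainder_bounds:
  fixes w :: complex
  assumes "Re w \<ge> 0"
  shows "norm (exp (- w) - 1 + w) \<le> norm w ^ 2" and "norm (exp (- w) - 1 + w) \<le> 2 * norm w"
proof -
  have a: "norm (exp (- x) - 1) \<le> norm x" if "Re x \<ge> 0" for x :: complex
  proof -
    have "norm (exp (- x) - exp (- 0)) \<le> 1 * norm (x - 0)"
    proof (rule field_differentiable_bound[where S = "{x. Re x \<ge> 0}"])
      show "((\<lambda>x. exp (- x)) has_field_derivative - exp (- z)) (at z within {x. Re x \<ge> 0})" for z :: complex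
        by (auto intro!: derivative_eq_intros)
    qed (use that in \<open>auto simp: convex_halfspace_Re_ge\<close>)
    then show ?thesis by simp
  qed
  have "norm ((exp (- w) - 1 + w) - (exp (- 0) - 1 + 0)) \<le> norm w * norm (w - 0)"
  proof (rule field_differentiable_bound[where S = "{x. Re x \<ge> 0} \<inter> cball 0 (norm w)"])
    show "((\<lambda>x. exp (- x) - 1 + x) has_field_derivative - exp (- z) + 1) (at z within ({x. Re x \<ge> 0} \<inter> cball 0 (norm w)))" for z :: complex
      by (auto intro!: derivative_eq_intros)
    fix z :: complex assume z: "z \<in> {x. Re x \<ge> 0} \<inter> cball 0 (norm w)"
    have "norm (- exp (- z) + 1) = norm (exp (- z) - 1)" by (metis add.commute minus_diff_eq norm_minus_cancel uminus_add_conv_diff)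
    also have "\<dots> \<le> norm w" using a[of z] z by auto
    finally show "norm (- exp (- z) + 1) \<le> norm w" .
  qed (use assms in \<open>auto intro!: convex_Int simp: convex_halfspace_Re_ge\<close>)
  then show "norm (exp (- w) - 1 + w) \<le> norm w ^ 2" by (simp add: power2_eq_square)
  show "norm (exp (- w) - 1 + w) \<le> 2 * norm w"
    using norm_triangle_ineq[of "exp (- w) - 1" w] a[OF assms] by simp
qed

lemma integral_pmf_nat:
  fixes f :: "nat \<Rightarrow> 'a::{banach,second_countable_topology}"
  assumes "summable (\<lambda>h. norm (pmf p h *\<^sub>R f h))"
  shows "integrable (measure_pmf p) f" "integral\<^sup>L (measure_pmf p) f = (\<Sum>h. pmf p h *\<^sub>R f h)"
proof -
  have i: "integrable (count_space UNIV) (\<lambda>h. pmf p h *\<^sub>R f h)"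
    using assms by (simp add: integrable_count_space_nat_iff)
  then show "integrable (measure_pmf p) f"
    unfolding measure_pmf_eq_density by (subst integrable_density) auto
  show "integral\<^sup>L (measure_pmf p) f = (\<Sum>h. pmf p h *\<^sub>R f h)"
    unfolding measure_pmf_eq_density using i by (subst integral_density) (auto simp: integral_count_space_nat)
qed

context site_profile
begin

text \<open>
The Laplace exponent of the limit law, for \<open>Re z \<ge> 0\<close>.
\<close>

definition \<Psi> :: "complex \<Rightarrow> complex" where
  "\<Psi> z = jump_integral (\<lambda>y. exp (- (z * y)) - 1 + z * y)"

lemma kernel_bounds:
  assumes "Re z \<ge> 0" "y > 0"
  defines "G \<equiv> max (norm z ^ 2) (2 * norm z)"
  shows "norm (exp (- (z * of_real y)) - 1 + z * of_real y) \<le> G * y ^ 2"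
    "norm (exp (- (z * of_real y)) - 1 + z * of_real y) \<le> G * y"
proof -
  have r: "Re (z * of_real y) \<ge> 0" using assms by simp
  have n: "norm (z * of_real y) = norm z * y" using assms by (simp add: norm_mult)
  show "norm (exp (- (z * of_real y)) - 1 + z * of_real y) \<le> G * y ^ 2"
    by (rule order_trans[OF exp_remainder_bounds(1)[OF r]])
       (unfold n power_mult_distrib G_def, intro mult_right_mono, auto)
  have "2 * (norm z * y) \<le> G * y"
    using assms(2) by (simp add: G_def mult.assoc[symmetric] del: mult.assoc)
  then show "norm (exp (- (z * of_real y)) - 1 + z * of_real y) \<le> G * y"
    using exp_remainder_bounds(2)[OF r] unfolding n by linarith
qed

lemma laplace_exponent_limit:
  fixes L :: "nat \<Rightarrow> real"
  assumes L: "\<And>k. L k > 0" "filterlim L at_top sequentially" and z: "Re z \<ge> 0"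
  shows "(\<lambda>k. \<Sum>j. rate (L k) j *\<^sub>R (exp (- (z * of_real (real j / L k powr \<alpha>))) - 1 + z * of_real (real j / L k powr \<alpha>))) \<longlonglongrightarrow> \<Psi> z"
  unfolding \<Psi>_def
  by (rule rate_series_limit(2)[OF L _ kernel_bounds[OF z]]) (auto intro!: continuous_intros)

text \<open>
The decay \<open>\<Theta> v = O(v powr (- 2))\<close> is available because \<open>2 > \<gamma> + 2 > a\<close>. It makes the bound
summable in \<open>j\<close>, and \<open>L\<close> enters with exactly the power that cancels in \<open>site_pmf_exp_bound\<close>.
\<close>

lemma rate_bound:
  obtains K where "K > 0" "\<And>L j. L > 0 \<Longrightarrow> exp (real j / (2 * L powr \<delta>)) * rate L j * real j ^ 2 \<le> K * L powr (2 * \<delta>) * real j powr (\<gamma> - 1)"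
proof -
  obtain K where K: "K > 0" "\<And>v. v > 0 \<Longrightarrow> \<Theta> v \<le> K * v powr (- 2)"
    using \<Theta>_bound[of 2] a_less \<gamma>_neg by auto
  have "exp (real j / (2 * L powr \<delta>)) * rate L j * real j ^ 2 \<le> (4 * K) * L powr (2 * \<delta>) * real j powr (\<gamma> - 1)" if L: "L > 0" for L j
  proof (cases "j = 0")
    case False
    define v where "v = real j / L powr \<delta>"
    have v: "v > 0" using False L by (simp add: v_def)
    have "exp (v / 2) * \<Theta> v \<le> \<Theta> (v / 2)" by (rule \<Theta>_exp[OF v])
    also have "\<dots> \<le> K * (v / 2) powr (- 2)" using v by (intro K) auto
    also have "\<dots> = 4 * K * L powr (2 * \<delta>) / real j ^ 2"
    proof -
      have "L powr (2 * \<delta>) = (L powr \<delta>) ^ 2" using L by (simp add: powr_power)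
      moreover have "(v / 2) powr (- 2) = 1 / (v / 2) ^ 2"
        using v by (simp add: powr_minus_divide)
      ultimately show ?thesis using L False by (simp add: v_def field_simps)
    qed
    finally have "real j powr (\<gamma> - 1) * real j ^ 2 * (exp (v / 2) * \<Theta> v) \<le> real j powr (\<gamma> - 1) * real j ^ 2 * (4 * K * L powr (2 * \<delta>) / real j ^ 2)"
      by (intro mult_left_mono) auto
    then show ?thesis using False by (simp add: rate_def v_def mult_ac)
  qed simp
  with K(1) that[of "4 * K"] show ?thesis by simp
qed

lemma summable_rate:
  assumes L: "L > 0"
  shows "summable (\<lambda>j. exp (real j / (2 * L powr \<delta>)) * rate L j * real j ^ 2)"
proof -
  obtain K where K: "K > 0" "\<And>j. exp (real j / (2 * L powr \<delta>)) * rate L j * real j ^ 2 \<le> K * L powr (2 * \<delta>) * real j powr (\<gamma> - 1)"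
    using rate_bound L by metis
  have "summable (\<lambda>j. K * L powr (2 * \<delta>) * real j powr (\<gamma> - 1))"
    using \<gamma>_neg by (intro summable_mult) (simp add: summable_real_powr_iff)
  then show ?thesis
    by (rule summable_comparison_test'[where N = 0]) (use K(2) rate_nonneg[OF L] in auto)
qed

lemma
  assumes L: "L > 0"
  shows summable_rate_exp: "summable (\<lambda>j. exp (real j / (2 * L powr \<delta>)) * rate L j)"
    and summable_rate_1: "summable (\<lambda>j. real j * rate L j)"
    and summable_rate_0: "summable (rate L)"
proof -
  have sq: "1 \<le> real j ^ 2" if "j \<noteq> 0" for j using that by (simp add: one_le_power)
  have e: "1 \<le> exp (real j / (2 * L powr \<delta>))" for j using L by simp
  show "summable (\<lambda>j. exp (real j / (2 * L powr \<delta>)) * rate L j)"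
  proof (rule summable_comparison_test'[OF summable_rate[OF L], of 0])
    fix j show "norm (exp (real j / (2 * L powr \<delta>)) * rate L j) \<le> exp (real j / (2 * L powr \<delta>)) * rate L j * real j ^ 2"
      using mult_left_mono[OF sq[of j], of "exp (real j / (2 * L powr \<delta>)) * rate L j"] rate_nonneg[OF L, of j]
      by (cases "j = 0") auto
  qed
  show s1: "summable (\<lambda>j. real j * rate L j)"
  proof (rule summable_comparison_test'[OF summable_rate[OF L], of 0])
    fix j
    have "real j \<le> real j ^ 2" by (simp add: power2_eq_square flip: of_nat_mult)
    then have "1 * (rate L j * real j) \<le> exp (real j / (2 * L powr \<delta>)) * (rate L j * real j ^ 2)"
      using e[of j] rate_nonneg[OF L, of j] by (intro mult_mono) auto
    then show "norm (real j * rate L j) \<le> exp (real j / (2 * L powr \<delta>)) * rate L j * real j ^ 2"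
      using rate_nonneg[OF L, of j] by (simp add: mult_ac)
  qed
  show "summable (rate L)"
  proof (rule summable_comparison_test'[OF s1, of 0])
    fix j show "norm (rate L j) \<le> real j * rate L j"
      using mult_right_mono[of 1 "real j" "rate L j"] rate_nonneg[OF L, of j] by (cases "j = 0") auto
  qed
qed


definition jumps where "jumps L = exp_coeff (\<lambda>j. real j * rate L j)"
definition mean where "mean L = (\<Sum>j. real j * rate L j)"
text \<open>
The law of the total occupation of the sites other than the origin when the total size is free.
\<close>

definition site_pmf where "site_pmf L = embed_pmf (\<lambda>h. jumps L h * exp (- (\<Sum>j. rate L j)))"

lemma jumps_nonneg: "L > 0 \<Longrightarrow> jumps L h \<ge> 0"
  unfolding jumps_def by (intro exp_coeff_nonneg mult_nonneg_nonneg rate_nonneg) auto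

lemma jumps_sums:
  fixes w :: "'b::{real_normed_field,banach}"
  assumes "summable (\<lambda>j. norm (of_real (rate L j) * w ^ j))"
  shows "summable (\<lambda>h. norm (of_real (jumps L h) * w ^ h))"
    "(\<lambda>h. of_real (jumps L h) * w ^ h) sums exp (\<Sum>j. of_real (rate L j) * w ^ j)"
proof -
  have eq: "real j * rate L j / real j = rate L j" for j by (cases "j = 0") auto
  show "summable (\<lambda>h. norm (of_real (jumps L h) * w ^ h))"
    "(\<lambda>h. of_real (jumps L h) * w ^ h) sums exp (\<Sum>j. of_real (rate L j) * w ^ j)"
    using exp_coeff_sums[of "\<lambda>j. real j * rate L j" w] assms unfolding eq jumps_def by auto
qed

lemma pmf_site_pmf:
  assumes L: "L > 0"
  shows "pmf (site_pmf L) h = jumps L h * exp (- (\<Sum>j. rate L j))"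
  unfolding site_pmf_def
proof (rule pmf_embed_pmf)
  show nn: "0 \<le> jumps L h * exp (- (\<Sum>j. rate L j))" for h by (simp add: jumps_nonneg[OF L])
  have "(\<lambda>h. jumps L h) sums exp (\<Sum>j. rate L j)"
    using jumps_sums(2)[of L "1::real"] summable_rate_0[OF L] rate_nonneg[OF L] by simp
  then have "(\<lambda>h. jumps L h * exp (- (\<Sum>j. rate L j))) sums (exp (\<Sum>j. rate L j) * exp (- (\<Sum>j. rate L j)))"
    by (rule sums_mult2)
  then have s1: "(\<lambda>h. jumps L h * exp (- (\<Sum>j. rate L j))) sums 1" by (simp add: exp_minus)
  show "(\<integral>\<^sup>+h. ennreal (jumps L h * exp (- (\<Sum>j. rate L j))) \<partial>count_space UNIV) = 1"
    unfolding nn_integral_count_space_nat suminf_ennreal_eq[OF nn s1] by simp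
qed

text \<open>
The compound Poisson formula for centred exponential moments. It holds for every \<open>z\<close> for which the
exponent converges, in particular for some real \<open>z > 0\<close>.
\<close>

lemma site_pmf_exp:
  fixes z :: "'b::{real_normed_field,banach,second_countable_topology}"
  assumes L: "L > 0" and S: "summable (\<lambda>j. norm (of_real (rate L j) * exp (of_nat j * z)))"
  shows "integrable (measure_pmf (site_pmf L)) (\<lambda>h. exp (z * (of_nat h - of_real (mean L))))"
    and "integral\<^sup>L (measure_pmf (site_pmf L)) (\<lambda>h. exp (z * (of_nat h - of_real (mean L))))
      = exp (\<Sum>j. of_real (rate L j) * (exp (of_nat j * z) - 1 - of_nat j * z))"
proof -
  have ew: "exp (of_nat j * z) = exp z ^ j" for j by (rule exp_of_nat_mult)
  note J = jumps_sums[of L "exp z", folded ew, OF S]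
  define A where "A = (\<Sum>j. rate L j)"
  define cc where "cc = exp (- of_real A - z * of_real (mean L))"
  have eq: "pmf (site_pmf L) h *\<^sub>R exp (z * (of_nat h - of_real (mean L))) = (of_real (jumps L h) * exp (of_nat h * z)) * cc" for h
    unfolding pmf_site_pmf[OF L] A_def[symmetric] cc_def
    by (simp add: scaleR_conv_of_real exp_diff exp_minus field_simps flip: exp_of_real)
  have s1: "summable (\<lambda>h. norm (pmf (site_pmf L) h *\<^sub>R exp (z * (of_nat h - of_real (mean L)))))"
    unfolding eq norm_mult[of _ cc] using J(1) by (rule summable_mult2)
  show "integrable (measure_pmf (site_pmf L)) (\<lambda>h. exp (z * (of_nat h - of_real (mean L))))"
    by (rule integral_pmf_nat(1)[OF s1])
  have "integral\<^sup>L (measure_pmf (site_pmf L)) (\<lambda>h. exp (z * (of_nat h - of_real (mean L))))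
     = (\<Sum>h. of_real (jumps L h) * exp (of_nat h * z) * cc)"
    unfolding integral_pmf_nat(2)[OF s1] eq ..
  also have "\<dots> = exp (\<Sum>j. of_real (rate L j) * exp (of_nat j * z)) * cc"
    using sums_mult2[OF J(2), of cc] by (simp add: sums_iff)
  also have "\<dots> = exp (\<Sum>j. of_real (rate L j) * (exp (of_nat j * z) - 1 - of_nat j * z))"
  proof -
    have 1: "(\<lambda>j. of_real (rate L j) * exp (of_nat j * z)) sums (\<Sum>j. of_real (rate L j) * exp (of_nat j * z))"
      using S by (intro summable_sums) (rule summable_norm_cancel)
    have 2: "(\<lambda>j. of_real (rate L j)) sums (of_real A :: 'b)"
      unfolding A_def by (intro sums_of_real summable_sums summable_rate_0 L)
    have 3: "(\<lambda>j. z * of_real (real j * rate L j)) sums (z * of_real (mean L))"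
      unfolding mean_def by (intro sums_mult sums_of_real summable_sums summable_rate_1 L)
    have "(\<lambda>j. of_real (rate L j) * exp (of_nat j * z) - of_real (rate L j) - z * of_real (real j * rate L j))
       sums ((\<Sum>j. of_real (rate L j) * exp (of_nat j * z)) - of_real A - z * of_real (mean L))"
      by (intro sums_diff 1 2 3)
    then have X: "(\<Sum>j. of_real (rate L j) * (exp (of_nat j * z) - 1 - of_nat j * z)) = (\<Sum>j. of_real (rate L j) * exp (of_nat j * z)) - of_real A - z * of_real (mean L)"
      by (simp add: sums_iff algebra_simps)
    show ?thesis unfolding X cc_def exp_add[symmetric] by (rule arg_cong[of _ _ exp]) simp
  qed
  finally show "integral\<^sup>L (measure_pmf (site_pmf L)) (\<lambda>h. exp (z * (of_nat h - of_real (mean L))))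
      = exp (\<Sum>j. of_real (rate L j) * (exp (of_nat j * z) - 1 - of_nat j * z))" .
qed

text \<open>
The recursion of the coefficients exhibits \<open>h * jumps L h\<close> as a Cauchy product.
\<close>

lemma site_pmf_mean:
  assumes L: "L > 0"
  shows "integrable (measure_pmf (site_pmf L)) real" "integral\<^sup>L (measure_pmf (site_pmf L)) real = mean L"
proof -
  define A where "A = (\<Sum>j. rate L j)"
  have r: "real h * jumps L h = (\<Sum>j\<le>h. (real j * rate L j) * jumps L (h - j))" for h
    unfolding jumps_def exp_coeff_rec
    by (intro sum.mono_neutral_left) auto
  have J: "summable (jumps L)" "jumps L sums exp A"
    using jumps_sums[of L "1::real"] summable_rate_0[OF L] rate_nonneg[OF L] jumps_nonneg[OF L]
    by (auto simp: A_def)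
  have c: "(\<lambda>h. \<Sum>j\<le>h. (real j * rate L j) * jumps L (h - j)) sums (mean L * (\<Sum>h. jumps L h))"
    unfolding mean_def using summable_rate_1[OF L] J rate_nonneg[OF L] jumps_nonneg[OF L]
    by (intro Cauchy_product_sums) auto
  then have "(\<lambda>h. real h * jumps L h) sums (mean L * exp A)"
    unfolding r using J(2) by (simp add: sums_iff)
  then have "(\<lambda>h. real h * jumps L h * exp (- A)) sums (mean L * exp A * exp (- A))"
    by (rule sums_mult2)
  moreover have "mean L * exp A * exp (- A) = mean L" by (simp add: exp_minus)
  ultimately have s: "(\<lambda>h. pmf (site_pmf L) h *\<^sub>R real h) sums mean L"
    unfolding pmf_site_pmf[OF L] A_def[symmetric] real_scaleR_def by (simp only: mult_ac)
  have n: "norm (pmf (site_pmf L) h *\<^sub>R real h) = pmf (site_pmf L) h *\<^sub>R real h" for h by simp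
  have s1: "summable (\<lambda>h. norm (pmf (site_pmf L) h *\<^sub>R real h))"
    unfolding n using s by (rule sums_summable)
  show "integrable (measure_pmf (site_pmf L)) real" "integral\<^sup>L (measure_pmf (site_pmf L)) real = mean L"
    using integral_pmf_nat[OF s1] s by (auto simp: sums_iff)
qed

text \<open>
The sign is that of the occupation of the origin, which gains what the other sites lose.
\<close>

definition fluct where "fluct L h = - (real h - mean L) / L powr \<alpha>"

definition site_law where "site_law L = distr (measure_pmf (site_pmf L)) borel (fluct L)"

lemma real_distribution_site_law: "real_distribution (site_law L)"
  unfolding site_law_def by (intro prob_space.real_distribution_distr) (auto intro: prob_space_measure_pmf)

lemma integral_site_law:
  fixes f :: "real \<Rightarrow> 'b::{banach,second_countable_topology}"
  assumes "f \<in> borel_measurable borel"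
  shows "integral\<^sup>L (site_law L) f = integral\<^sup>L (measure_pmf (site_pmf L)) (\<lambda>h. f (fluct L h))"
    "integrable (site_law L) f \<longleftrightarrow> integrable (measure_pmf (site_pmf L)) (\<lambda>h. f (fluct L h))"
  unfolding site_law_def using assms by (auto intro!: integral_distr integrable_distr_eq)

lemma site_law_exp:
  fixes z :: complex
  assumes L: "L > 0" and z: "Re z \<ge> 0"
  defines "S \<equiv> (\<Sum>j. rate L j *\<^sub>R (exp (- (z * of_real (real j / L powr \<alpha>))) - 1 + z * of_real (real j / L powr \<alpha>)))"
  shows "integrable (site_law L) (\<lambda>x. exp (z * of_real x))"
    and "integral\<^sup>L (site_law L) (\<lambda>x. exp (z * of_real x)) = exp S"
proof -
  define N where "N = L powr \<alpha>"
  define z' where "z' = - z / of_real N"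
  have N: "N > 0" using L by (simp add: N_def)
  have e: "z * of_real (fluct L h) = z' * (of_nat h - of_real (mean L))" for h
    using N unfolding fluct_def z'_def N_def[symmetric] by (simp add: field_simps)
  have e2: "of_nat j * z' = - (z * of_real (real j / N))" for j
    by (simp add: z'_def)
  have sm: "summable (\<lambda>j. norm (of_real (rate L j) * exp (of_nat j * z')))"
  proof (rule summable_comparison_test'[OF summable_rate_0[OF L], of 0])
    fix j
    have "norm (exp (of_nat j * z')) \<le> 1"
      unfolding e2 norm_exp_eq_Re using z N by simp
    then show "norm (norm (of_real (rate L j) * exp (of_nat j * z'))) \<le> rate L j"
      using rate_nonneg[OF L, of j] by (simp add: norm_mult mult_left_le)
  qed
  note P = site_pmf_exp[OF L sm, folded e]
  have m: "(\<lambda>x. exp (z * of_real x)) \<in> borel_measurable borel" by measurable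
  show "integrable (site_law L) (\<lambda>x. exp (z * of_real x))"
    unfolding integral_site_law(2)[OF m] by (rule P(1))
  show "integral\<^sup>L (site_law L) (\<lambda>x. exp (z * of_real x)) = exp S"
    unfolding integral_site_law(1)[OF m] P(2) S_def N_def[symmetric] e2
    by (simp add: scaleR_conv_of_real)
qed

lemma site_law_exp_limit:
  assumes L: "\<And>k. L k > 0" "filterlim L at_top sequentially" and z: "Re z \<ge> 0"
  shows "(\<lambda>k. integral\<^sup>L (site_law (L k)) (\<lambda>x. exp (z * of_real x))) \<longlonglongrightarrow> exp (\<Psi> z)"
  unfolding site_law_exp(2)[OF L(1) z] by (intro tendsto_exp laplace_exponent_limit L z)

text \<open>
The exponent is at most \<open>t\<^sup>2\<close> times the sum of \<open>j\<^sup>2 * exp (t j) * rate L j\<close>, and with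
\<open>t = 1 / (2 L powr \<delta>)\<close> the bound \<open>rate_bound\<close> leaves a constant. This gives Chernoff bounds at
scale \<open>L powr \<delta>\<close>, which is larger than \<open>L powr \<alpha>\<close> but smaller than the volume.
\<close>

lemma site_pmf_exp_bound:
  obtains C where "\<And>L. L > 0 \<Longrightarrow> integrable (measure_pmf (site_pmf L)) (\<lambda>h. exp ((1 / (2 * L powr \<delta>)) * (real h - mean L)))"
    "\<And>L. L > 0 \<Longrightarrow> integral\<^sup>L (measure_pmf (site_pmf L)) (\<lambda>h. exp ((1 / (2 * L powr \<delta>)) * (real h - mean L))) \<le> C"
proof -
  obtain K where K: "K > 0" "\<And>L j. L > 0 \<Longrightarrow> exp (real j / (2 * L powr \<delta>)) * rate L j * real j ^ 2 \<le> K * L powr (2 * \<delta>) * real j powr (\<gamma> - 1)"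
    using rate_bound by blast
  have sp: "summable (\<lambda>j. K * real j powr (\<gamma> - 1))"
    using \<gamma>_neg by (intro summable_mult) (simp add: summable_real_powr_iff)
  define C where "C = exp (\<Sum>j. K * real j powr (\<gamma> - 1))"
  have "integrable (measure_pmf (site_pmf L)) (\<lambda>h. exp ((1 / (2 * L powr \<delta>)) * (real h - mean L))) \<and>
    integral\<^sup>L (measure_pmf (site_pmf L)) (\<lambda>h. exp ((1 / (2 * L powr \<delta>)) * (real h - mean L))) \<le> C" if L: "L > 0" for L
  proof -
    define t where "t = 1 / (2 * L powr \<delta>)"
    have t: "t > 0" using L by (simp add: t_def)
    have jt: "real j * t = real j / (2 * L powr \<delta>)" for j by (simp add: t_def)
    have sm: "summable (\<lambda>j. norm (of_real (rate L j) * exp (of_nat j * t)))"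
    proof -
      have "norm (of_real (rate L j) * exp (of_nat j * t)) = exp (real j / (2 * L powr \<delta>)) * rate L j" for j
        unfolding jt[symmetric] using rate_nonneg[OF L, of j] by (simp add: norm_mult mult.commute)
      then show ?thesis using summable_rate_exp[OF L] by (simp only:)
    qed
    note P = site_pmf_exp[OF L sm]
    have b: "rate L j * (exp (real j * t) - 1 - real j * t) \<le> K * real j powr (\<gamma> - 1)" for j
    proof -
      define x where "x = real j * t"
      have x: "x \<ge> 0" using t by (simp add: x_def)
      have "exp x - 1 - x \<le> x ^ 2 * exp x"
      proof -
        have "exp x - exp 0 - x \<le> x * (x * exp x)"
        proof (cases "x = 0")
          case False
          then obtain u where u: "0 < u" "u < x" "exp x - exp 0 = (x - 0) * exp u"
            using MVT2[of 0 x exp exp] x by (auto intro: DERIV_exp)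
          then obtain v where v: "0 < v" "v < u" "exp u - exp 0 = (u - 0) * exp v"
            using MVT2[of 0 u exp exp] by (auto intro: DERIV_exp)
          have "exp x - exp 0 - x = x * (u * exp v)" using u v by (simp add: algebra_simps)
          also have "\<dots> \<le> x * (x * exp x)" using u v x by (intro mult_left_mono mult_mono) auto
          finally show ?thesis .
        qed simp
        then show ?thesis by (simp add: power2_eq_square mult_ac)
      qed
      then have "rate L j * (exp x - 1 - x) \<le> rate L j * (x ^ 2 * exp x)"
        by (intro mult_left_mono rate_nonneg L)
      also have "\<dots> = t ^ 2 * (exp (real j / (2 * L powr \<delta>)) * rate L j * real j ^ 2)"
        by (simp add: x_def jt[symmetric] power_mult_distrib mult_ac)
      also have "\<dots> \<le> t ^ 2 * (K * L powr (2 * \<delta>) * real j powr (\<gamma> - 1))"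
        by (intro mult_left_mono K L) auto
      also have "\<dots> = (t ^ 2 * L powr (2 * \<delta>)) * (K * real j powr (\<gamma> - 1))" by (simp only: mult_ac)
      also have "t ^ 2 * L powr (2 * \<delta>) = 1 / 4"
      proof -
        have "L powr (2 * \<delta>) = (L powr \<delta>) ^ 2" using L by (simp add: powr_power)
        then show ?thesis using L by (simp add: t_def power2_eq_square)
      qed
      also have "1 / 4 * (K * real j powr (\<gamma> - 1)) \<le> 1 * (K * real j powr (\<gamma> - 1))"
        using K by (intro mult_right_mono) auto
      finally show ?thesis by (simp add: x_def)
    qed
    have pos: "0 \<le> rate L j * (exp (real j * t) - 1 - real j * t)" for j
      using exp_ge_add_one_self[of "real j * t"] by (intro mult_nonneg_nonneg rate_nonneg L) linarith
    have sb: "summable (\<lambda>j. rate L j * (exp (real j * t) - 1 - real j * t))"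
      by (rule summable_comparison_test'[OF sp, of 0]) (use b pos in auto)
    have "(\<Sum>j. rate L j * (exp (real j * t) - 1 - real j * t)) \<le> (\<Sum>j. K * real j powr (\<gamma> - 1))"
      by (rule suminf_le[OF b sb sp])
    then show ?thesis using P by (simp add: C_def t_def[symmetric])
  qed
  with that show ?thesis by blast
qed

end

section \<open>The stable limit\<close>

lemma char_distr_scale:
  assumes "real_distribution \<mu>"
  shows "char (distr \<mu> borel (\<lambda>x. c * x)) t = char \<mu> (c * t)"
proof -
  interpret real_distribution \<mu> by fact
  show ?thesis unfolding char_def by (subst integral_distr) (auto simp: mult_ac)
qed

lemma real_distribution_scale:
  assumes "real_distribution \<mu>"
  shows "real_distribution (distr \<mu> borel (\<lambda>x. c * x))"
proof -
  interpret real_distribution \<mu> by fact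
  show ?thesis by (rule real_distribution_distr) simp
qed

lemma
  assumes "real_distribution M" "real_distribution N"
  shows char_convolution: "char (M \<star> N) t = char M t * char N t"
    and real_distribution_convolution: "real_distribution (M \<star> N)"
proof -
  interpret M: real_distribution M by fact
  interpret N: real_distribution N by fact
  interpret P: pair_prob_space M N ..
  have m: "(\<lambda>(x, y). x + y) \<in> measurable (M \<Otimes>\<^sub>M N) (borel :: real measure)" by measurable
  have "integrable (M \<Otimes>\<^sub>M N) (\<lambda>(x, y). iexp (t * x) * iexp (t * y))"
    by (rule P.integrable_const_bound[where B = 1]) (auto simp: norm_mult)
  then have "(CLINT x|M. CLINT y|N. iexp (t * x) * iexp (t * y)) = (CLINT p|M \<Otimes>\<^sub>M N. (case p of (x, y) \<Rightarrow> iexp (t * x) * iexp (t * y)))"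
    by (rule P.integral_fst)
  moreover have "char (M \<star> N) t = (CLINT p|M \<Otimes>\<^sub>M N. (case p of (x, y) \<Rightarrow> iexp (t * x) * iexp (t * y)))"
    unfolding char_def convolution_def using m
    by (subst integral_distr) (auto intro!: Bochner_Integration.integral_cong simp: distrib_left exp_add)
  ultimately show "char (M \<star> N) t = char M t * char N t"
    by (simp add: char_def)
  show "real_distribution (M \<star> N)"
    unfolding convolution_def using m by (rule P.real_distribution_distr)
qed

context site_profile
begin

text \<open>
Substitute \<open>y \<mapsto> c y\<close> in the integral. This homogeneity is what makes the limit law stable.
\<close>

lemma \<Psi>_scale:
  assumes c: "c > 0"
  shows "\<Psi> (of_real c * z) = c powr s *\<^sub>R \<Psi> z"
proof -
  define f where "f = (\<lambda>y. indicator {0<..} y *\<^sub>R (y powr (- s - 1) *\<^sub>R (exp (- (z * of_real y)) - 1 + z * of_real y)))"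
  define I where "I = (LINT y|lborel. indicator {0<..} y *\<^sub>R (y powr (- s - 1) *\<^sub>R (exp (- (of_real c * z * of_real y)) - 1 + of_real c * z * of_real y)))"
  have "(LINT y|lborel. f y) = \<bar>c\<bar> *\<^sub>R (LINT y|lborel. f (0 + c * y))"
    using c by (intro lborel_integral_real_affine) auto
  also have "(LINT y|lborel. f (0 + c * y)) = c powr (- s - 1) *\<^sub>R I"
    unfolding I_def integral_scaleR_right[symmetric]
    using c by (intro Bochner_Integration.integral_cong)
      (auto simp: f_def indicator_def powr_mult zero_less_mult_iff mult_ac)
  finally have "c powr s *\<^sub>R (LINT y|lborel. f y) = (c powr s * (c * c powr (- s - 1))) *\<^sub>R I"
    using c by simp
  also have "c powr s * (c * c powr (- s - 1)) = 1"
  proof -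
    have "c * c powr (- s - 1) = c powr (- s)" using c by (simp add: powr_diff)
    then show ?thesis using c by (simp add: powr_add[symmetric])
  qed
  finally have "c powr s *\<^sub>R (LINT y|lborel. f y) = I" by simp
  moreover have "\<Psi> (of_real c * z) = cvol *\<^sub>R I"
    unfolding \<Psi>_def jump_integral_def I_def ..
  moreover have "\<Psi> z = cvol *\<^sub>R (LINT y|lborel. f y)"
    unfolding \<Psi>_def jump_integral_def f_def ..
  ultimately show ?thesis by (simp only: scaleR_scaleR mult.commute flip: \<open>c powr s *\<^sub>R (LINT y|lborel. f y) = I\<close>)
qed

lemma \<Psi>_0: "\<Psi> 0 = 0"
  by (simp add: \<Psi>_def jump_integral_def)

text \<open>
The value of \<open>\<Psi>\<close> at \<open>1\<close>, as a real number.
\<close>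

definition stable_const :: real where
  "stable_const = cvol * (LINT y|lborel. indicator {0<..} y * (y powr (- s - 1) * (exp (- y) - 1 + y)))"

lemma \<Psi>_of_real:
  assumes t: "t \<ge> 0"
  shows "\<Psi> (of_real t) = of_real (stable_const * t powr s)"
proof (cases "t = 0")
  case False
  have "\<Psi> 1 = of_real stable_const"
  proof -
    have "(LINT y|lborel. indicator {0<..} y *\<^sub>R (y powr (- s - 1) *\<^sub>R (exp (- (1 * of_real y)) - 1 + 1 * of_real y)))
       = complex_of_real (LINT y|lborel. indicator {0<..} y * (y powr (- s - 1) * (exp (- y) - 1 + y)))"
      unfolding integral_complex_of_real[symmetric]
      by (intro Bochner_Integration.integral_cong) (auto simp: scaleR_conv_of_real exp_of_real[symmetric])
    then show ?thesis unfolding \<Psi>_def jump_integral_def stable_const_def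
      by (simp only: scaleR_conv_of_real of_real_mult)
  qed
  then show ?thesis using \<Psi>_scale[of t 1] t False by (simp add: scaleR_conv_of_real mult.commute)
qed (simp add: \<Psi>_0 exponent_facts)

lemma site_law_real_exp:
  assumes L: "L > 0" and t: "t \<ge> 0"
  shows "integrable (site_law L) (\<lambda>x. exp (t * x))"
    and "of_real (integral\<^sup>L (site_law L) (\<lambda>x. exp (t * x))) = integral\<^sup>L (site_law L) (\<lambda>x. exp (complex_of_real t * of_real x))"
proof -
  have e: "exp (complex_of_real t * of_real x) = of_real (exp (t * x))" for x by (simp add: exp_of_real[symmetric])
  have "integrable (site_law L) (\<lambda>x. complex_of_real (exp (t * x)))"
    using site_law_exp(1)[OF L, of "of_real t"] t unfolding e by simp
  then show "integrable (site_law L) (\<lambda>x. exp (t * x))" by (simp only: complex_of_real_integrable_eq)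
  show "of_real (integral\<^sup>L (site_law L) (\<lambda>x. exp (t * x))) = integral\<^sup>L (site_law L) (\<lambda>x. exp (complex_of_real t * of_real x))"
    unfolding e by simp
qed

lemma site_law_real_exp_limit:
  assumes L: "\<And>k. L k > 0" "filterlim L at_top sequentially" and t: "t \<ge> 0"
  shows "(\<lambda>k. integral\<^sup>L (site_law (L k)) (\<lambda>x. exp (t * x))) \<longlonglongrightarrow> exp (stable_const * t powr s)"
proof -
  have "(\<lambda>k. complex_of_real (integral\<^sup>L (site_law (L k)) (\<lambda>x. exp (t * x)))) \<longlonglongrightarrow> of_real (exp (stable_const * t powr s))"
    using site_law_exp_limit[OF L, of "of_real t"] t
    unfolding site_law_real_exp(2)[OF L(1) t] \<Psi>_of_real[OF t] exp_of_real by simp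
  then show ?thesis by (simp only: tendsto_of_real_iff)
qed

text \<open>
The law is centred, so \<open>\<bar>x\<bar> \<le> 2 exp x - x\<close> bounds its first absolute moment by twice the exponential
moment, which converges.
\<close>

lemma site_law_tight:
  assumes L: "\<And>k. L k > 0" "filterlim L at_top sequentially"
  shows "tight (\<lambda>k. site_law (L k))"
  unfolding tight_def
proof (intro conjI allI impI)
  show "real_distribution (site_law (L k))" for k by (rule real_distribution_site_law)
  fix \<epsilon> :: real assume \<epsilon>: "\<epsilon> > 0"
  have "convergent (\<lambda>k. integral\<^sup>L (site_law (L k)) (\<lambda>x. exp (1 * x)))"
    by (rule convergentI, rule site_law_real_exp_limit[OF L]) simp
  then have "Bseq (\<lambda>k. integral\<^sup>L (site_law (L k)) (\<lambda>x. exp (1 * x)))" by (rule convergent_imp_Bseq)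
  then obtain B where B: "\<And>k. norm (integral\<^sup>L (site_law (L k)) (\<lambda>x. exp (1 * x))) \<le> B"
    by (elim BseqE) blast
  \<comment> \<open>chosen so that \<open>2 * B < c * \<epsilon>\<close>, as Markov's inequality at level \<open>c\<close> asks for\<close>
  define c where "c = (2 * B + 1) / \<epsilon> + 1"
  have B0: "B \<ge> 0" using order_trans[OF norm_ge_zero B[of 0]] .
  have c: "c > 0" unfolding c_def using B0 \<epsilon> by (intro add_nonneg_pos divide_nonneg_pos) auto
  have "measure (site_law (L k)) {- c<..c} > 1 - \<epsilon>" for k
  proof -
    interpret real_distribution "site_law (L k)" by (rule real_distribution_site_law)
    have id: "(\<lambda>x::real. x) \<in> borel_measurable borel" by simp
    have fl: "fluct (L k) h = (mean (L k) - real h) / L k powr \<alpha>" for h by (simp add: fluct_def)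
    have ix: "integrable (site_law (L k)) (\<lambda>x. x)"
      unfolding integral_site_law(2)[OF id] fl using site_pmf_mean(1)[OF L(1)[of k]] by (intro integrable_divide) auto
    have x0: "integral\<^sup>L (site_law (L k)) (\<lambda>x. x) = 0"
      unfolding integral_site_law(1)[OF id] fl using site_pmf_mean[OF L(1)[of k]]
      by (simp add: measure_pmf.prob_space)
    have ie: "integrable (site_law (L k)) (\<lambda>x. exp x)" using site_law_real_exp(1)[OF L(1), of 1] by simp
    have "c * measure (site_law (L k)) {x \<in> space (site_law (L k)). c \<le> \<bar>x\<bar>} \<le> integral\<^sup>L (site_law (L k)) (\<lambda>x. \<bar>x\<bar>)"
      using integral_Markov_inequality_measure[of "site_law (L k)" "\<lambda>x. \<bar>x\<bar>" UNIV c] ix c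
      by (simp add: field_simps)
    also have "\<dots> \<le> integral\<^sup>L (site_law (L k)) (\<lambda>x. 2 * exp x - x)"
    proof (intro integral_mono)
      fix x :: real
      show "\<bar>x\<bar> \<le> 2 * exp x - x" using exp_ge_add_one_self[of x] exp_gt_zero[of x] by linarith
    qed (use ix ie in auto)
    also have "\<dots> = 2 * integral\<^sup>L (site_law (L k)) (\<lambda>x. exp x)"
      using ix ie x0 by simp
    also have "\<dots> \<le> 2 * B" using B[of k] by simp
    finally have "c * measure (site_law (L k)) {x \<in> space (site_law (L k)). c \<le> \<bar>x\<bar>} \<le> 2 * B" .
    moreover have "c * \<epsilon> = 2 * B + 1 + \<epsilon>"
    proof -
      have "(2 * B + 1) / \<epsilon> * \<epsilon> = 2 * B + 1" using \<epsilon> by simp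
      then show ?thesis unfolding c_def distrib_right[of "(2 * B + 1) / \<epsilon>" 1 \<epsilon>] by linarith
    qed
    ultimately have "c * measure (site_law (L k)) {x \<in> space (site_law (L k)). c \<le> \<bar>x\<bar>} < c * \<epsilon>" using \<epsilon> by linarith
    then have le: "measure (site_law (L k)) {x \<in> space (site_law (L k)). c \<le> \<bar>x\<bar>} < \<epsilon>" using c by simp
    have "1 = measure (site_law (L k)) ({- c<..c} \<union> (- {- c<..c}))" using prob_space by simp
    also have "\<dots> \<le> measure (site_law (L k)) {- c<..c} + measure (site_law (L k)) (- {- c<..c})"
      by (rule measure_Un_le) auto
    also have "measure (site_law (L k)) (- {- c<..c}) \<le> measure (site_law (L k)) {x \<in> space (site_law (L k)). c \<le> \<bar>x\<bar>}"
      by (rule finite_measure_mono) auto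
    finally show ?thesis using le by linarith
  qed
  then show "\<exists>a b. a < b \<and> (\<forall>k. 1 - \<epsilon> < measure (site_law (L k)) {a<..b})"
    using c by (intro exI[of _ "- c"] exI[of _ c]) auto
qed

text \<open>
Tightness gives a limit along a subsequence; its characteristic function is known, and this promotes
the convergence to every sequence of scales.
\<close>

lemma limit_law_exists:
  obtains \<mu> where "real_distribution \<mu>" "\<And>t. char \<mu> t = exp (\<Psi> (\<i> * of_real t))"
    "\<And>L. (\<And>k. L k > 0) \<Longrightarrow> filterlim L at_top sequentially \<Longrightarrow> weak_conv_m (\<lambda>k. site_law (L k)) \<mu>"
proof -
  define L0 where "L0 = (\<lambda>k. real (Suc k))"
  have L0: "\<And>k. L0 k > 0" "filterlim L0 at_top sequentially"
    unfolding L0_def by (simp, rule filterlim_compose[OF filterlim_real_sequentially filterlim_Suc])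
  have lim: "(\<lambda>k. char (site_law (L k)) t) \<longlonglongrightarrow> exp (\<Psi> (\<i> * of_real t))"
    if "\<And>k. L k > 0" "filterlim L at_top sequentially" for L t
    using site_law_exp_limit[OF that, of "\<i> * of_real t"] by (simp add: char_def mult.assoc)
  obtain r \<mu> where r: "strict_mono r" "real_distribution \<mu>" "weak_conv_m ((\<lambda>k. site_law (L0 k)) \<circ> id \<circ> r) \<mu>"
    using tight_imp_convergent_subsubsequence[OF site_law_tight[OF L0], of id] by (auto simp: strict_mono_def)
  have ch: "char \<mu> t = exp (\<Psi> (\<i> * of_real t))" for t
  proof (rule LIMSEQ_unique)
    show "(\<lambda>k. char (site_law (L0 (r k))) t) \<longlonglongrightarrow> char \<mu> t"
      using r(3) by (intro levy_continuity1 r(2) real_distribution_site_law) (simp add: comp_def)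
    show "(\<lambda>k. char (site_law (L0 (r k))) t) \<longlonglongrightarrow> exp (\<Psi> (\<i> * of_real t))"
      using LIMSEQ_subseq_LIMSEQ[OF lim[OF L0] r(1), of t] by (simp add: comp_def)
  qed
  show ?thesis
  proof
    show "real_distribution \<mu>" by fact
    show "char \<mu> t = exp (\<Psi> (\<i> * of_real t))" for t by (rule ch)
    show "weak_conv_m (\<lambda>k. site_law (L k)) \<mu>" if "\<And>k. L k > 0" "filterlim L at_top sequentially" for L
      by (rule levy_continuity[OF real_distribution_site_law r(2)]) (use lim[OF that] ch in simp)
  qed
qed

text \<open>
By \<open>\<Psi>_scale\<close> the sum of independent multiples by \<open>x\<close> and \<open>y\<close> has the characteristic function
of the multiple by \<open>c\<close> with \<open>c powr s = x powr s + y powr s\<close>.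
\<close>

lemma stable_limit_law:
  assumes \<mu>: "real_distribution \<mu>" "\<And>t. char \<mu> t = exp (\<Psi> (\<i> * of_real t))"
  shows "stable_distribution \<mu>"
  unfolding stable_distribution_def
proof (intro conjI allI impI \<mu>(1))
  fix x y :: real assume x: "x > 0" and y: "y > 0"
  define c where "c = (x powr s + y powr s) powr (1 / s)"
  have pos: "x powr s + y powr s > 0" using x y by (intro add_pos_pos) auto
  have c: "c > 0" using pos by (simp add: c_def)
  have cs: "c powr s = x powr s + y powr s"
    using pos exponent_facts by (simp add: c_def powr_powr)
  have ch: "char \<mu> (u * t) = exp (u powr s *\<^sub>R \<Psi> (\<i> * of_real t))" if "u > 0" for u t
    using \<Psi>_scale[OF that, of "\<i> * of_real t"] by (simp add: \<mu>(2) mult_ac)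
  have "distr \<mu> borel (\<lambda>z. x * z) \<star> distr \<mu> borel (\<lambda>z. y * z) = distr \<mu> borel (\<lambda>z. c * z)"
  proof (rule Levy_uniqueness)
    show "char (distr \<mu> borel (\<lambda>z. x * z) \<star> distr \<mu> borel (\<lambda>z. y * z)) = char (distr \<mu> borel (\<lambda>z. c * z))"
    proof
      fix t
      show "char (distr \<mu> borel (\<lambda>z. x * z) \<star> distr \<mu> borel (\<lambda>z. y * z)) t = char (distr \<mu> borel (\<lambda>z. c * z)) t"
        by (simp add: char_convolution real_distribution_scale \<mu>(1) char_distr_scale ch x y c cs scaleR_left_distrib exp_add)
    qed
  qed (intro real_distribution_convolution real_distribution_scale \<mu>)+
  then show "\<exists>c>0. \<exists>s. distr \<mu> borel (\<lambda>z. x * z) \<star> distr \<mu> borel (\<lambda>z. y * z) = distr \<mu> borel (\<lambda>z. c * z + s)"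
    using c by (intro exI[of _ c] conjI exI[of _ 0]) auto
qed

end

text \<open>
Truncate \<open>exp (t x)\<close> at a level \<open>M\<close>. The error is at most \<open>exp (2 t x) / M\<close>, whose mean is
bounded uniformly along the sequence, so the moments converge as well.
\<close>

lemma weak_conv_exp_moment:
  fixes lim :: "real \<Rightarrow> real"
  assumes \<mu>k: "\<And>k. real_distribution (\<mu>k k)" and \<mu>: "real_distribution \<mu>" and w: "weak_conv_m \<mu>k \<mu>"
    and int: "\<And>k u. u \<ge> 0 \<Longrightarrow> integrable (\<mu>k k) (\<lambda>x. exp (u * x))"
    and conv_lim: "\<And>u. u \<ge> 0 \<Longrightarrow> (\<lambda>k. integral\<^sup>L (\<mu>k k) (\<lambda>x. exp (u * x))) \<longlonglongrightarrow> lim u"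
    and t: "t \<ge> 0"
  shows "integrable \<mu> (\<lambda>x. exp (t * x))" "integral\<^sup>L \<mu> (\<lambda>x. exp (t * x)) = lim t"
proof -
  interpret k: real_distribution "\<mu>k k" for k by (rule \<mu>k)
  interpret real_distribution \<mu> by (rule \<mu>)
  define f where "f = (\<lambda>(M::real) x. min (exp (t * x)) M)"
  have fb: "norm (f M x) \<le> M" if "M > 0" for M x using that by (simp add: f_def min_def)
  have fm [measurable]: "f M \<in> borel_measurable borel" for M unfolding f_def by measurable
  have fi: "integrable \<mu> (f M)" if "M > 0" for M
    by (rule integrable_const_bound[where B = M]) (use fb[OF that] in auto)
  have fik: "integrable (\<mu>k k) (f M)" if "M > 0" for M k
    by (rule k.integrable_const_bound[where B = M]) (use fb[OF that] in auto)
  have flim: "(\<lambda>k. integral\<^sup>L (\<mu>k k) (f M)) \<longlonglongrightarrow> integral\<^sup>L \<mu> (f M)" if "M > 0" for M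
    by (rule weak_conv_imp_integral_bdd_continuous_conv[OF \<mu>k \<mu> w, where B = M])
       (use fb[OF that] in \<open>auto simp: f_def intro!: continuous_intros\<close>)
  have up: "integral\<^sup>L \<mu> (f M) \<le> lim t" if M: "M > 0" for M
  proof (rule LIMSEQ_le[OF flim[OF M] conv_lim[OF t]], intro exI allI impI)
    show "integral\<^sup>L (\<mu>k k) (f M) \<le> integral\<^sup>L (\<mu>k k) (\<lambda>x. exp (t * x))" for k
      by (intro integral_mono fik M int t) (simp add: f_def)
  qed
  have lo: "lim t - lim (2 * t) / M \<le> integral\<^sup>L \<mu> (f M)" if M: "M > 0" for M
  proof (rule LIMSEQ_le[OF _ flim[OF M]])
    show "(\<lambda>k. integral\<^sup>L (\<mu>k k) (\<lambda>x. exp (t * x)) - integral\<^sup>L (\<mu>k k) (\<lambda>x. exp (2 * t * x)) / M) \<longlonglongrightarrow> lim t - lim (2 * t) / M"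
      using t M by (intro tendsto_intros conv_lim) auto
    have "integral\<^sup>L (\<mu>k k) (\<lambda>x. exp (t * x)) - integral\<^sup>L (\<mu>k k) (\<lambda>x. exp (2 * t * x)) / M \<le> integral\<^sup>L (\<mu>k k) (f M)" for k
    proof -
    have i2: "integrable (\<mu>k k) (\<lambda>x. exp (2 * t * x))" using t by (intro int) auto
    have "integral\<^sup>L (\<mu>k k) (\<lambda>x. exp (t * x)) - integral\<^sup>L (\<mu>k k) (\<lambda>x. exp (2 * t * x)) / M
       = integral\<^sup>L (\<mu>k k) (\<lambda>x. exp (t * x) - exp (2 * t * x) / M)"
      using int[OF t] i2 by simp
    also have "\<dots> \<le> integral\<^sup>L (\<mu>k k) (f M)"
    proof (intro integral_mono fik M)
      show "integrable (\<mu>k k) (\<lambda>x. exp (t * x) - exp (2 * t * x) / M)" using int[OF t] i2 by simp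
      fix x
      have e: "exp (2 * t * x) = exp (t * x) * exp (t * x)" by (simp add: exp_add[symmetric])
      show "exp (t * x) - exp (2 * t * x) / M \<le> f M x"
      proof (cases "exp (t * x) \<le> M")
        case False
        then have "exp (t * x) * 1 \<le> exp (t * x) * (exp (t * x) / M)" using M by (intro mult_left_mono) auto
        then show ?thesis using False M by (simp add: f_def e)
      qed (use M in \<open>simp add: f_def\<close>)
    qed
    finally show ?thesis .
    qed
    then show "\<exists>N. \<forall>n\<ge>N. integral\<^sup>L (\<mu>k n) (\<lambda>x. exp (t * x)) - integral\<^sup>L (\<mu>k n) (\<lambda>x. exp (2 * t * x)) / M \<le> integral\<^sup>L (\<mu>k n) (f M)"
      by blast
  qed
  have conv: "(\<lambda>n. f (real (Suc n)) x) \<longlonglongrightarrow> exp (t * x)" for x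
  proof (rule tendsto_eventually)
    obtain N where "exp (t * x) \<le> real N" using real_arch_simple by blast
    then have "f (real (Suc n)) x = exp (t * x)" if "n \<ge> N" for n using that by (simp add: f_def min_def)
    then show "eventually (\<lambda>n. f (real (Suc n)) x = exp (t * x)) sequentially"
      by (auto simp: eventually_sequentially)
  qed
  have "(\<integral>\<^sup>+x. ennreal (exp (t * x)) \<partial>\<mu>) \<le> ennreal (lim t)"
  proof -
    have "(\<integral>\<^sup>+x. ennreal (exp (t * x)) \<partial>\<mu>) = (\<integral>\<^sup>+x. liminf (\<lambda>n. ennreal (f (real (Suc n)) x)) \<partial>\<mu>)"
      using conv by (intro nn_integral_cong lim_imp_Liminf[symmetric] tendsto_ennrealI) auto
    also have "\<dots> \<le> liminf (\<lambda>n. \<integral>\<^sup>+x. ennreal (f (real (Suc n)) x) \<partial>\<mu>)"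
      by (rule nn_integral_liminf) measurable
    also have "\<dots> \<le> liminf (\<lambda>n. ennreal (lim t))"
    proof (intro Liminf_mono always_eventually allI)
      fix n
      have "(\<integral>\<^sup>+x. ennreal (f (real (Suc n)) x) \<partial>\<mu>) = ennreal (integral\<^sup>L \<mu> (f (real (Suc n))))"
        by (intro nn_integral_eq_integral fi) (auto simp: f_def)
      also have "\<dots> \<le> ennreal (lim t)" by (intro ennreal_leI up) simp
      finally show "(\<integral>\<^sup>+x. ennreal (f (real (Suc n)) x) \<partial>\<mu>) \<le> ennreal (lim t)" .
    qed
    also have "\<dots> = ennreal (lim t)" by (simp add: Liminf_const)
    finally show ?thesis .
  qed
  then show i: "integrable \<mu> (\<lambda>x. exp (t * x))"
    by (intro integrableI_nonneg) (auto simp: le_less_trans)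
  have "(\<lambda>n. integral\<^sup>L \<mu> (f (real (Suc n)))) \<longlonglongrightarrow> integral\<^sup>L \<mu> (\<lambda>x. exp (t * x))"
    by (rule integral_dominated_convergence[OF _ _ i]) (use conv in \<open>auto simp: f_def min_def\<close>)
  moreover have "(\<lambda>n. integral\<^sup>L \<mu> (f (real (Suc n)))) \<longlonglongrightarrow> lim t"
  proof (rule tendsto_sandwich[OF _ _ _ tendsto_const])
    show "eventually (\<lambda>n. lim t - lim (2 * t) / real (Suc n) \<le> integral\<^sup>L \<mu> (f (real (Suc n)))) sequentially"
      by (intro always_eventually allI lo) simp
    show "eventually (\<lambda>n. integral\<^sup>L \<mu> (f (real (Suc n))) \<le> lim t) sequentially"
      by (intro always_eventually allI up) simp
    have "(\<lambda>n. lim t - lim (2 * t) / real (Suc n)) \<longlonglongrightarrow> lim t - 0"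
      by (intro tendsto_diff tendsto_const LIMSEQ_Suc[OF lim_const_over_n])
    then show "(\<lambda>n. lim t - lim (2 * t) / real (Suc n)) \<longlonglongrightarrow> lim t" by simp
  qed
  ultimately show "integral\<^sup>L \<mu> (\<lambda>x. exp (t * x)) = lim t" by (rule LIMSEQ_unique)
qed

section \<open>Conditioning as a change of measure\<close>

lemma ratio_close_to_1:
  fixes \<gamma> :: real
  assumes "\<epsilon> > 0"
  obtains \<eta> where "0 < \<eta>" "\<eta> < 1 / 2" "\<And>u v. \<bar>u - 1\<bar> \<le> \<eta> \<Longrightarrow> \<bar>v - 1\<bar> \<le> \<eta> \<Longrightarrow> \<bar>u * v powr (\<gamma> - 1) - 1\<bar> \<le> \<epsilon>"
proof -
  have "isCont (\<lambda>v::real. v powr (\<gamma> - 1)) 1" by (intro continuous_intros) auto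
  then obtain e where e: "e > 0" "\<And>v::real. \<bar>v - 1\<bar> < e \<Longrightarrow> \<bar>v powr (\<gamma> - 1) - 1\<bar> < \<epsilon> / 4"
    unfolding continuous_at_eps_delta using assms by (metis dist_real_def powr_one_eq_one zero_less_divide_iff zero_less_numeral)
  \<comment> \<open>the cap at 1/4 keeps \<open>u\<close> bounded\<close>
  define \<eta> where "\<eta> = min (min (e / 2) (\<epsilon> / 4)) (1 / 4)"
  have "\<bar>u * v powr (\<gamma> - 1) - 1\<bar> \<le> \<epsilon>" if u: "\<bar>u - 1\<bar> \<le> \<eta>" and v: "\<bar>v - 1\<bar> \<le> \<eta>" for u v :: real
  proof -
    have v': "\<bar>v powr (\<gamma> - 1) - 1\<bar> \<le> \<epsilon> / 4" using e(2)[of v] v e(1) by (simp add: \<eta>_def)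
    have "\<bar>u - 1\<bar> \<le> 1 / 4" using u by (simp add: \<eta>_def)
    then have "\<bar>u\<bar> \<le> 2" by linarith
    then have "\<bar>u\<bar> * \<bar>v powr (\<gamma> - 1) - 1\<bar> \<le> 2 * (\<epsilon> / 4)" using v' by (intro mult_mono) auto
    moreover have "u * v powr (\<gamma> - 1) - 1 = u * (v powr (\<gamma> - 1) - 1) + (u - 1)" by (simp add: algebra_simps)
    moreover have "\<bar>u - 1\<bar> \<le> \<epsilon> / 4" using u by (simp add: \<eta>_def)
    ultimately have "\<bar>u * v powr (\<gamma> - 1) - 1\<bar> \<le> \<bar>u\<bar> * \<bar>v powr (\<gamma> - 1) - 1\<bar> + \<bar>u - 1\<bar>"
      using abs_triangle_ineq[of "u * (v powr (\<gamma> - 1) - 1)" "u - 1"] by (simp only: abs_mult)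
    also have "\<dots> \<le> 2 * (\<epsilon> / 4) + \<epsilon> / 4" by (rule add_mono) fact+
    finally show ?thesis using assms by simp
  qed
  with that[of \<eta>] e assms show ?thesis by (simp add: \<eta>_def)
qed

text \<open>
If a density is close to one in mean, then normalising it changes the probability of no event by much,
uniformly over events.
\<close>

lemma tilted_measure_close:
  fixes p :: "nat \<Rightarrow> 'a pmf" and w :: "nat \<Rightarrow> 'a \<Rightarrow> real"
  assumes int: "\<And>k. integrable (measure_pmf (p k)) (w k)"
    and lim: "(\<lambda>k. measure_pmf.expectation (p k) (\<lambda>h. \<bar>w k h - 1\<bar>)) \<longlonglongrightarrow> 0"
  shows "(\<lambda>k. measure_pmf.expectation (p k) (\<lambda>h. w k h * indicator (B k) h) / measure_pmf.expectation (p k) (w k)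
     - measure_pmf.prob (p k) (B k)) \<longlonglongrightarrow> 0"
proof -
  have iB: "integrable (measure_pmf (p k)) (\<lambda>h. w k h * indicator (A k) h)" for k A
    using integrable_real_mult_indicator[of "A k" "measure_pmf (p k)" "w k"] int by simp
  have ii: "integrable (measure_pmf (p k)) (indicator (A k) :: 'a \<Rightarrow> real)" for k A
    by (rule measure_pmf.integrable_const_bound[where B = 1]) (auto simp: indicator_def)
  have id: "integrable (measure_pmf (p k)) (\<lambda>h. \<bar>w k h - 1\<bar>)" for k using int[of k] by simp
  have close: "(\<lambda>k. measure_pmf.expectation (p k) (\<lambda>h. w k h * indicator (A k) h) - measure_pmf.prob (p k) (A k)) \<longlonglongrightarrow> 0" for A
  proof (rule Lim_null_comparison[OF always_eventually[OF allI] lim])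
    fix k
    have "measure_pmf.expectation (p k) (\<lambda>h. w k h * indicator (A k) h) - measure_pmf.prob (p k) (A k)
      = measure_pmf.expectation (p k) (\<lambda>h. w k h * indicator (A k) h - indicator (A k) h)"
      by (subst Bochner_Integration.integral_diff) (simp_all add: iB ii)
    also have "\<bar>\<dots>\<bar> \<le> measure_pmf.expectation (p k) (\<lambda>h. \<bar>w k h * indicator (A k) h - indicator (A k) h\<bar>)"
      by (rule integral_abs_bound)
    also have "\<dots> \<le> measure_pmf.expectation (p k) (\<lambda>h. \<bar>w k h - 1\<bar>)"
    proof (intro integral_mono id)
      show "integrable (measure_pmf (p k)) (\<lambda>h. \<bar>w k h * indicator (A k) h - indicator (A k) h\<bar>)"
        by (intro integrable_abs Bochner_Integration.integrable_diff iB ii)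
    qed (auto split: split_indicator)
    finally show "norm (measure_pmf.expectation (p k) (\<lambda>h. w k h * indicator (A k) h) - measure_pmf.prob (p k) (A k))
      \<le> measure_pmf.expectation (p k) (\<lambda>h. \<bar>w k h - 1\<bar>)" by simp
  qed
  define D where "D = (\<lambda>k. measure_pmf.expectation (p k) (w k))"
  define E where "E = (\<lambda>k. measure_pmf.expectation (p k) (\<lambda>h. w k h * indicator (B k) h) - measure_pmf.prob (p k) (B k))"
  define P where "P = (\<lambda>k. measure_pmf.prob (p k) (B k))"
  have "(\<lambda>k. D k - 1) \<longlonglongrightarrow> 0"
    using close[of "\<lambda>_. UNIV"] by (simp add: D_def)
  then have D: "D \<longlonglongrightarrow> 1" using tendsto_add[of _ 0 sequentially "\<lambda>_. 1" 1] by fastforce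
  have E: "E \<longlonglongrightarrow> 0" unfolding E_def by (rule close)
  have "(\<lambda>k. inverse (D k) - 1) \<longlonglongrightarrow> inverse 1 - 1" by (intro tendsto_intros D) auto
  then have "(\<lambda>k. inverse (D k) - 1) \<longlonglongrightarrow> 0" by simp
  then have "(\<lambda>k. P k * (inverse (D k) - 1)) \<longlonglongrightarrow> 0"
    by (rule Lim_null_comparison[rotated, OF tendsto_norm_zero])
       (auto simp: P_def abs_mult intro!: always_eventually mult_left_le_one_le)
  moreover have "(\<lambda>k. E k * inverse (D k)) \<longlonglongrightarrow> 0 * inverse 1" by (intro tendsto_intros E D) auto
  ultimately have "(\<lambda>k. E k * inverse (D k) + P k * (inverse (D k) - 1)) \<longlonglongrightarrow> 0"
    using tendsto_add[of "\<lambda>k. E k * inverse (D k)" 0 sequentially "\<lambda>k. P k * (inverse (D k) - 1)" 0] by simp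
  moreover have "E k * inverse (D k) + P k * (inverse (D k) - 1)
    = measure_pmf.expectation (p k) (\<lambda>h. w k h * indicator (B k) h) / D k - P k" for k
    unfolding E_def P_def by (simp add: algebra_simps divide_inverse)
  ultimately show ?thesis by (simp add: D_def P_def)
qed

context site_profile
begin

abbreviation origin_coeff where "origin_coeff \<equiv> exp_coeff (\<lambda>j. real j powr \<gamma>)"

text \<open>
Conditioning on the total size \<open>n\<close> multiplies the law of \<open>H'\<close> by this density, up to
normalisation. The denominator is the asymptotic value of the numerator at the mean, so that the
density is close to one where \<open>H'\<close> is close to its mean.
\<close>

definition tilt where
  "tilt L n h = (if h \<le> n then origin_coeff (n - h) / (suminf origin_coeff * (real n - mean L) powr (\<gamma> - 1)) else 0)"

text \<open>
Near the mean the ratio is within \<open>\<epsilon>\<close> of one. Away from it, one of the two Chernoff factors is at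
least one, and \<open>c\<^sub>m \<le> K m powr (\<gamma> - 1)\<close> bounds the density as long as \<open>m\<close> exceeds half its
typical value. For smaller \<open>m\<close> only \<open>c\<^sub>m \<le> \<Sum>c\<close> is left; this loses a power of the system
size, which the last exponential factor pays for.
\<close>

lemma tilt_pointwise_bound:
  assumes \<epsilon>: "\<epsilon> > 0"
  obtains \<eta> K M where "0 < \<eta>" "K > 0" "M > 0"
    "\<And>L n h. L > 0 \<Longrightarrow> real n - mean L \<ge> M \<Longrightarrow> \<bar>tilt L n h - 1\<bar> \<le> \<epsilon>
       + K * (exp ((1 / (2 * L powr \<delta>)) * (real h - mean L)) * exp (- \<eta> * (real n - mean L) / (2 * L powr \<delta>))
             + exp (fluct L h) * exp (- \<eta> * (real n - mean L) / L powr \<alpha>))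
       + (real n - mean L) powr (1 - \<gamma>) * exp (- (real n - mean L) / (4 * L powr \<delta>)) * exp ((1 / (2 * L powr \<delta>)) * (real h - mean L))"
proof -
  define c where "c = origin_coeff"
  define C where "C = suminf c"
  have c0: "c m \<ge> 0" for m unfolding c_def by (rule exp_coeff_nonneg) auto
  have sc: "summable c" and C: "C > 0"
    unfolding C_def c_def using exp_coeff_powr_summable[OF \<gamma>_neg] by auto
  have cC: "c m \<le> C" for m
    unfolding C_def using sum_le_suminf[OF sc, of "{m}"] c0 by simp
  obtain K where K: "\<And>m. m \<ge> 1 \<Longrightarrow> c m \<le> K * real m powr (\<gamma> - 1)" "K > 0"
    using exp_coeff_powr_bound[OF exponent_facts(1) \<gamma>_neg] unfolding c_def by blast
  obtain \<eta> where \<eta>: "0 < \<eta>" "\<eta> < 1 / 2" "\<And>u v. \<bar>u - 1\<bar> \<le> \<eta> \<Longrightarrow> \<bar>v - 1\<bar> \<le> \<eta> \<Longrightarrow> \<bar>u * v powr (\<gamma> - 1) - 1\<bar> \<le> \<epsilon>"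
    using ratio_close_to_1[OF \<epsilon>] by blast
  have "(\<lambda>m. c m * real m powr (1 - \<gamma>)) \<longlonglongrightarrow> C"
    unfolding c_def C_def by (rule exp_coeff_powr_asymp[OF exponent_facts(1) \<gamma>_neg])
  then have "(\<lambda>m. c m * real m powr (1 - \<gamma>) / C) \<longlonglongrightarrow> C / C" using C by (intro tendsto_intros) auto
  then have "(\<lambda>m. c m * real m powr (1 - \<gamma>) / C) \<longlonglongrightarrow> 1" using C by simp
  then have "eventually (\<lambda>m. \<bar>c m * real m powr (1 - \<gamma>) / C - 1\<bar> < \<eta>) sequentially"
    using \<eta>(1) by (auto simp: tendsto_iff dist_real_def)
  then obtain M1 where M1: "\<And>m. m \<ge> M1 \<Longrightarrow> \<bar>c m * real m powr (1 - \<gamma>) / C - 1\<bar> < \<eta>"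
    by (auto simp: eventually_sequentially)
  define K1 where "K1 = K * (1 / 2) powr (\<gamma> - 1) / C"
  have K1: "K1 \<ge> 0" using K C by (simp add: K1_def)
  show thesis
  proof
    show "0 < \<eta>" by fact
    show "1 + K1 > 0" using K1 by simp
    show "2 * real M1 + 2 > 0" by simp
    fix L :: real and n h :: nat
    assume L: "L > 0" and big: "real n - mean L \<ge> 2 * real M1 + 2"
    define m0 where "m0 = real n - mean L"
    define Y where "Y = exp ((1 / (2 * L powr \<delta>)) * (real h - mean L))"
    define X where "X = exp (fluct L h)"
    define T1 where "T1 = Y * exp (- \<eta> * m0 / (2 * L powr \<delta>))"
    define T2 where "T2 = X * exp (- \<eta> * m0 / L powr \<alpha>)"
    define T3 where "T3 = m0 powr (1 - \<gamma>) * exp (- m0 / (4 * L powr \<delta>)) * Y"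
    have m0: "m0 \<ge> 2 * real M1 + 2" "m0 > 0" using big by (auto simp: m0_def)
    have T: "T1 \<ge> 0" "T2 \<ge> 0" "T3 \<ge> 0" by (auto simp: T1_def T2_def T3_def X_def Y_def)
    have LL: "L powr \<delta> > 0" "L powr \<alpha> > 0" using L by auto
    have T1_ge: "T1 \<ge> 1" if "real h - mean L \<ge> \<eta> * m0"
    proof -
      have "\<eta> * m0 / (2 * L powr \<delta>) \<le> (real h - mean L) / (2 * L powr \<delta>)"
        using that LL by (intro divide_right_mono) auto
      then show ?thesis unfolding T1_def Y_def exp_add[symmetric] by simp
    qed
    have T2_ge: "T2 \<ge> 1" if "real h - mean L \<le> - (\<eta> * m0)"
    proof -
      have "\<eta> * m0 / L powr \<alpha> \<le> - (real h - mean L) / L powr \<alpha>"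
        using that LL by (intro divide_right_mono) auto
      then show ?thesis unfolding T2_def X_def fluct_def exp_add[symmetric] by simp
    qed
    have "\<bar>tilt L n h - 1\<bar> \<le> \<epsilon> + (1 + K1) * (T1 + T2) + T3"
    proof (cases "\<bar>real h - mean L\<bar> < \<eta> * m0")
      case True
      moreover have "\<eta> * m0 \<le> 1 * m0" using \<eta> m0 by (intro mult_right_mono) auto
      ultimately have "real h - mean L < m0" by linarith
      then have hn: "h \<le> n" by (simp add: m0_def)
      define m where "m = n - h"
      have rm: "real m = m0 - (real h - mean L)" using hn by (simp add: m_def m0_def of_nat_diff)
      have "\<eta> * m0 \<le> 1 / 2 * m0" using \<eta> m0 by (intro mult_right_mono) auto
      then have mM: "real m > m0 / 2" using True rm by linarith
      then have mge: "m \<ge> M1" "real m > 0" using m0 by auto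
      have "\<bar>real m / m0 - 1\<bar> \<le> \<eta>"
      proof -
        have "real m / m0 - 1 = - (real h - mean L) / m0" using m0 by (simp add: rm field_simps)
        then have "\<bar>real m / m0 - 1\<bar> = \<bar>real h - mean L\<bar> / m0" using m0 by simp
        also have "\<dots> \<le> \<eta>" using True m0 by (simp add: pos_divide_le_eq)
        finally show ?thesis .
      qed
      then have "\<bar>(c m * real m powr (1 - \<gamma>) / C) * (real m / m0) powr (\<gamma> - 1) - 1\<bar> \<le> \<epsilon>"
        using M1[OF mge(1)] by (intro \<eta>(3)) auto
      moreover have "(c m * real m powr (1 - \<gamma>) / C) * (real m / m0) powr (\<gamma> - 1) = tilt L n h"
      proof -
        have "real m powr (1 - \<gamma>) * real m powr (\<gamma> - 1) = 1" using mge by (simp add: powr_add[symmetric])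
        then have "(c m * real m powr (1 - \<gamma>) / C) * (real m / m0) powr (\<gamma> - 1) = c m / (C * m0 powr (\<gamma> - 1))"
          using m0 mge by (simp add: powr_divide mult.assoc)
        then show ?thesis using hn by (simp add: tilt_def m_def[symmetric] m0_def C_def c_def)
      qed
      ultimately show ?thesis using T K1 by (simp add: add.assoc add_increasing2)
    next
      case False
      then have T12: "1 \<le> T1 + T2"
        using T1_ge T2_ge T by (smt (verit))
      then have K12: "1 + K1 \<le> (1 + K1) * (T1 + T2)" using K1 mult_left_mono[OF T12, of "1 + K1"] by simp
      have tilt0: "tilt L n h \<ge> 0" using c0 C m0 by (simp add: tilt_def c_def[symmetric] C_def[symmetric] m0_def[symmetric])
      have "tilt L n h \<le> K1 + T3"
      proof (cases "h \<le> n")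
        case True
        define m where "m = n - h"
        have rm: "real m = m0 - (real h - mean L)" using True by (simp add: m_def m0_def of_nat_diff)
        have te: "tilt L n h = c m / C * m0 powr (1 - \<gamma>)"
          using True m0 by (simp add: tilt_def m_def[symmetric] m0_def[symmetric] C_def c_def powr_diff)
        show ?thesis
        proof (cases "real m \<ge> m0 / 2")
          case True
          then have m1: "m \<ge> 1" using m0 by linarith
          have "c m \<le> K * real m powr (\<gamma> - 1)" by (rule K(1)[OF m1])
          also have "\<dots> \<le> K * (1 / 2 * m0) powr (\<gamma> - 1)"
            using True m0 K \<gamma>_neg by (intro mult_left_mono powr_mono2') auto
          finally have "tilt L n h \<le> K * (1 / 2 * m0) powr (\<gamma> - 1) / C * m0 powr (1 - \<gamma>)"
            unfolding te using C by (intro mult_right_mono divide_right_mono) auto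
          also have "\<dots> = K1 * (m0 powr (\<gamma> - 1) * m0 powr (1 - \<gamma>))"
            using m0 by (simp only: K1_def powr_mult) simp
          also have "m0 powr (\<gamma> - 1) * m0 powr (1 - \<gamma>) = 1" using m0 by (simp add: powr_add[symmetric])
          finally show ?thesis using T by simp
        next
          case False
          then have hm: "real h - mean L \<ge> m0 / 2" using rm by linarith
          have "(m0 / 2) / (2 * L powr \<delta>) \<le> (real h - mean L) / (2 * L powr \<delta>)"
            using hm LL by (intro divide_right_mono) auto
          then have "1 \<le> exp (- m0 / (4 * L powr \<delta>)) * Y"
            unfolding Y_def exp_add[symmetric] by simp
          then have "m0 powr (1 - \<gamma>) * 1 \<le> m0 powr (1 - \<gamma>) * (exp (- m0 / (4 * L powr \<delta>)) * Y)"
            by (intro mult_left_mono) auto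
          then have "m0 powr (1 - \<gamma>) \<le> T3" by (simp add: T3_def mult.assoc)
          moreover have "tilt L n h \<le> 1 * m0 powr (1 - \<gamma>)"
            unfolding te using cC[of m] C by (intro mult_right_mono) auto
          ultimately show ?thesis using K1 by simp
        qed
      qed (use K1 T in \<open>simp add: tilt_def\<close>)
      then show ?thesis using K12 tilt0 \<epsilon> T by (smt (verit))
    qed
    then show "\<bar>tilt L n h - 1\<bar> \<le> \<epsilon>
       + (1 + K1) * (exp ((1 / (2 * L powr \<delta>)) * (real h - mean L)) * exp (- \<eta> * (real n - mean L) / (2 * L powr \<delta>))
             + exp (fluct L h) * exp (- \<eta> * (real n - mean L) / L powr \<alpha>))
       + (real n - mean L) powr (1 - \<gamma>) * exp (- (real n - mean L) / (4 * L powr \<delta>)) * exp ((1 / (2 * L powr \<delta>)) * (real h - mean L))"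
      by (simp only: T1_def T2_def T3_def X_def Y_def m0_def)
  qed
qed


lemma pmf_integral_finite_support:
  fixes f :: "nat \<Rightarrow> real"
  assumes "\<And>h. h > n \<Longrightarrow> f h = 0"
  shows "integrable (measure_pmf p) f" "measure_pmf.expectation p f = (\<Sum>h\<le>n. pmf p h * f h)"
proof -
  have "summable (\<lambda>h. norm (pmf p h *\<^sub>R f h))"
    by (rule summable_finite[of "{..n}"]) (use assms in auto)
  note I = integral_pmf_nat[OF this]
  show "integrable (measure_pmf p) f" by (rule I)
  show "measure_pmf.expectation p f = (\<Sum>h\<le>n. pmf p h * f h)"
    unfolding I(2) by (subst suminf_finite[of "{..n}"]) (use assms in auto)
qed

lemma tilt_integrable: "integrable (measure_pmf (site_pmf L)) (tilt L n)"
  by (rule pmf_integral_finite_support[of n]) (simp add: tilt_def)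

text \<open>
All error terms of \<open>tilt_pointwise_bound\<close> vanish in mean, because \<open>n - mean L\<close> is of order
\<open>L powr (\<delta> * a)\<close>, which exceeds both \<open>L powr \<alpha>\<close> and \<open>L powr \<delta>\<close> by a power of \<open>L\<close>.
\<close>

lemma tilt_expectation_limit:
  assumes L: "\<And>k. L k > 0" "filterlim L at_top sequentially" and \<kappa>: "\<kappa> > 0"
    and n: "(\<lambda>k. (real (n k) - mean (L k)) / L k powr (\<delta> * a)) \<longlonglongrightarrow> \<kappa>"
  shows "(\<lambda>k. measure_pmf.expectation (site_pmf (L k)) (\<lambda>h. \<bar>tilt (L k) (n k) h - 1\<bar>)) \<longlonglongrightarrow> 0"
proof (rule tendstoI)
  fix \<epsilon> :: real assume "\<epsilon> > 0"
  then have \<epsilon>: "\<epsilon> / 2 > 0" by simp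
  obtain \<eta> K M where \<eta>: "0 < \<eta>" "K > 0" "M > 0"
    and bd: "\<And>L n h. L > 0 \<Longrightarrow> real n - mean L \<ge> M \<Longrightarrow> \<bar>tilt L n h - 1\<bar> \<le> \<epsilon> / 2
       + K * (exp ((1 / (2 * L powr \<delta>)) * (real h - mean L)) * exp (- \<eta> * (real n - mean L) / (2 * L powr \<delta>))
             + exp (fluct L h) * exp (- \<eta> * (real n - mean L) / L powr \<alpha>))
       + (real n - mean L) powr (1 - \<gamma>) * exp (- (real n - mean L) / (4 * L powr \<delta>)) * exp ((1 / (2 * L powr \<delta>)) * (real h - mean L))"
    using tilt_pointwise_bound[OF \<epsilon>] by blast
  obtain C where C: "\<And>L. L > 0 \<Longrightarrow> integrable (measure_pmf (site_pmf L)) (\<lambda>h. exp ((1 / (2 * L powr \<delta>)) * (real h - mean L)))"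
    "\<And>L. L > 0 \<Longrightarrow> measure_pmf.expectation (site_pmf L) (\<lambda>h. exp ((1 / (2 * L powr \<delta>)) * (real h - mean L))) \<le> C"
    using site_pmf_exp_bound by blast
  define m0 where "m0 = (\<lambda>k. real (n k) - mean (L k))"
  define r where "r = (\<lambda>k. m0 k / L k powr (\<delta> * a))"
  have r: "r \<longlonglongrightarrow> \<kappa>" using n by (simp add: r_def m0_def)
  have m0r: "m0 k = r k * L k powr (\<delta> * a)" for k using L(1)[of k] by (simp add: r_def)
  have Lp: "filterlim (\<lambda>k. L k powr e) at_top sequentially" if "e > 0" for e
    by (rule filterlim_compose[OF _ L(2)]) (use that in real_asymp)
  have grow: "filterlim (\<lambda>k. m0 k / L k powr e) at_top sequentially" if "e < \<delta> * a" for e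
  proof -
    have "m0 k / L k powr e = r k * L k powr (\<delta> * a - e)" for k
      using L(1)[of k] by (simp add: m0r powr_diff)
    then show ?thesis using filterlim_tendsto_pos_mult_at_top[OF r \<kappa> Lp[of "\<delta> * a - e"]] that by simp
  qed
  have expz: "(\<lambda>k. exp (- c * m0 k / L k powr e)) \<longlonglongrightarrow> 0" if "e < \<delta> * a" "c > 0" for e c
  proof -
    have "filterlim (\<lambda>k. c * (m0 k / L k powr e)) at_top sequentially"
      by (rule filterlim_tendsto_pos_mult_at_top[OF tendsto_const \<open>c > 0\<close> grow[OF that(1)]])
    then have "(\<lambda>k. exp (- (c * (m0 k / L k powr e)))) \<longlonglongrightarrow> 0"
      by (intro filterlim_compose[OF exp_at_bot] filterlim_uminus_at_bot_at_top[THEN filterlim_compose])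
    then show ?thesis by simp
  qed
  define e1 where "e1 = (\<lambda>k. exp (- \<eta> * m0 k / (2 * L k powr \<delta>)))"
  define e2 where "e2 = (\<lambda>k. exp (- \<eta> * m0 k / L k powr \<alpha>))"
  define e3 where "e3 = (\<lambda>k. m0 k powr (1 - \<gamma>) * exp (- m0 k / (4 * L k powr \<delta>)))"
  define B where "B = (\<lambda>k. integral\<^sup>L (site_law (L k)) (\<lambda>x. exp (1 * x)))"
  have e1: "e1 \<longlonglongrightarrow> 0"
    using expz[of \<delta> "\<eta> / 2"] exponent_facts(7) \<eta> by (simp add: e1_def mult.commute)
  have e2: "e2 \<longlonglongrightarrow> 0"
    using expz[of \<alpha> \<eta>] exponent_facts \<eta> by (simp add: e2_def)
  have e3: "e3 \<longlonglongrightarrow> 0"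
  proof -
    \<comment> \<open>both the polynomial and the exponential factor are functions of this one large quantity\<close>
    define u where "u = (\<lambda>k. L k powr (\<delta> * a - \<delta>))"
    define q where "q = \<delta> * a * (1 - \<gamma>) / (\<delta> * a - \<delta>)"
    have u: "filterlim u at_top sequentially" unfolding u_def using exponent_facts(7) by (intro Lp) simp
    have "((\<lambda>x::real. x powr q * exp (- (\<kappa> / 8) * x)) \<longlongrightarrow> 0) at_top"
      using \<kappa> by real_asymp
    then have "(\<lambda>k. u k powr q * exp (- (\<kappa> / 8) * u k)) \<longlonglongrightarrow> 0"
      by (rule filterlim_compose[OF _ u])
    then have "(\<lambda>k. r k powr (1 - \<gamma>) * (u k powr q * exp (- (\<kappa> / 8) * u k))) \<longlonglongrightarrow> \<kappa> powr (1 - \<gamma>) * 0"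
      using \<kappa> by (intro tendsto_mult tendsto_powr r tendsto_const) auto
    then have lim: "(\<lambda>k. r k powr (1 - \<gamma>) * (u k powr q * exp (- (\<kappa> / 8) * u k))) \<longlonglongrightarrow> 0" by simp
    have "eventually (\<lambda>k. r k > \<kappa> / 2) sequentially" using r \<kappa> by (intro order_tendstoD) auto
    then have "eventually (\<lambda>k. norm (e3 k) \<le> r k powr (1 - \<gamma>) * (u k powr q * exp (- (\<kappa> / 8) * u k))) sequentially"
    proof eventually_elim
      case (elim k)
      have u0: "u k > 0" using L(1)[of k] by (simp add: u_def)
      have r0: "r k > 0" using elim \<kappa> by simp
      have ne: "\<delta> * a - \<delta> \<noteq> 0" using exponent_facts(7) by linarith
      have "(\<delta> * a - \<delta>) * q = \<delta> * a * (1 - \<gamma>)"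
      proof -
        have "X * (Y / X) = Y" if "X \<noteq> 0" for X Y :: real using that by simp
        from this[OF ne] show ?thesis unfolding q_def .
      qed
      then have uq: "u k powr q = L k powr (\<delta> * a * (1 - \<gamma>))"
        by (simp only: u_def powr_powr)
      have p: "m0 k powr (1 - \<gamma>) = r k powr (1 - \<gamma>) * u k powr q"
        unfolding m0r uq using r0 by (simp add: powr_mult powr_powr)
      have "m0 k / L k powr \<delta> = r k * u k"
        using L(1)[of k] by (simp add: m0r u_def powr_diff)
      then have "- m0 k / (4 * L k powr \<delta>) = - (r k * u k) / 4" by simp
      also have "\<dots> \<le> - (\<kappa> / 8) * u k"
        using mult_right_mono[of "\<kappa> / 2" "r k" "u k"] elim u0 by simp
      finally have ex: "exp (- m0 k / (4 * L k powr \<delta>)) \<le> exp (- (\<kappa> / 8) * u k)" by simp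
      have "e3 k \<le> (r k powr (1 - \<gamma>) * u k powr q) * exp (- (\<kappa> / 8) * u k)"
        unfolding e3_def p by (intro mult_left_mono ex) auto
      moreover have "e3 k \<ge> 0" by (simp add: e3_def)
      ultimately show ?case by (simp add: mult.assoc)
    qed
    then show ?thesis by (rule Lim_null_comparison[OF _ lim])
  qed
  have B: "B \<longlonglongrightarrow> exp (stable_const * 1 powr s)"
    unfolding B_def by (rule site_law_real_exp_limit[OF L]) simp
  have "(\<lambda>k. \<epsilon> / 2 + K * (C * e1 k + B k * e2 k) + e3 k * C) \<longlonglongrightarrow> \<epsilon> / 2 + K * (C * 0 + exp (stable_const * 1 powr s) * 0) + 0 * C"
    by (intro tendsto_intros e1 e2 e3 B)
  then have lim: "(\<lambda>k. \<epsilon> / 2 + K * (C * e1 k + B k * e2 k) + e3 k * C) \<longlonglongrightarrow> \<epsilon> / 2" by simp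
  have "eventually (\<lambda>k. \<epsilon> / 2 + K * (C * e1 k + B k * e2 k) + e3 k * C < \<epsilon>) sequentially"
    by (rule order_tendstoD(2)[OF lim]) (use \<epsilon> in simp)
  moreover have "filterlim m0 at_top sequentially"
    using filterlim_tendsto_pos_mult_at_top[OF r \<kappa> Lp[of "\<delta> * a"]] exponent_facts(4,6,7) \<delta>_pos a_gt by (simp add: m0r[symmetric])
  then have "eventually (\<lambda>k. m0 k \<ge> M) sequentially" by (simp add: filterlim_at_top)
  ultimately show "eventually (\<lambda>k. dist (measure_pmf.expectation (site_pmf (L k)) (\<lambda>h. \<bar>tilt (L k) (n k) h - 1\<bar>)) 0 < \<epsilon>) sequentially"
  proof eventually_elim
    case (elim k)
    let ?Y = "\<lambda>h. exp ((1 / (2 * L k powr \<delta>)) * (real h - mean (L k)))"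
    let ?X = "\<lambda>h. exp (fluct (L k) h)"
    have iX: "integrable (measure_pmf (site_pmf (L k))) ?X" and eX: "measure_pmf.expectation (site_pmf (L k)) ?X = B k"
      using site_law_real_exp(1)[OF L(1), of 1 k] integral_site_law[of "\<lambda>x. exp (1 * x)" "L k"] by (auto simp: B_def)
    note iY = C(1)[OF L(1)[of k]]
    have "measure_pmf.expectation (site_pmf (L k)) (\<lambda>h. \<bar>tilt (L k) (n k) h - 1\<bar>)
      \<le> measure_pmf.expectation (site_pmf (L k)) (\<lambda>h. \<epsilon> / 2 + K * (?Y h * e1 k + ?X h * e2 k) + e3 k * ?Y h)"
    proof (intro integral_mono)
      show "integrable (measure_pmf (site_pmf (L k))) (\<lambda>h. \<bar>tilt (L k) (n k) h - 1\<bar>)"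
        using tilt_integrable[of "L k" "n k"] by simp
      show "integrable (measure_pmf (site_pmf (L k))) (\<lambda>h. \<epsilon> / 2 + K * (?Y h * e1 k + ?X h * e2 k) + e3 k * ?Y h)"
        by (intro Bochner_Integration.integrable_add integrable_mult_right integrable_mult_left iX iY) auto
      show "\<bar>tilt (L k) (n k) h - 1\<bar> \<le> \<epsilon> / 2 + K * (?Y h * e1 k + ?X h * e2 k) + e3 k * ?Y h" for h
        using bd[OF L(1)[of k], of "n k" h] elim unfolding e1_def e2_def e3_def m0_def by simp
    qed
    also have "\<dots> = \<epsilon> / 2 + K * (measure_pmf.expectation (site_pmf (L k)) ?Y * e1 k + B k * e2 k) + e3 k * measure_pmf.expectation (site_pmf (L k)) ?Y"
      using iX iY by (simp add: eX)
    also have "\<dots> \<le> \<epsilon> / 2 + K * (C * e1 k + B k * e2 k) + e3 k * C"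
      using \<eta> C(2)[OF L(1), of k]
      by (intro add_mono mult_left_mono mult_right_mono order_refl) (auto simp: e1_def e3_def)
    also have "\<dots> < \<epsilon>" using elim by simp
    finally show ?case by (simp add: abs_of_nonneg)
  qed
qed

text \<open>
The quotient is the conditional distribution function given by \<open>occupation_law\<close>. The substitution
\<open>h = n - m\<close> turns it into a quotient of \<open>tilt\<close>-expectations, in which the normalisations cancel.
\<close>

lemma origin_law_close:
  assumes L: "\<And>k. L k > 0" "filterlim L at_top sequentially" and \<kappa>: "\<kappa> > 0"
    and n: "(\<lambda>k. (real (n k) - mean (L k)) / L k powr (\<delta> * a)) \<longlonglongrightarrow> \<kappa>"
  shows "(\<lambda>k. (\<Sum>m | m \<le> n k \<and> (real m - (real (n k) - mean (L k))) / L k powr \<alpha> \<le> x. origin_coeff m * jumps (L k) (n k - m))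
      / (\<Sum>m\<le>n k. origin_coeff m * jumps (L k) (n k - m)) - cdf (site_law (L k)) x) \<longlonglongrightarrow> 0"
proof -
  define Bx where "Bx = (\<lambda>k. {h. fluct (L k) h \<le> x})"
  have cdf: "cdf (site_law (L k)) x = measure_pmf.prob (site_pmf (L k)) (Bx k)" for k
    unfolding cdf_def site_law_def by (subst measure_distr) (auto simp: Bx_def vimage_def)
  have ev: "eventually (\<lambda>k. measure_pmf.expectation (site_pmf (L k)) (\<lambda>h. tilt (L k) (n k) h * indicator (Bx k) h) / measure_pmf.expectation (site_pmf (L k)) (tilt (L k) (n k))
     - measure_pmf.prob (site_pmf (L k)) (Bx k) =
     (\<Sum>m | m \<le> n k \<and> (real m - (real (n k) - mean (L k))) / L k powr \<alpha> \<le> x. origin_coeff m * jumps (L k) (n k - m))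
      / (\<Sum>m\<le>n k. origin_coeff m * jumps (L k) (n k - m)) - cdf (site_law (L k)) x) sequentially"
  proof -
    have "eventually (\<lambda>k. (real (n k) - mean (L k)) / L k powr (\<delta> * a) > 0) sequentially"
      by (rule order_tendstoD(1)[OF n \<kappa>])
    then show ?thesis
    proof eventually_elim
      case (elim k)
      then have m0: "real (n k) - mean (L k) > 0" using L(1)[of k] by (simp add: zero_less_divide_iff)
      define F where "F = exp (- (\<Sum>j. rate (L k) j)) / (suminf origin_coeff * (real (n k) - mean (L k)) powr (\<gamma> - 1))"
      have F: "F > 0" using m0 exp_coeff_powr_summable(2)[OF \<gamma>_neg] by (simp add: F_def)
      have E: "measure_pmf.expectation (site_pmf (L k)) (\<lambda>h. tilt (L k) (n k) h * indicator A h)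
         = F * (\<Sum>m | m \<le> n k \<and> n k - m \<in> A. origin_coeff m * jumps (L k) (n k - m))" for A
      proof -
        have "measure_pmf.expectation (site_pmf (L k)) (\<lambda>h. tilt (L k) (n k) h * indicator A h)
           = (\<Sum>h\<le>n k. pmf (site_pmf (L k)) h * (tilt (L k) (n k) h * indicator A h))"
          by (rule pmf_integral_finite_support) (simp add: tilt_def)
        also have "\<dots> = (\<Sum>h | h \<le> n k \<and> h \<in> A. F * (origin_coeff (n k - h) * jumps (L k) h))"
          by (intro sum.mono_neutral_cong_right)
             (auto simp: pmf_site_pmf[OF L(1)] tilt_def F_def field_simps indicator_def)
        also have "\<dots> = (\<Sum>m | m \<le> n k \<and> n k - m \<in> A. F * (origin_coeff m * jumps (L k) (n k - m)))"
          by (rule sum.reindex_bij_witness[of _ "\<lambda>m. n k - m" "\<lambda>h. n k - h"]) auto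
        finally show ?thesis by (simp add: sum_distrib_left)
      qed
      have Bm: "n k - m \<in> Bx k \<longleftrightarrow> (real m - (real (n k) - mean (L k))) / L k powr \<alpha> \<le> x" if "m \<le> n k" for m
        using that by (simp add: Bx_def fluct_def of_nat_diff algebra_simps)
      have "(\<Sum>m | m \<le> n k \<and> n k - m \<in> Bx k. origin_coeff m * jumps (L k) (n k - m))
        = (\<Sum>m | m \<le> n k \<and> (real m - (real (n k) - mean (L k))) / L k powr \<alpha> \<le> x. origin_coeff m * jumps (L k) (n k - m))"
        by (intro sum.cong) (use Bm in auto)
      moreover have "measure_pmf.expectation (site_pmf (L k)) (tilt (L k) (n k)) = F * (\<Sum>m\<le>n k. origin_coeff m * jumps (L k) (n k - m))"
        using E[of UNIV] by (simp add: atMost_def)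
      ultimately show ?case using F by (simp add: E cdf)
    qed
  qed
  show ?thesis
    by (rule Lim_transform_eventually[OF tilted_measure_close[OF tilt_integrable tilt_expectation_limit[OF L \<kappa> n]] ev])
qed

end

section \<open>The stable constant\<close>

lemma nn_integral_Gamma_scaled:
  assumes x: "x > 0" and r: "r > 0"
  shows "(\<integral>\<^sup>+y. ennreal (y powr (x - 1) * exp (- (r * y))) * indicator {0..} y \<partial>lborel) = ennreal (Gamma x * r powr (- x))"
proof -
  define f where "f = (\<lambda>u. ennreal (u powr (x - 1) * exp (- u)) * indicator {0..} u)"
  have fm: "f \<in> borel_measurable borel" unfolding f_def by measurable
  have "integral\<^sup>N lborel f = ennreal \<bar>r\<bar> * (\<integral>\<^sup>+y. f (0 + r * y) \<partial>lborel)"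
    using r by (intro nn_integral_real_affine fm) simp
  then have "ennreal (Gamma x) = ennreal \<bar>r\<bar> * (\<integral>\<^sup>+y. ennreal ((0 + r * y) powr (x - 1) * exp (- (0 + r * y))) * indicator {0..} (0 + r * y) \<partial>lborel)"
    unfolding f_def nn_integral_Gamma[OF x] .
  also have "\<dots> = ennreal \<bar>r\<bar> * (\<integral>\<^sup>+y. ennreal (r powr (x - 1)) * (ennreal (y powr (x - 1) * exp (- (r * y))) * indicator {0..} y) \<partial>lborel)"
  proof -
    have "ennreal ((0 + r * y) powr (x - 1) * exp (- (0 + r * y))) * indicator {0..} (0 + r * y)
       = ennreal (r powr (x - 1)) * (ennreal (y powr (x - 1) * exp (- (r * y))) * indicator {0..} y)" for y
      using r by (cases "y \<ge> 0") (simp_all add: powr_mult ennreal_mult mult.assoc zero_le_mult_iff)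
    then show ?thesis by simp
  qed
  also have "\<dots> = ennreal (r * r powr (x - 1)) * (\<integral>\<^sup>+y. ennreal (y powr (x - 1) * exp (- (r * y))) * indicator {0..} y \<partial>lborel)"
    using r by (subst nn_integral_cmult) (auto simp: ennreal_mult mult.assoc)
  also have "r * r powr (x - 1) = r powr x" using r by (simp add: powr_diff)
  finally have e: "ennreal (Gamma x) = ennreal (r powr x) * (\<integral>\<^sup>+y. ennreal (y powr (x - 1) * exp (- (r * y))) * indicator {0..} y \<partial>lborel)" .
  have "ennreal (Gamma x * r powr (- x)) = ennreal (r powr (- x)) * ennreal (Gamma x)"
    using x by (simp add: ennreal_mult mult.commute)
  also have "\<dots> = ennreal (r powr (- x) * r powr x) * (\<integral>\<^sup>+y. ennreal (y powr (x - 1) * exp (- (r * y))) * indicator {0..} y \<partial>lborel)"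
    unfolding e by (simp add: ennreal_mult mult.assoc)
  also have "r powr (- x) * r powr x = 1" using r by (simp add: powr_add[symmetric])
  finally show ?thesis by simp
qed

lemma exp_remainder_pos:
  fixes y :: real
  assumes "y > 0"
  shows "exp (- y) - 1 + y > 0"
proof (cases "y \<le> 2")
  case True
  have "(1 - y / 2) ^ 2 \<le> exp (- (y / 2)) ^ 2"
    using exp_ge_add_one_self[of "- (y / 2)"] True by (intro power_mono) auto
  also have "exp (- (y / 2)) ^ 2 = exp (- y)" by (simp add: power2_eq_square exp_add[symmetric])
  finally have "1 - y + y ^ 2 / 4 \<le> exp (- y)" by (simp add: power2_eq_square algebra_simps)
  moreover have "y ^ 2 / 4 > 0" using assms by simp
  ultimately show ?thesis by linarith
qed (use exp_gt_zero[of "- y"] in linarith)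

lemma nn_integral_exp_remainder:
  fixes y :: real
  assumes "y \<ge> 0"
  shows "(\<integral>\<^sup>+w. ennreal ((1 - w) * (y ^ 2 * exp (- (w * y)))) * indicator {0..1} w \<partial>lborel) = ennreal (exp (- y) - 1 + y)"
proof -
  define G where "G = (\<lambda>w. - ((1 - w) * y * exp (- (w * y))) + exp (- (w * y)))"
  have "(\<integral>\<^sup>+w. ennreal ((1 - w) * (y ^ 2 * exp (- (w * y)))) * indicator {0..1} w \<partial>lborel) = ennreal (G 1 - G 0)"
  proof -
    have der: "(G has_real_derivative (1 - w) * (y ^ 2 * exp (- (w * y)))) (at w)" for w
      unfolding G_def by (auto intro!: derivative_eq_intros simp: algebra_simps power2_eq_square)
    show ?thesis
      by (intro nn_integral_FTC_Icc der) (use assms in auto)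
  qed
  also have "G 1 - G 0 = exp (- y) - 1 + y" by (simp add: G_def)
  finally show ?thesis .
qed

text \<open>
Use \<open>exp (- y) - 1 + y = integral of (1 - w) * y\<^sup>2 * exp (- w y)\<close> over \<open>w\<close> in \<open>[0, 1]\<close>. The
factor \<open>y\<^sup>2\<close> makes the inner integral over \<open>y\<close> a convergent Gamma integral at \<open>\<gamma> + 2\<close>, and
the integral over \<open>w\<close> has an elementary primitive.
\<close>

lemma nn_integral_jump_kernel:
  assumes \<gamma>: "-1 < \<gamma>" "\<gamma> < 0" and u: "u > (0::real)"
  defines "R \<equiv> - (Gamma (1 + \<gamma>) / (- \<gamma>)) * ((1 + u) powr (- \<gamma>) - u powr (- \<gamma>) - (- \<gamma>) * u powr (- (1 + \<gamma>)))"
  shows "(\<integral>\<^sup>+y. ennreal (y powr (\<gamma> - 1) * exp (- (u * y)) * (exp (- y) - 1 + y)) * indicator {0<..} y \<partial>lborel) = ennreal R"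
    and "R \<ge> 0"
proof -
  define F where "F = (\<lambda>w. Gamma (\<gamma> + 2) * ((1 - w) * (- ((u + w) powr (- \<gamma> - 1)) / (\<gamma> + 1)) + (u + w) powr (- \<gamma>) / ((\<gamma> + 1) * \<gamma>)))"
  have der: "(F has_real_derivative Gamma (\<gamma> + 2) * ((1 - w) * (u + w) powr (- \<gamma> - 2))) (at w)" if w: "0 \<le> w" for w
  proof -
    have uw: "u + w > 0" using u w by simp
    have d: "((\<lambda>w. (u + w) powr e) has_real_derivative e * (u + w) powr (e - 1)) (at w)" for e
      using uw by (auto intro!: derivative_eq_intros simp: powr_diff)
    have "((\<lambda>w. (1 - w) * (- ((u + w) powr (- \<gamma> - 1)) / (\<gamma> + 1)) + (u + w) powr (- \<gamma>) / ((\<gamma> + 1) * \<gamma>)) has_real_derivative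
      ((0 - 1) * (- ((u + w) powr (- \<gamma> - 1)) / (\<gamma> + 1)) + (- ((- \<gamma> - 1) * (u + w) powr (- \<gamma> - 1 - 1)) / (\<gamma> + 1)) * (1 - w) + (- \<gamma> * (u + w) powr (- \<gamma> - 1)) / ((\<gamma> + 1) * \<gamma>))) (at w)"
      by (intro DERIV_add DERIV_mult DERIV_cdivide DERIV_minus d DERIV_diff DERIV_const DERIV_ident)
    moreover have "(0 - 1) * (- ((u + w) powr (- \<gamma> - 1)) / (\<gamma> + 1)) + (- ((- \<gamma> - 1) * (u + w) powr (- \<gamma> - 1 - 1)) / (\<gamma> + 1)) * (1 - w) + (- \<gamma> * (u + w) powr (- \<gamma> - 1)) / ((\<gamma> + 1) * \<gamma>)
      = (1 - w) * (u + w) powr (- \<gamma> - 2)"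
    proof -
      have 1: "- ((- \<gamma> - 1) * X) / (\<gamma> + 1) = X" for X using \<gamma> by (simp add: field_simps)
      have 2: "(0 - 1) * (- X / (\<gamma> + 1)) + (- \<gamma> * X) / ((\<gamma> + 1) * \<gamma>) = 0" for X
      proof -
        have "(- \<gamma> * X) / ((\<gamma> + 1) * \<gamma>) = - (X / (\<gamma> + 1))" using \<gamma> by simp
        then show ?thesis by simp
      qed
      have e2: "- \<gamma> - 1 - 1 = - \<gamma> - 2" by simp
      show ?thesis
        using 2[of "(u + w) powr (- \<gamma> - 1)"] unfolding 1 e2 mult.commute[of "1 - w"] by linarith
    qed
    ultimately show ?thesis unfolding F_def by (intro DERIV_cmult) simp
  qed
  have FR: "F 1 - F 0 = R"
  proof -
    have G: "Gamma (\<gamma> + 2) = (\<gamma> + 1) * Gamma (1 + \<gamma>)"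
    proof -
      have "1 + \<gamma> \<notin> \<int>\<^sub>\<le>\<^sub>0" using \<gamma> nonpos_Ints_nonpos[of "1 + \<gamma>"] by auto
      from Gamma_plus1[OF this] show ?thesis by (simp add: add_ac)
    qed
    have e: "- \<gamma> - 1 = - (1 + \<gamma>)" by simp
    have "F 1 - F 0 = (\<gamma> + 1) * Gamma (1 + \<gamma>) * ((1 + u) powr (- \<gamma>) / ((\<gamma> + 1) * \<gamma>) + u powr (- (1 + \<gamma>)) / (\<gamma> + 1) - u powr (- \<gamma>) / ((\<gamma> + 1) * \<gamma>))"
      unfolding F_def G e by (simp add: algebra_simps)
    also have "\<dots> = R"
    proof -
      have "b * G' * (A / (b * g) + D / b - B / (b * g)) = - (G' / (- g)) * (A - B - (- g) * D)"
        if "b \<noteq> 0" "g \<noteq> 0" for b g G' A B D :: real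
        using that by (simp add: field_simps)
      then show ?thesis unfolding R_def using \<gamma> by simp
    qed
    finally show ?thesis .
  qed
  have G2: "Gamma (\<gamma> + 2) > 0" using \<gamma> by (intro Gamma_real_pos) simp
  have FTC: "(\<integral>\<^sup>+w. ennreal (Gamma (\<gamma> + 2) * ((1 - w) * (u + w) powr (- \<gamma> - 2))) * indicator {0..1} w \<partial>lborel) = ennreal R"
    unfolding FR[symmetric] using G2 by (intro nn_integral_FTC_Icc der) auto
  have "F 0 \<le> F 1"
  proof (rule DERIV_nonneg_imp_increasing_open[where f = F and a = 0 and b = 1])
    show "continuous_on {0..1} F"
      by (rule DERIV_atLeastAtMost_imp_continuous_on) (use der in blast)
    fix w :: real assume w: "0 < w" "w < 1"
    have "(F has_real_derivative Gamma (\<gamma> + 2) * ((1 - w) * (u + w) powr (- \<gamma> - 2))) (at w)"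
      using der[of w] w by simp
    then show "\<exists>y. (F has_real_derivative y) (at w) \<and> 0 \<le> y" using w G2 by (intro exI conjI) auto
  qed auto
  then show "R \<ge> 0" using FR by simp
  have "(\<integral>\<^sup>+y. ennreal (y powr (\<gamma> - 1) * exp (- (u * y)) * (exp (- y) - 1 + y)) * indicator {0<..} y \<partial>lborel)
    = (\<integral>\<^sup>+y. \<integral>\<^sup>+w. ennreal ((1 - w) * (y powr (\<gamma> + 2 - 1) * exp (- ((u + w) * y)))) * indicator {0..1} w * indicator {0<..} y \<partial>lborel \<partial>lborel)"
  proof (intro nn_integral_cong)
    fix y :: real
    show "ennreal (y powr (\<gamma> - 1) * exp (- (u * y)) * (exp (- y) - 1 + y)) * indicator {0<..} y
      = (\<integral>\<^sup>+w. ennreal ((1 - w) * (y powr (\<gamma> + 2 - 1) * exp (- ((u + w) * y)))) * indicator {0..1} w * indicator {0<..} y \<partial>lborel)"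
    proof (cases "y > 0")
      case True
      have "ennreal (y powr (\<gamma> - 1) * exp (- (u * y)) * (exp (- y) - 1 + y))
         = ennreal (y powr (\<gamma> - 1) * exp (- (u * y))) * ennreal (exp (- y) - 1 + y)"
        using exp_remainder_pos[OF True] by (simp add: ennreal_mult)
      also have "\<dots> = (\<integral>\<^sup>+w. ennreal (y powr (\<gamma> - 1) * exp (- (u * y))) * (ennreal ((1 - w) * (y ^ 2 * exp (- (w * y)))) * indicator {0..1} w) \<partial>lborel)"
        unfolding nn_integral_exp_remainder[OF less_imp_le[OF True], symmetric] by (rule nn_integral_cmult[symmetric]) measurable
      also have "\<dots> = (\<integral>\<^sup>+w. ennreal ((1 - w) * (y powr (\<gamma> + 2 - 1) * exp (- ((u + w) * y)))) * indicator {0..1} w \<partial>lborel)"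
      proof (intro nn_integral_cong)
        fix w :: real
        have "y powr (\<gamma> + 2 - 1) = y powr (\<gamma> - 1) * y ^ 2"
          using True by (simp add: powr_add[symmetric] flip: powr_numeral)
        moreover have "exp (- ((u + w) * y)) = exp (- (u * y)) * exp (- (w * y))"
          by (simp add: exp_add[symmetric] algebra_simps)
        ultimately have eq: "(1 - w) * (y powr (\<gamma> + 2 - 1) * exp (- ((u + w) * y))) = (y powr (\<gamma> - 1) * exp (- (u * y))) * ((1 - w) * (y ^ 2 * exp (- (w * y))))"
          by (simp only: mult_ac)
        show "ennreal (y powr (\<gamma> - 1) * exp (- (u * y))) * (ennreal ((1 - w) * (y ^ 2 * exp (- (w * y)))) * indicator {0..1} w)
          = ennreal ((1 - w) * (y powr (\<gamma> + 2 - 1) * exp (- ((u + w) * y)))) * indicator {0..1} w"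
          unfolding eq by (subst ennreal_mult') (simp_all only: mult.assoc mult_nonneg_nonneg powr_ge_zero exp_ge_zero)
      qed
      finally show ?thesis using True by simp
    qed simp
  qed
  also have "\<dots> = (\<integral>\<^sup>+w. \<integral>\<^sup>+y. ennreal ((1 - w) * (y powr (\<gamma> + 2 - 1) * exp (- ((u + w) * y)))) * indicator {0..1} w * indicator {0<..} y \<partial>lborel \<partial>lborel)"
    by (rule lborel_pair.Fubini') measurable
  also have "\<dots> = (\<integral>\<^sup>+w. ennreal (Gamma (\<gamma> + 2) * ((1 - w) * (u + w) powr (- \<gamma> - 2))) * indicator {0..1} w \<partial>lborel)"
  proof (intro nn_integral_cong)
    fix w :: real
    show "(\<integral>\<^sup>+y. ennreal ((1 - w) * (y powr (\<gamma> + 2 - 1) * exp (- ((u + w) * y)))) * indicator {0..1} w * indicator {0<..} y \<partial>lborel)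
      = ennreal (Gamma (\<gamma> + 2) * ((1 - w) * (u + w) powr (- \<gamma> - 2))) * indicator {0..1} w"
    proof (cases "w \<in> {0..1}")
      case True
      have "(\<integral>\<^sup>+y. ennreal ((1 - w) * (y powr (\<gamma> + 2 - 1) * exp (- ((u + w) * y)))) * indicator {0..1} w * indicator {0<..} y \<partial>lborel)
        = (\<integral>\<^sup>+y. ennreal (1 - w) * (ennreal (y powr (\<gamma> + 2 - 1) * exp (- ((u + w) * y))) * indicator {0..} y) \<partial>lborel)"
        using True \<gamma> by (intro nn_integral_cong) (auto simp: ennreal_mult indicator_def)
      also have "\<dots> = ennreal (1 - w) * ennreal (Gamma (\<gamma> + 2) * (u + w) powr (- (\<gamma> + 2)))"
      proof -
        have gs: "(\<integral>\<^sup>+y. ennreal (y powr (\<gamma> + 2 - 1) * exp (- ((u + w) * y))) * indicator {0..} y \<partial>lborel) = ennreal (Gamma (\<gamma> + 2) * (u + w) powr (- (\<gamma> + 2)))"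
          using True \<gamma> u by (intro nn_integral_Gamma_scaled) auto
        show ?thesis unfolding gs[symmetric] by (rule nn_integral_cmult) measurable
      qed
      also have "\<dots> = ennreal (Gamma (\<gamma> + 2) * ((1 - w) * (u + w) powr (- \<gamma> - 2)))"
        using True G2 by (simp add: ennreal_mult[symmetric] mult_ac)
      finally show ?thesis using True by simp
    qed simp
  qed
  also have "\<dots> = ennreal R" by (rule FTC)
  finally show "(\<integral>\<^sup>+y. ennreal (y powr (\<gamma> - 1) * exp (- (u * y)) * (exp (- y) - 1 + y)) * indicator {0<..} y \<partial>lborel) = ennreal R" .
qed

context site_profile
begin

lemma stable_integrand_integrable:
  "integrable lborel (\<lambda>y. indicator {0<..} y * (y powr (- s - 1) * (exp (- y) - 1 + y)))"
proof -
  have "integrable lborel (\<lambda>y. indicator {0<..} y *\<^sub>R (y powr (- s - 1) *\<^sub>R (exp (- (1 * complex_of_real y)) - 1 + 1 * of_real y)))"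
    by (rule jump_integrable[OF _ kernel_bounds]) auto
  also have "(\<lambda>y. indicator {0<..} y *\<^sub>R (y powr (- s - 1) *\<^sub>R (exp (- (1 * complex_of_real y)) - 1 + 1 * of_real y)))
    = (\<lambda>y. complex_of_real (indicator {0<..} y * (y powr (- s - 1) * (exp (- y) - 1 + y))))"
    by (auto simp: fun_eq_iff scaleR_conv_of_real exp_of_real[symmetric])
  finally show ?thesis by (simp only: complex_of_real_integrable_eq)
qed

lemma stable_const_pos: "stable_const > 0"
proof -
  let ?f = "\<lambda>y. indicator {0<..} y * (y powr (- s - 1) * (exp (- y) - 1 + y))"
  have nn: "?f y \<ge> 0" for y
    using exp_remainder_pos[of y] by (auto simp: indicator_def)
  have "integral\<^sup>L lborel ?f \<noteq> 0"
  proof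
    assume "integral\<^sup>L lborel ?f = 0"
    then have "AE y in lborel. ?f y = 0"
      using integral_nonneg_eq_0_iff_AE[OF stable_integrand_integrable] nn by simp
    then have "AE y in lborel. y \<notin> {0<..<1::real}"
      by eventually_elim (use exp_remainder_pos in \<open>force simp: indicator_def\<close>)
    then have "emeasure lborel {0<..<1::real} = 0"
      by (subst (asm) AE_iff_measurable[of "{0<..<1}"]) auto
    then show False by simp
  qed
  moreover have "integral\<^sup>L lborel ?f \<ge> 0" using nn by (intro integral_nonneg_AE) simp
  ultimately show ?thesis unfolding stable_const_def using cvol_pos by simp
qed

text \<open>
Integrate \<open>nn_integral_jump_kernel\<close> at \<open>u = norm x powr \<delta>\<close> over \<open>x\<close> and exchange the integrals:
the integral of \<open>exp (- y * norm x powr \<delta>)\<close> is \<open>cvol * y powr (- a)\<close>.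
\<close>

lemma stable_coeff_eq_stable_const:
  assumes vol: "\<And>y. y > 0 \<Longrightarrow> (\<integral>\<^sup>+x. ennreal (exp (- y * norm x powr \<delta>)) \<partial>(lborel :: (real ^ 'd::finite) measure)) = ennreal (cvol * y powr (- a))"
  shows "stable_coeff TYPE('d) \<gamma> \<delta> = stable_const"
proof -
  define R where "R = (\<lambda>u. - (Gamma (1 + \<gamma>) / (- \<gamma>)) * ((1 + u) powr (- \<gamma>) - u powr (- \<gamma>) - (- \<gamma>) * u powr (- (1 + \<gamma>))))"
  have Rm: "R \<in> borel_measurable borel" unfolding R_def by measurable
  have coeff: "stable_coeff TYPE('d) \<gamma> \<delta> = (LINT x|(lborel :: (real ^ 'd) measure). R (norm x powr \<delta>))"
  proof -
    have "stable_coeff TYPE('d) \<gamma> \<delta> = (LINT x|(lborel :: (real ^ 'd) measure). - (Gamma (1 + \<gamma>) / (- \<gamma>)) * ((1 + norm x powr \<delta>) powr (- \<gamma>) - norm x powr (\<delta> * (- \<gamma>)) - (- \<gamma>) * norm x powr (- \<delta> * (1 + \<gamma>))))"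
      unfolding stable_coeff_def using \<gamma>_neg by simp
    also have "- \<delta> * (1 + \<gamma>) = \<delta> * (- (1 + \<gamma>))" by (metis minus_mult_minus mult_minus_left mult_minus_right)
    also have "(LINT x|(lborel :: (real ^ 'd) measure). - (Gamma (1 + \<gamma>) / (- \<gamma>)) * ((1 + norm x powr \<delta>) powr (- \<gamma>) - norm x powr (\<delta> * (- \<gamma>)) - (- \<gamma>) * norm x powr (\<delta> * (- (1 + \<gamma>)))))
      = (LINT x|(lborel :: (real ^ 'd) measure). R (norm x powr \<delta>))"
      unfolding R_def powr_powr ..
    finally show ?thesis .
  qed
  have AE0: "AE x in (lborel :: (real ^ 'd) measure). x \<noteq> 0" by (rule AE_lborel_singleton)
  have pos: "AE x in (lborel :: (real ^ 'd) measure). 0 \<le> R (norm x powr \<delta>)"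
    using AE0
  proof eventually_elim
    case (elim x)
    show ?case unfolding R_def by (rule nn_integral_jump_kernel(2)[OF exponent_facts(1) \<gamma>_neg]) (use elim in simp)
  qed
  have "(\<integral>\<^sup>+x. ennreal (R (norm x powr \<delta>)) \<partial>(lborel :: (real ^ 'd) measure))
     = (\<integral>\<^sup>+x. \<integral>\<^sup>+y. ennreal (y powr (\<gamma> - 1) * exp (- (norm x powr \<delta> * y)) * (exp (- y) - 1 + y)) * indicator {0<..} y \<partial>lborel \<partial>(lborel :: (real ^ 'd) measure))"
    using AE0
  proof (intro nn_integral_cong_AE, eventually_elim)
    case (elim x)
    then have "norm x powr \<delta> > 0" by simp
    from nn_integral_jump_kernel(1)[OF exponent_facts(1) \<gamma>_neg this] show ?case unfolding R_def by simp
  qed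
  also have "\<dots> = (\<integral>\<^sup>+y. \<integral>\<^sup>+x. ennreal (y powr (\<gamma> - 1) * exp (- (norm x powr \<delta> * y)) * (exp (- y) - 1 + y)) * indicator {0<..} y \<partial>(lborel :: (real ^ 'd) measure) \<partial>lborel)"
    by (rule lborel_pair.Fubini') measurable
  also have "\<dots> = (\<integral>\<^sup>+y. ennreal (cvol * (indicator {0<..} y * (y powr (- s - 1) * (exp (- y) - 1 + y)))) \<partial>lborel)"
  proof (intro nn_integral_cong)
    fix y :: real
    show "(\<integral>\<^sup>+x. ennreal (y powr (\<gamma> - 1) * exp (- (norm x powr \<delta> * y)) * (exp (- y) - 1 + y)) * indicator {0<..} y \<partial>(lborel :: (real ^ 'd) measure))
      = ennreal (cvol * (indicator {0<..} y * (y powr (- s - 1) * (exp (- y) - 1 + y))))"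
    proof (cases "y > 0")
      case True
      define q where "q = y powr (\<gamma> - 1) * (exp (- y) - 1 + y)"
      have q: "q \<ge> 0" using exp_remainder_pos[OF True] by (simp add: q_def)
      have "(\<integral>\<^sup>+x. ennreal (y powr (\<gamma> - 1) * exp (- (norm x powr \<delta> * y)) * (exp (- y) - 1 + y)) * indicator {0<..} y \<partial>(lborel :: (real ^ 'd) measure))
        = (\<integral>\<^sup>+x. ennreal q * ennreal (exp (- y * norm x powr \<delta>)) \<partial>(lborel :: (real ^ 'd) measure))"
        using True q by (intro nn_integral_cong) (simp add: q_def ennreal_mult[symmetric] mult_ac)
      also have "\<dots> = ennreal q * ennreal (cvol * y powr (- a))"
        by (subst nn_integral_cmult) (auto simp: vol[OF True, simplified])
      also have "\<dots> = ennreal (cvol * (y powr (\<gamma> - 1) * y powr (- a)) * (exp (- y) - 1 + y))"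
        using q cvol_pos by (simp add: ennreal_mult[symmetric] q_def mult_ac)
      also have "y powr (\<gamma> - 1) * y powr (- a) = y powr (- s - 1)"
      proof -
        have e: "(\<gamma> - 1) + (- a) = - s - 1" by (simp add: s_def)
        show ?thesis unfolding powr_add[symmetric] e ..
      qed
      finally show ?thesis using True by (simp add: mult.assoc)
    qed simp
  qed
  also have "\<dots> = ennreal stable_const"
    unfolding stable_const_def integral_mult_right_zero[symmetric]
  proof (rule nn_integral_eq_integral)
    show "integrable lborel (\<lambda>y. cvol * (indicator {0<..} y * (y powr (- s - 1) * (exp (- y) - 1 + y))))"
      by (intro integrable_mult_right stable_integrand_integrable)
    show "AE y in lborel. 0 \<le> cvol * (indicator {0<..} y * (y powr (- s - 1) * (exp (- y) - 1 + y)))"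
    proof (rule AE_I2)
      fix y :: real
      have "0 \<le> indicator {0<..} y * (y powr (- s - 1) * (exp (- y) - 1 + y))"
        using exp_remainder_pos[of y] by (auto simp: indicator_def)
      then show "0 \<le> cvol * (indicator {0<..} y * (y powr (- s - 1) * (exp (- y) - 1 + y)))"
        by (rule mult_nonneg_nonneg[OF less_imp_le[OF cvol_pos]])
    qed
  qed
  finally have nn: "(\<integral>\<^sup>+x. ennreal (R (norm x powr \<delta>)) \<partial>(lborel :: (real ^ 'd) measure)) = ennreal stable_const" .
  have m: "(\<lambda>x :: real ^ 'd. R (norm x powr \<delta>)) \<in> borel_measurable lborel"
    using Rm by measurable
  show ?thesis
    unfolding coeff integral_eq_nn_integral[OF m pos] nn using stable_const_pos by simp
qed

end

section \<open>Fluctuations of the condensate\<close>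

context site_profile
begin

text \<open>
For the model the ratio is \<open>rho_crit_scaled\<close> and the limit is \<open>rho_crit\<close>.
\<close>

lemma mean_limit:
  assumes L: "\<And>k. L k > 0" "filterlim L at_top sequentially"
  shows "(\<lambda>k. mean (L k) / L k powr (\<delta> * a)) \<longlonglongrightarrow> cvol * (\<Sum>j. real j powr (- s))"
proof -
  obtain K where K: "K > 0" "\<And>v. v > 0 \<Longrightarrow> \<Theta> v \<le> K * v powr (- a)"
    using \<Theta>_bound[OF order_refl] by blast
  define f where "f = (\<lambda>k j. real j * rate (L k) j / L k powr (\<delta> * a))"
  have f_eq: "f k j = real j powr (- s) * ((real j / L k powr \<delta>) powr a * \<Theta> (real j / L k powr \<delta>))" if j: "j \<noteq> 0" for k j
  proof -
    have "(real j / L k powr \<delta>) powr a = real j powr a / L k powr (\<delta> * a)"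
      using L(1)[of k] by (simp add: powr_divide powr_powr)
    moreover have "real j * real j powr (\<gamma> - 1) = real j powr (- s) * real j powr a"
    proof -
      have e: "- s + a = \<gamma>" by (simp add: s_def)
      have "real j * real j powr (\<gamma> - 1) = real j powr \<gamma>" using j by (simp add: powr_diff)
      then show ?thesis unfolding powr_add[symmetric] e .
    qed
    ultimately show ?thesis by (simp add: f_def rate_def mult.assoc[symmetric])
  qed
  have "(\<lambda>k. \<Sum>j. f k j) \<longlonglongrightarrow> (\<Sum>j. cvol * real j powr (- s))"
  proof (rule tendsto_suminf_dominated)
    show "summable (\<lambda>j. K * real j powr (- s))"
      using exponent_facts by (intro summable_mult) (simp add: summable_real_powr_iff)
    have "norm (f k j) \<le> K * real j powr (- s)" for k j
    proof (cases "j = 0")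
      case False
      define v where "v = real j / L k powr \<delta>"
      have v: "v > 0" using False L(1)[of k] by (simp add: v_def)
      have "v powr a * \<Theta> v \<le> v powr a * (K * v powr (- a))" by (intro mult_left_mono K v) auto
      also have "\<dots> = K * (v powr a * v powr (- a))" by (simp only: mult_ac)
      also have "v powr a * v powr (- a) = 1" using v by (simp add: powr_add[symmetric])
      finally have "real j powr (- s) * (v powr a * \<Theta> v) \<le> real j powr (- s) * (K * 1)"
        by (intro mult_left_mono) auto
      moreover have "f k j \<ge> 0" using rate_nonneg[OF L(1)] by (simp add: f_def)
      ultimately show ?thesis unfolding f_eq[OF False] v_def[symmetric] by (simp add: mult.commute)
    qed (simp add: f_def)
    then show "eventually (\<lambda>k. \<forall>j. norm (f k j) \<le> K * real j powr (- s)) sequentially" by simp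
    show "(\<lambda>k. f k j) \<longlonglongrightarrow> cvol * real j powr (- s)" for j
    proof (cases "j = 0")
      case False
      have Lp: "filterlim (\<lambda>k. L k powr \<delta>) at_top sequentially"
        by (rule filterlim_compose[OF _ L(2)]) (use \<delta>_pos in real_asymp)
      have "(\<lambda>k. real j / L k powr \<delta>) \<longlonglongrightarrow> 0"
        by (intro tendsto_divide_0[OF tendsto_const] filterlim_at_top_imp_at_infinity Lp)
      then have "filterlim (\<lambda>k. real j / L k powr \<delta>) (at_right 0) sequentially"
      proof (rule tendsto_imp_filterlim_at_right)
        have "real j / L k powr \<delta> > 0" for k using False L(1)[of k] by simp
        then show "eventually (\<lambda>k. real j / L k powr \<delta> > 0) sequentially" by simp
      qed
      then have "(\<lambda>k. (real j / L k powr \<delta>) powr a * \<Theta> (real j / L k powr \<delta>)) \<longlonglongrightarrow> cvol"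
        by (rule filterlim_compose[OF \<Theta>_asymp])
      then have "(\<lambda>k. real j powr (- s) * ((real j / L k powr \<delta>) powr a * \<Theta> (real j / L k powr \<delta>))) \<longlonglongrightarrow> real j powr (- s) * cvol"
        by (intro tendsto_intros)
      then show ?thesis using f_eq[OF False] by (simp add: mult.commute)
    qed (simp add: f_def)
  qed simp
  moreover have "(\<Sum>j. f k j) = mean (L k) / L k powr (\<delta> * a)" for k
    unfolding f_def mean_def by (rule suminf_divide[OF summable_rate_1[OF L(1)]])
  moreover have "(\<Sum>j. cvol * real j powr (- s)) = cvol * (\<Sum>j. real j powr (- s))"
    using exponent_facts by (intro suminf_mult) (simp add: summable_real_powr_iff)
  ultimately show ?thesis by simp
qed

end

lemma infsum_from_1:
  fixes f :: "nat \<Rightarrow> real"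
  assumes "f 0 = 0" "summable (\<lambda>j. norm (f j))"
  shows "(\<Sum>\<^sub>\<infinity>j\<in>{1..}. f j) = (\<Sum>j. f j)"
proof -
  have "(f has_sum (\<Sum>j. f j)) UNIV"
    using assms(2) by (intro norm_summable_imp_has_sum summable_sums) (auto intro: summable_norm_cancel)
  then have "(\<Sum>\<^sub>\<infinity>j. f j) = (\<Sum>j. f j)" by (rule infsumI)
  moreover have "(\<Sum>\<^sub>\<infinity>j\<in>{1..}. f j) = (\<Sum>\<^sub>\<infinity>j. f j)"
  proof (rule infsum_cong_neutral)
    fix j :: nat assume "j \<in> UNIV - {1..}"
    then have "j = 0" by simp
    then show "f j = 0" using assms(1) by simp
  qed auto
  ultimately show ?thesis by simp
qed

theorem theorem6p6:
  fixes V :: "real ^ 'd::finite \<Rightarrow> real"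
    and \<theta> :: "nat \<Rightarrow> real"
    and \<delta> \<gamma> \<rho> \<alpha> :: real
  assumes V: "\<And>x. V x = norm x powr \<delta>" and \<delta>: "\<delta> > 0"
    and \<theta>: "\<And>j. j \<ge> 1 \<Longrightarrow> \<theta> j = real j powr \<gamma>" and \<gamma>: "\<gamma> < 0"
    and dim: "1 < real CARD('d) / \<delta>" "real CARD('d) / \<delta> < \<gamma> + 2"
    and \<rho>: "\<rho> > rho_crit \<theta> V"
    and \<alpha>: "\<alpha> = \<delta> / (1 - \<delta> * \<gamma> / real CARD('d))"
  shows "stable_coeff TYPE('d) \<gamma> \<delta> > 0 \<and>
    (\<exists>\<mu>. stable_distribution \<mu> \<and>
      (\<forall>t\<ge>0. integrable \<mu> (\<lambda>z. exp (t * z)) \<and>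
        (\<integral>z. exp (t * z) \<partial>\<mu>) =
          exp (stable_coeff TYPE('d) \<gamma> \<delta> * t powr (\<bar>\<gamma>\<bar> + real CARD('d) / \<delta>))) \<and>
      (\<forall>(n :: nat \<Rightarrow> nat) (L :: nat \<Rightarrow> real).
        filterlim n at_top sequentially \<longrightarrow> filterlim L at_top sequentially \<longrightarrow>
        (\<forall>k. real (n k) = \<rho> * L k ^ CARD('d)) \<longrightarrow>
        weak_conv_m
          (\<lambda>k. distr (spatial_measure \<theta> V (L k) (n k)) borel
            (\<lambda>p. (real (occupation p 0) - (\<rho> - rho_crit_scaled \<theta> V (L k)) * L k ^ CARD('d))
                 / L k powr \<alpha>))
          \<mu>))"
proof -
  let ?a = "real CARD('d) / \<delta>" and ?c = "volume_const TYPE('d) \<delta>"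
  interpret P: site_profile "site_sum TYPE('d) \<delta>" \<gamma> \<delta> ?a ?c
  proof
    show "\<exists>K>0. \<forall>v>0. site_sum TYPE('d) \<delta> v \<le> K * v powr (- p)" if "?a \<le> p" for p
      using site_sum_bound[OF \<delta> that] by blast
  qed (use \<delta> \<gamma> dim in \<open>auto intro: site_sum_nonneg site_sum_asymp site_sum_exp_le volume_const_pos\<close>)
  have da: "\<delta> * ?a = real CARD('d)" using \<delta> by simp
  have s: "\<bar>\<gamma>\<bar> + ?a = P.s" using \<gamma> by (simp add: P.s_def)
  have \<alpha>_eq: "P.\<alpha> = \<alpha>"
  proof -
    have d: "real CARD('d) > 0" by simp
    have "1 - \<delta> * \<gamma> / real CARD('d) = \<delta> * P.s / real CARD('d)"
      using \<delta> d by (simp add: P.s_def field_simps)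
    then show ?thesis using \<delta> d P.exponent_facts(2) by (simp add: \<alpha> P.\<alpha>_def da)
  qed
  have coeff: "stable_coeff TYPE('d) \<gamma> \<delta> = P.stable_const"
    by (rule P.stable_coeff_eq_stable_const) (rule nn_integral_exp_norm[OF \<delta>])
  obtain \<mu> where \<mu>: "real_distribution \<mu>" "\<And>t. char \<mu> t = exp (P.\<Psi> (\<i> * of_real t))"
    "\<And>L. (\<And>k. L k > 0) \<Longrightarrow> filterlim L at_top sequentially \<Longrightarrow> weak_conv_m (\<lambda>k. P.site_law (L k)) \<mu>"
    using P.limit_law_exists by blast
  have moments: "integrable \<mu> (\<lambda>z. exp (t * z)) \<and> (\<integral>z. exp (t * z) \<partial>\<mu>) = exp (stable_coeff TYPE('d) \<gamma> \<delta> * t powr (\<bar>\<gamma>\<bar> + ?a))"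
    if t: "t \<ge> 0" for t
  proof -
    define L0 where "L0 = (\<lambda>k. real (Suc k))"
    have L0: "\<And>k. L0 k > 0" "filterlim L0 at_top sequentially"
      unfolding L0_def by (simp, rule filterlim_compose[OF filterlim_real_sequentially filterlim_Suc])
    show ?thesis
      unfolding s coeff
      using weak_conv_exp_moment[OF P.real_distribution_site_law \<mu>(1) \<mu>(3)[OF L0] P.site_law_real_exp(1)[OF L0(1)] P.site_law_real_exp_limit[OF L0] t]
      by blast
  qed
  have conv: "weak_conv_m
          (\<lambda>k. distr (spatial_measure \<theta> V (L k) (n k)) borel
            (\<lambda>p. (real (occupation p 0) - (\<rho> - rho_crit_scaled \<theta> V (L k)) * L k ^ CARD('d)) / L k powr \<alpha>)) \<mu>"
    if L: "filterlim L at_top sequentially" and n: "\<And>k. real (n k) = \<rho> * L k ^ CARD('d)" for n :: "nat \<Rightarrow> nat" and L :: "nat \<Rightarrow> real"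
  proof -
    \<comment> \<open>the scales are positive only eventually, while the lemmas ask for positive ones throughout\<close>
    define L' where "L' = (\<lambda>k. max (L k) 1)"
    have L'pos: "L' k > 0" for k by (simp add: L'_def)
    have evL: "eventually (\<lambda>k. L k \<ge> 1) sequentially" using L by (simp add: filterlim_at_top)
    then have ev: "eventually (\<lambda>k. L' k = L k) sequentially" by eventually_elim (simp add: L'_def)
    have L'lim: "filterlim L' at_top sequentially"
      by (rule filterlim_at_top_mono[OF L]) (simp add: L'_def)
    have site: "real j * V (scaled_site \<Lambda> x) = real j / \<Lambda> powr \<delta> * norm (real_site x) powr \<delta>" if "\<Lambda> > 0" for j \<Lambda> and x :: "int ^ 'd"
      using that by (simp add: V norm_scaled_site powr_divide)
    have rc: "rho_crit_scaled \<theta> V \<Lambda> * \<Lambda> ^ CARD('d) = P.mean \<Lambda>" if \<Lambda>: "\<Lambda> > 0" for \<Lambda>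
    proof -
      have "(\<Sum>\<^sub>\<infinity>j\<in>{1..}. \<Sum>\<^sub>\<infinity>x\<in>UNIV - {0 :: int ^ 'd}. \<theta> j * exp (- real j * V (scaled_site \<Lambda> x))) = (\<Sum>\<^sub>\<infinity>j\<in>{1..}. real j * P.rate \<Lambda> j)"
      proof (rule infsum_cong)
        fix j :: nat assume "j \<in> {1..}"
        then have j: "j \<ge> 1" by simp
        have v: "real j / \<Lambda> powr \<delta> > 0" using j \<Lambda> by simp
        have "(\<Sum>\<^sub>\<infinity>x\<in>UNIV - {0 :: int ^ 'd}. \<theta> j * exp (- real j * V (scaled_site \<Lambda> x)))
          = (\<Sum>\<^sub>\<infinity>x\<in>- {0 :: int ^ 'd}. \<theta> j * exp (- (real j / \<Lambda> powr \<delta>) * norm (real_site x) powr \<delta>))"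
          using site[OF \<Lambda>, of j] by (intro infsum_cong_neutral) auto
        also have "\<dots> = \<theta> j * site_sum TYPE('d) \<delta> (real j / \<Lambda> powr \<delta>)"
          by (rule infsumI) (rule has_sum_cmult_right[OF site_sum_has_sum[OF \<delta> v]])
        also have "\<dots> = real j * P.rate \<Lambda> j"
          using j by (simp add: \<theta> P.rate_def powr_diff)
        finally show "(\<Sum>\<^sub>\<infinity>x\<in>UNIV - {0 :: int ^ 'd}. \<theta> j * exp (- real j * V (scaled_site \<Lambda> x))) = real j * P.rate \<Lambda> j" .
      qed
      also have "\<dots> = P.mean \<Lambda>"
        unfolding P.mean_def using P.summable_rate_1[OF \<Lambda>] P.rate_nonneg[OF \<Lambda>] by (intro infsum_from_1) auto
      finally show ?thesis using \<Lambda> by (simp add: rho_crit_scaled_def)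
    qed
    have rho: "rho_crit \<theta> V = ?c * (\<Sum>j. real j powr (- P.s))"
    proof -
      have "rho_crit \<theta> V = (\<Sum>\<^sub>\<infinity>j\<in>{1..}. ?c * real j powr (- P.s))"
        unfolding rho_crit_def
      proof (rule infsum_cong)
        fix j :: nat assume "j \<in> {1..}"
        then have j: "j \<ge> 1" by simp
        have "(\<integral>x. exp (- real j * V x) \<partial>lborel) = enn2real (\<integral>\<^sup>+x. ennreal (exp (- real j * norm x powr \<delta>)) \<partial>(lborel :: (real ^ 'd) measure))"
          unfolding V by (rule integral_eq_nn_integral) auto
        also have "\<dots> = ?c * real j powr (- ?a)"
          using j volume_const_pos[OF \<delta>, where 'd = 'd] by (subst nn_integral_exp_norm[OF \<delta>]) auto
        finally have "(\<integral>x. exp (- real j * V x) \<partial>lborel) = ?c * real j powr (- ?a)" .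
        moreover have "real j powr \<gamma> * real j powr (- ?a) = real j powr (- P.s)"
          by (simp add: powr_add[symmetric] P.s_def)
        ultimately show "\<theta> j * (\<integral>x. exp (- real j * V x) \<partial>lborel) = ?c * real j powr (- P.s)"
          using \<theta>[OF j] by (simp add: mult_ac)
      qed
      also have "\<dots> = (\<Sum>j. ?c * real j powr (- P.s))"
        using P.exponent_facts volume_const_pos[OF \<delta>, where 'd = 'd]
        by (intro infsum_from_1) (auto intro!: summable_mult simp: summable_real_powr_iff abs_mult)
      also have "\<dots> = ?c * (\<Sum>j. real j powr (- P.s))"
        using P.exponent_facts by (intro suminf_mult) (simp add: summable_real_powr_iff)
      finally show ?thesis .
    qed
    have pw: "\<Lambda> powr (\<delta> * ?a) = \<Lambda> ^ CARD('d)" if "\<Lambda> > 0" for \<Lambda> :: real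
      unfolding da using that by (rule powr_realpow)
    have \<kappa>: "(\<lambda>k. (real (n k) - P.mean (L' k)) / L' k powr (\<delta> * ?a)) \<longlonglongrightarrow> \<rho> - rho_crit \<theta> V"
    proof (rule Lim_transform_eventually)
      show "(\<lambda>k. \<rho> - P.mean (L' k) / L' k powr (\<delta> * ?a)) \<longlonglongrightarrow> \<rho> - rho_crit \<theta> V"
        unfolding rho by (intro tendsto_diff tendsto_const P.mean_limit L'pos L'lim)
      show "eventually (\<lambda>k. \<rho> - P.mean (L' k) / L' k powr (\<delta> * ?a) = (real (n k) - P.mean (L' k)) / L' k powr (\<delta> * ?a)) sequentially"
        using ev
      proof eventually_elim
        case (elim k)
        have nz: "L' k ^ CARD('d) \<noteq> 0" using L'pos[of k] by simp
        show ?case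
          unfolding pw[OF L'pos] n elim[symmetric] diff_divide_distrib nonzero_mult_div_cancel_right[OF nz] ..
      qed
    qed
    show ?thesis
      unfolding weak_conv_m_def weak_conv_def
    proof (intro allI impI)
      fix x assume "isCont (cdf \<mu>) x"
      then have lim: "(\<lambda>k. cdf (P.site_law (L' k)) x) \<longlonglongrightarrow> cdf \<mu> x"
        using \<mu>(3)[OF L'pos L'lim] by (simp add: weak_conv_m_def weak_conv_def)
      define r where "r = (\<lambda>k. (\<Sum>m | m \<le> n k \<and> (real m - (real (n k) - P.mean (L' k))) / L' k powr P.\<alpha> \<le> x. P.origin_coeff m * P.jumps (L' k) (n k - m))
      / (\<Sum>m\<le>n k. P.origin_coeff m * P.jumps (L' k) (n k - m)))"
      have "(\<lambda>k. r k - cdf (P.site_law (L' k)) x) \<longlonglongrightarrow> 0"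
        unfolding r_def by (rule P.origin_law_close[OF L'pos L'lim _ \<kappa>]) (use \<rho> in simp)
      from tendsto_add[OF this lim] have rlim: "r \<longlonglongrightarrow> cdf \<mu> x" by simp
      have "eventually (\<lambda>k. r k = cdf (distr (spatial_measure \<theta> V (L k) (n k)) borel
            (\<lambda>p. (real (occupation p 0) - (\<rho> - rho_crit_scaled \<theta> V (L k)) * L k ^ CARD('d)) / L k powr \<alpha>)) x) sequentially"
        using ev
      proof eventually_elim
        case (elim k)
        define \<Lambda> where "\<Lambda> = L k"
        have \<Lambda>: "\<Lambda> > 0" "L' k = \<Lambda>" "L k = \<Lambda>" using elim L'pos[of k] by (auto simp: \<Lambda>_def)
        have m0: "(\<rho> - rho_crit_scaled \<theta> V \<Lambda>) * \<Lambda> ^ CARD('d) = real (n k) - P.mean \<Lambda>"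
          using n[of k] rc[OF \<Lambda>(1)] by (simp add: \<Lambda>(3) left_diff_distrib)
        let ?f = "\<lambda>p. (real (occupation p 0) - (real (n k) - P.mean \<Lambda>)) / \<Lambda> powr \<alpha>"
        let ?M = "spatial_measure \<theta> V \<Lambda> (n k)"
        have sp: "space ?M = spatial_partitions (n k)" by (simp add: spatial_measure_def space_point_measure)
        have fm: "?f \<in> measurable ?M borel" by (simp add: spatial_measure_def)
        have "cdf (distr ?M borel ?f) x = measure ?M {p \<in> spatial_partitions (n k). ?f p \<le> x}"
          unfolding cdf_def by (subst measure_distr[OF fm]) (auto simp: sp intro!: arg_cong[where f = "measure ?M"])
        also have "\<dots> = (\<Sum>m | m \<le> n k \<and> (real m - (real (n k) - P.mean \<Lambda>)) / \<Lambda> powr \<alpha> \<le> x. P.origin_coeff m * P.jumps \<Lambda> (n k - m))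
          / (\<Sum>m\<le>n k. P.origin_coeff m * P.jumps \<Lambda> (n k - m))"
          unfolding P.jumps_def
        proof (rule occupation_law)
          show "0 \<le> \<theta> j" if "1 \<le> j" for j using \<theta>[OF that] by simp
          show "real j powr \<gamma> = \<theta> j * exp (- real j * V 0)" if "1 \<le> j" for j
            using \<theta>[OF that] \<delta> by (simp add: V)
          show "0 \<le> real j * P.rate \<Lambda> j" for j using P.rate_nonneg[OF \<Lambda>(1)] by simp
          show "(\<integral>\<^sup>+x. ennreal (\<theta> j * exp (- real j * V (scaled_site \<Lambda> x))) \<partial>count_space (- {0})) = ennreal (real j * P.rate \<Lambda> j)"
            if j: "1 \<le> j" for j
          proof -
            have v: "real j / \<Lambda> powr \<delta> > 0" using j \<Lambda> by simp
            have "(\<integral>\<^sup>+x. ennreal (\<theta> j * exp (- real j * V (scaled_site \<Lambda> x))) \<partial>count_space (- {0}))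
               = (\<integral>\<^sup>+x. ennreal (real j powr \<gamma>) * ennreal (exp (- (real j / \<Lambda> powr \<delta>) * norm (real_site x) powr \<delta>)) \<partial>count_space (- {0 :: int ^ 'd}))"
              using \<theta>[OF j] site[OF \<Lambda>(1), of j] by (intro nn_integral_cong) (simp add: ennreal_mult)
            also have "\<dots> = ennreal (real j powr \<gamma>) * ennreal (site_sum TYPE('d) \<delta> (real j / \<Lambda> powr \<delta>))"
              unfolding nn_integral_site_sum[OF \<delta> v, symmetric] by (rule nn_integral_cmult) simp
            also have "\<dots> = ennreal (real j * P.rate \<Lambda> j)"
              using j site_sum_nonneg[OF \<delta> v, where 'd = 'd] by (simp add: ennreal_mult[symmetric] P.rate_def powr_diff)
            finally show ?thesis .
          qed
        qed
        finally show ?case unfolding r_def \<Lambda> m0 \<alpha>_eq ..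
      qed
      from Lim_transform_eventually[OF rlim this]
      show "(\<lambda>k. cdf (distr (spatial_measure \<theta> V (L k) (n k)) borel
            (\<lambda>p. (real (occupation p 0) - (\<rho> - rho_crit_scaled \<theta> V (L k)) * L k ^ CARD('d)) / L k powr \<alpha>)) x) \<longlonglongrightarrow> cdf \<mu> x" .
    qed
  qed
  show ?thesis
  proof (intro conjI exI[of _ \<mu>] allI impI)
    show "stable_coeff TYPE('d) \<gamma> \<delta> > 0" using P.stable_const_pos coeff by simp
    show "stable_distribution \<mu>" by (rule P.stable_limit_law[OF \<mu>(1,2)])
  next
    fix t :: real assume "t \<ge> 0"
    from moments[OF this] show "integrable \<mu> (\<lambda>z. exp (t * z))"
      and "(\<integral>z. exp (t * z) \<partial>\<mu>) = exp (stable_coeff TYPE('d) \<gamma> \<delta> * t powr (\<bar>\<gamma>\<bar> + ?a))"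
      by auto
  next
    fix n :: "nat \<Rightarrow> nat" and L :: "nat \<Rightarrow> real"
    assume "filterlim L at_top sequentially" "\<forall>k. real (n k) = \<rho> * L k ^ CARD('d)"
    then show "weak_conv_m
          (\<lambda>k. distr (spatial_measure \<theta> V (L k) (n k)) borel
            (\<lambda>p. (real (occupation p 0) - (\<rho> - rho_crit_scaled \<theta> V (L k)) * L k ^ CARD('d)) / L k powr \<alpha>)) \<mu>"
      by (intro conv) auto
  qed
qed

end
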